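(* Let $(M,c)$ be a conformal manifold and $N\subset M$ a submanifold of dimension $n$, $1\le n<m=\dim M$, such that $m\ge3$, or $m=2$ and $M$ is endowed with a fixed M\"obius structure $\mathcal M$. Then the mixed Schouten-Weyl tensor $\mu:TN\to\nu^*$, $$\mu_X(\xi):=h^\nabla(X,\xi)-(\nabla_XH^\nabla)(\xi)+\frac1{n-1}(\delta^\nabla B_0)(X)(\xi),\qquad X\in TN,\ \xi\in\nu,$$ is independent of the Weyl structure $\nabla$ on $M$ used to compute the Schouten-Weyl tensor $h^\nabla$, the mean curvature $H^\nabla$ and the codifferential $$(\delta^\nabla B_0)(X):=\mathrm{tr}^c_{TN}\big((\nabla_\cdot B_0)(X,\cdot)\big).$$ Here $\nabla H^\nabla$ and $\nabla B_0$ are the covariant derivatives induced by $\nabla$ on $\nu$ (and its dual), respectively on $S^2_0T^*N\otimes\nu$. For $n=1$ the convention is to omit the term in $\delta^\nabla B_0$.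
   Context: All objects are smooth. On an $m$-manifold $M$, for $k\in\mathbb R$, $L^k$ is the oriented real line bundle associated with the frame bundle and the representation $|\det|^{k/m}$. A conformal structure $c$ is a positive-definite section of $S^2T^*M\otimes L^2$, normalized by $|\det c|=1$; equivalently it is the conformal class of metrics $l^{-2}c$, for $l$ a positive section of $L$. Via $c$, $T^*M\cong TM\otimes L^{-2}$; inner products and traces $\mathrm{tr}_c$ are taken with these weights. A Weyl structure $\nabla$ is a torsion-free connection on $TM$ with $\nabla c=0$ (with the induced connection on $L$). $F^\nabla\in\Lambda^2T^*M$ (Faraday form) is the curvature of the connection induced by $\nabla$ on $L$. Put $R^\nabla_{X,Y}Z=\nabla_X\nabla_YZ-\nabla_Y\nabla_XZ-\nabla_{[X,Y]}Z$, $\mathrm{Ric}^\nabla(X,Y)=\mathrm{tr}(Z\mapsto R^\nabla_{Z,X}Y)$, $\mathrm{Scal}^\nabla=\mathrm{tr}_c\mathrm{Ric}^\nabla$, and $\sigma^\nabla=\frac{1}{2(m-1)}\mathrm{Scal}^\nabla$. Schouten-Weyl tensor $h^\nabla\in T^*M\otimes T^*M$. For $m\ge3$: $h^\nabla=\frac1{m-2}\mathrm{Ric}^{\nabla,s}_0+\frac1m\sigma^\nabla c-\frac12F^\nabla$, where $\mathrm{Ric}^{\nabla,s}_0$ is the symmetric trace-free part of $\mathrm{Ric}^\nabla$. For sections $l$ of $L$, $\mathrm{Hess}^\nabla(X,Y)l=\nabla_X\nabla_Yl-\nabla_{\nabla_XY}l$, and $\mathrm{Hess}^\nabla_0$ is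 its symmetric trace-free part. A M\"obius structure is a linear second order differential operator $\mathcal M:C^\infty(L)\to C^\infty(S^2_0T^*M\otimes L)$ such that $\mathcal M-\mathrm{Hess}_0^\nabla$ is of order zero for some (hence every) Weyl structure $\nabla$. If $m=2$ and $\mathcal M$ is fixed: $h^\nabla=h_0^{\mathcal M,\nabla}+\frac12\sigma^\nabla c-\frac12F^\nabla$ with $h_0^{\mathcal M,\nabla}:=\mathcal M-\mathrm{Hess}^\nabla_0$. Submanifolds. $N^n\subset M^m$ carries the induced conformal structure $c$; $\nu$ is its normal bundle, $TM|_N=TN\oplus\nu$, with components denoted by $(\cdot)^N,(\cdot)^\perp$. For a Weyl structure $\nabla$ on $M$: $\nabla^N_XY=(\nabla_XY)^N$ is the induced Weyl structure on $N$; $\nabla^\perp_X\xi=(\nabla_X\xi)^\perp$ is the induced connection on $\nu$ (the connections on $\nu^*$ and $S^2_0T^*N\otimes\nu$ are built from these); $B^\nabla(X,Y)=(\nabla_XY)^\perp$ ($X,Y\in TN$) is the fundamental form; $H^\nabla\in\nu^*\cong\nu\otimes L^{-2}$, $H^\nabla(\xi)=-\frac1n\mathrm{tr}(X\mapsto(\nabla_X\xi)^N)$, is the mean curvature; $B^\nabla=H^\nabla\cdot c+B_0$ with $B_0\in S^2_0T^*N\otimes\nu$ trace-free, independent of $\nabla$. The trace $(\delta^\nabla B_0)(X)$ lies in $\nu\otimes L^{-2}\cong\nu^*$. *)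

theory Defs
  imports "HOL-Analysis.Analysis"
begin

section \<open>Smooth maps and smooth manifolds\<close>

text \<open>For open \<open>S\<close> only: \<open>f\<close> is of class \<open>C^k\<close> on \<open>S\<close>.\<close>

primrec Ck_on :: "nat \<Rightarrow> 'x::real_normed_vector set \<Rightarrow> ('x \<Rightarrow> 'y::real_normed_vector) \<Rightarrow> bool"
  where
    "Ck_on 0 S f \<longleftrightarrow> continuous_on S f"
  | "Ck_on (Suc k) S f \<longleftrightarrow>
       (\<forall>x\<in>S. f differentiable (at x)) \<and>
       (\<forall>v. Ck_on k S (\<lambda>x. frechet_derivative f (at x) v))"

definition smooth_on :: "'x::real_normed_vector set \<Rightarrow> ('x \<Rightarrow> 'y::real_normed_vector) \<Rightarrow> bool"
  where "smooth_on S f \<longleftrightarrow> (\<forall>k. Ck_on k S f)"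

text \<open>A chart \<open>(U, \<phi>)\<close> on a space \<open>'a\<close>; the map \<open>\<phi>\<close> is meaningful only on \<open>U\<close>.\<close>

type_synonym ('a, 'm) chart = "'a set \<times> ('a \<Rightarrow> real ^ 'm)"

text \<open>Operators on vector fields \<open>X, Y \<mapsto> \<nabla>\<^sub>X Y\<close>, and from densities to (density valued) bilinear
  forms; the fibres are represented as explained below.\<close>

type_synonym ('a, 'm) connection_op =
  "('a \<Rightarrow> real ^ 'm) \<Rightarrow> ('a \<Rightarrow> real ^ 'm) \<Rightarrow> 'a \<Rightarrow> real ^ 'm"

type_synonym ('a, 'm) density_op =
  "('a \<Rightarrow> real) \<Rightarrow> 'a \<Rightarrow> real ^ 'm \<Rightarrow> real ^ 'm \<Rightarrow> real"

definition inv_chart :: "('a, 'm::finite) chart \<Rightarrow> real ^ 'm \<Rightarrow> 'a"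
  where "inv_chart a = inv_into (fst a) (snd a)"

definition is_chart :: "('a::topological_space, 'm::finite) chart \<Rightarrow> bool"
  where "is_chart a \<longleftrightarrow>
    open (fst a) \<and> open (snd a ` fst a) \<and>
    homeomorphism (fst a) (snd a ` fst a) (snd a) (inv_chart a)"

definition compatible ::
    "('a::topological_space, 'm::finite) chart \<Rightarrow> ('a, 'm) chart \<Rightarrow> bool"
  where "compatible a b \<longleftrightarrow>
    smooth_on (snd a ` (fst a \<inter> fst b)) (snd b \<circ> inv_chart a) \<and>
    smooth_on (snd b ` (fst a \<inter> fst b)) (snd a \<circ> inv_chart b)"

text \<open>A smooth structure is a maximal atlas. The underlying manifold \<open>M\<close> is the whole type
  \<open>'a\<close>, which is Hausdorff and second countable; its dimension \<open>m\<close> is \<open>CARD('m)\<close>.\<close>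

definition smooth_manifold ::
    "('a::{t2_space,second_countable_topology}, 'm::finite) chart set \<Rightarrow> bool"
  where "smooth_manifold A \<longleftrightarrow>
    (\<forall>a\<in>A. is_chart a) \<and>
    (\<Union>a\<in>A. fst a) = UNIV \<and>
    (\<forall>a\<in>A. \<forall>b\<in>A. compatible a b) \<and>
    (\<forall>a. is_chart a \<and> (\<forall>b\<in>A. compatible a b) \<longrightarrow> a \<in> A)"

context
  fixes A :: "('a::{t2_space,second_countable_topology}, 'm::finite) chart set"
begin

section \<open>Tangent vectors, densities and their fields\<close>

text \<open>
  At each point \<open>p\<close> one reference chart is selected. An element of the fibre at \<open>p\<close> of a
  bundle associated with the frame bundle is represented by its value in the coordinate frame
  at \<open>p\<close> of that chart. Thus \<open>T\<^sub>pM\<close> is \<open>real ^ 'm\<close>, the fibre of \<open>L^k\<close> at \<open>p\<close> is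
  \<open>real\<close>, and tensor products with and pairings between powers of \<open>L\<close> are products of
  real numbers. The reference chart varies in no controlled way with \<open>p\<close>, so smoothness and
  derivatives of fields only make sense after passing to the components in a fixed chart.
\<close>

definition ref_chart :: "'a \<Rightarrow> ('a, 'm) chart"
  where "ref_chart p = (SOME a. a \<in> A \<and> p \<in> fst a)"

text \<open>Change of frame at \<open>p\<close> from the reference chart to the chart \<open>a\<close>.\<close>

definition jac :: "('a, 'm) chart \<Rightarrow> 'a \<Rightarrow> real ^ 'm \<Rightarrow> real ^ 'm"
  where "jac a p =
    frechet_derivative (snd a \<circ> inv_chart (ref_chart p)) (at (snd (ref_chart p) p))"

definition vec_comp :: "('a, 'm) chart \<Rightarrow> ('a \<Rightarrow> real ^ 'm) \<Rightarrow> 'a \<Rightarrow> real ^ 'm"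
  where "vec_comp a X q = jac a q (X q)"

text \<open>Components of a section of \<open>L^k\<close>, by the representation \<open>|det|^(k/m)\<close>.\<close>

definition dens_comp :: "real \<Rightarrow> ('a, 'm) chart \<Rightarrow> ('a \<Rightarrow> real) \<Rightarrow> 'a \<Rightarrow> real"
  where "dens_comp k a l q = \<bar>det (matrix (jac a q))\<bar> powr (k / real CARD('m)) * l q"

definition smooth_fun :: "'a set \<Rightarrow> ('a \<Rightarrow> real) \<Rightarrow> bool"
  where "smooth_fun S f \<longleftrightarrow> open S \<and>
    (\<forall>a\<in>A. smooth_on (snd a ` (fst a \<inter> S)) (f \<circ> inv_chart a))"

definition vector_field :: "'a set \<Rightarrow> ('a \<Rightarrow> real ^ 'm) \<Rightarrow> bool"
  where "vector_field S X \<longleftrightarrow> open S \<and>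
    (\<forall>a\<in>A. smooth_on (snd a ` (fst a \<inter> S)) (vec_comp a X \<circ> inv_chart a))"

definition density_field :: "real \<Rightarrow> 'a set \<Rightarrow> ('a \<Rightarrow> real) \<Rightarrow> bool"
  where "density_field k S l \<longleftrightarrow> open S \<and>
    (\<forall>a\<in>A. smooth_on (snd a ` (fst a \<inter> S)) (dens_comp k a l \<circ> inv_chart a))"

text \<open>Derivative at \<open>p\<close> of a function in the direction \<open>v \<in> T\<^sub>pM\<close>.\<close>

definition dir_deriv :: "'a \<Rightarrow> real ^ 'm \<Rightarrow> ('a \<Rightarrow> 'b::real_normed_vector) \<Rightarrow> 'b"
  where "dir_deriv p v f =
    frechet_derivative (f \<circ> inv_chart (ref_chart p)) (at (snd (ref_chart p) p)) v"

definition lie_bracket :: "('a \<Rightarrow> real ^ 'm) \<Rightarrow> ('a \<Rightarrow> real ^ 'm) \<Rightarrow> 'a \<Rightarrow> real ^ 'm"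
  where "lie_bracket X Y p =
    dir_deriv p (X p) (vec_comp (ref_chart p) Y) - dir_deriv p (Y p) (vec_comp (ref_chart p) X)"

text \<open>The vector field, and the positive section of \<open>L\<close>, on the domain of the chart \<open>a\<close>
  whose components in \<open>a\<close> are the constant \<open>u\<close>, respectively the constant 1.\<close>

definition coord_field :: "('a, 'm) chart \<Rightarrow> real ^ 'm \<Rightarrow> 'a \<Rightarrow> real ^ 'm"
  where "coord_field a u q =
    frechet_derivative (snd (ref_chart q) \<circ> inv_chart a) (at (snd a q)) u"

definition coord_dens :: "('a, 'm) chart \<Rightarrow> 'a \<Rightarrow> real"
  where "coord_dens a q = \<bar>det (matrix (jac a q))\<bar> powr (- 1 / real CARD('m))"

section \<open>Connections\<close>

text \<open>A connection on \<open>TM\<close>, \<open>D X Y\<close> being \<open>\<nabla>\<^sub>X Y\<close>, acting on local vector fields.\<close>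

definition connection ::
    "('a, 'm) connection_op \<Rightarrow> bool"
  where "connection D \<longleftrightarrow>
    (\<forall>S X Y. vector_field S X \<and> vector_field S Y \<longrightarrow> vector_field S (D X Y)) \<and>
    (\<forall>S X X' Y Y'. vector_field S X \<and> vector_field S X' \<and> vector_field S Y \<and> vector_field S Y' \<and>
       (\<forall>q\<in>S. X q = X' q \<and> Y q = Y' q) \<longrightarrow> (\<forall>p\<in>S. D X Y p = D X' Y' p)) \<and>
    (\<forall>S X X' Y. vector_field S X \<and> vector_field S X' \<and> vector_field S Y \<longrightarrow>
       (\<forall>p\<in>S. D (\<lambda>q. X q + X' q) Y p = D X Y p + D X' Y p)) \<and>
    (\<forall>S X Y Y'. vector_field S X \<and> vector_field S Y \<and> vector_field S Y' \<longrightarrow>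
       (\<forall>p\<in>S. D X (\<lambda>q. Y q + Y' q) p = D X Y p + D X Y' p)) \<and>
    (\<forall>S f X Y. smooth_fun S f \<and> vector_field S X \<and> vector_field S Y \<longrightarrow>
       (\<forall>p\<in>S. D (\<lambda>q. f q *\<^sub>R X q) Y p = f p *\<^sub>R D X Y p)) \<and>
    (\<forall>S f X Y. smooth_fun S f \<and> vector_field S X \<and> vector_field S Y \<longrightarrow>
       (\<forall>p\<in>S. D X (\<lambda>q. f q *\<^sub>R Y q) p = dir_deriv p (X p) f *\<^sub>R Y p + f p *\<^sub>R D X Y p))"

definition torsion_free ::
    "('a, 'm) connection_op \<Rightarrow> bool"
  where "torsion_free D \<longleftrightarrow>
    (\<forall>S X Y. vector_field S X \<and> vector_field S Y \<longrightarrow>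
       (\<forall>p\<in>S. D X Y p - D Y X p = lie_bracket X Y p))"

text \<open>The covariant derivative at \<open>p\<close> of the vector field \<open>Y\<close> in the direction \<open>x \<in> T\<^sub>pM\<close>.\<close>

definition cov ::
    "('a, 'm) connection_op \<Rightarrow>
     'a \<Rightarrow> real ^ 'm \<Rightarrow> ('a \<Rightarrow> real ^ 'm) \<Rightarrow> real ^ 'm"
  where "cov D p x Y = D (coord_field (ref_chart p) x) Y p"

text \<open>The connection induced on \<open>L^k\<close>: the differential of \<open>|det|^(k/m)\<close> is \<open>(k/m) trace\<close>, here
  applied to the connection form of \<open>D\<close> in the reference coordinate frame.\<close>

definition cov_dens ::
    "('a, 'm) connection_op \<Rightarrow>
     real \<Rightarrow> ('a \<Rightarrow> real ^ 'm) \<Rightarrow> ('a \<Rightarrow> real) \<Rightarrow> 'a \<Rightarrow> real"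
  where "cov_dens D k X l p =
    dir_deriv p (X p) (dens_comp k (ref_chart p) l) +
    k / real CARD('m) * trace (matrix (\<lambda>u. D X (coord_field (ref_chart p) u) p)) * l p"

definition curvature ::
    "('a, 'm) connection_op \<Rightarrow>
     ('a \<Rightarrow> real ^ 'm) \<Rightarrow> ('a \<Rightarrow> real ^ 'm) \<Rightarrow> ('a \<Rightarrow> real ^ 'm) \<Rightarrow> 'a \<Rightarrow> real ^ 'm"
  where "curvature D X Y Z p =
    D X (D Y Z) p - D Y (D X Z) p - D (lie_bracket X Y) Z p"

text \<open>In the next three definitions the arguments in \<open>T\<^sub>pM\<close> are extended to the coordinate fields
  of the reference chart at \<open>p\<close>. In the second, \<open>l\<close> is a local positive section of \<open>L\<close>.\<close>

definition Ric ::
    "('a, 'm) connection_op \<Rightarrow>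
     'a \<Rightarrow> real ^ 'm \<Rightarrow> real ^ 'm \<Rightarrow> real"
  where "Ric D p x y =
    (let E = coord_field (ref_chart p)
     in trace (matrix (\<lambda>z. curvature D (E z) (E x) (E y) p)))"

definition Faraday ::
    "('a, 'm) connection_op \<Rightarrow>
     'a \<Rightarrow> real ^ 'm \<Rightarrow> real ^ 'm \<Rightarrow> real"
  where "Faraday D p x y =
    (let X = coord_field (ref_chart p) x; Y = coord_field (ref_chart p) y;
         l = coord_dens (ref_chart p)
     in (cov_dens D 1 X (cov_dens D 1 Y l) p - cov_dens D 1 Y (cov_dens D 1 X l) p
         - cov_dens D 1 (lie_bracket X Y) l p) / l p)"

definition Hess ::
    "('a, 'm) connection_op \<Rightarrow>
     ('a \<Rightarrow> real) \<Rightarrow> 'a \<Rightarrow> real ^ 'm \<Rightarrow> real ^ 'm \<Rightarrow> real"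
  where "Hess D l p x y =
    (let X = coord_field (ref_chart p) x; Y = coord_field (ref_chart p) y
     in cov_dens D 1 X (cov_dens D 1 Y l) p - cov_dens D 1 (D X Y) l p)"

section \<open>Conformal geometry\<close>

context
  fixes c :: "'a \<Rightarrow> real ^ 'm \<Rightarrow> real ^ 'm \<Rightarrow> real"
begin

text \<open>The value of \<open>c p\<close> lies in the fibre of \<open>L^2\<close>, and \<open>det c\<close> in a trivial line.\<close>

definition conformal_structure :: bool
  where "conformal_structure \<longleftrightarrow>
    (\<forall>p. bilinear (c p)) \<and>
    (\<forall>p x y. c p x y = c p y x) \<and>
    (\<forall>p x. x \<noteq> 0 \<longrightarrow> c p x x > 0) \<and>
    (\<forall>p. \<bar>det (\<chi> i j. c p (axis i 1) (axis j 1))\<bar> = 1) \<and>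
    (\<forall>S X Y. vector_field S X \<and> vector_field S Y \<longrightarrow> density_field 2 S (\<lambda>q. c q (X q) (Y q)))"

definition Weyl_structure ::
    "('a, 'm) connection_op \<Rightarrow> bool"
  where "Weyl_structure D \<longleftrightarrow> connection D \<and> torsion_free D \<and>
    (\<forall>S X Y Z. vector_field S X \<and> vector_field S Y \<and> vector_field S Z \<longrightarrow>
       (\<forall>p\<in>S. cov_dens D 2 X (\<lambda>q. c q (Y q) (Z q)) p = c p (D X Y p) (Z p) + c p (Y p) (D X Z p)))"

text \<open>Trace with respect to \<open>c\<close> over a subspace \<open>V\<close> of \<open>T\<^sub>pM\<close>, by an orthonormal basis.\<close>

definition ctrace ::
    "'a \<Rightarrow> (real ^ 'm) set \<Rightarrow> (real ^ 'm \<Rightarrow> real ^ 'm \<Rightarrow> 'b::real_vector) \<Rightarrow> 'b"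
  where "ctrace p V b =
    (\<Sum>e\<in>(SOME E. E \<subseteq> V \<and> span E = V \<and> (\<forall>e\<in>E. \<forall>f\<in>E. c p e f = (if e = f then 1 else 0))). b e e)"

definition sym_tracefree ::
    "'a \<Rightarrow> (real ^ 'm \<Rightarrow> real ^ 'm \<Rightarrow> real) \<Rightarrow> real ^ 'm \<Rightarrow> real ^ 'm \<Rightarrow> real"
  where "sym_tracefree p b x y =
    (b x y + b y x) / 2 - ctrace p UNIV b / real CARD('m) * c p x y"

definition Scal ::
    "('a, 'm) connection_op \<Rightarrow> 'a \<Rightarrow> real"
  where "Scal D p = ctrace p UNIV (Ric D p)"

definition sigma ::
    "('a, 'm) connection_op \<Rightarrow> 'a \<Rightarrow> real"
  where "sigma D p = 1 / (2 * (real CARD('m) - 1)) * Scal D p"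

definition Hess0 ::
    "('a, 'm) connection_op \<Rightarrow>
     ('a \<Rightarrow> real) \<Rightarrow> 'a \<Rightarrow> real ^ 'm \<Rightarrow> real ^ 'm \<Rightarrow> real"
  where "Hess0 D l p = sym_tracefree p (Hess D l p)"

text \<open>The operator \<open>Mo\<close> acts on local sections of \<open>L\<close>, with values in the symmetric trace-free
  bilinear forms with values in \<open>L\<close>. The last condition says that \<open>Mo - Hess0 D\<close> is of order zero,
  i.e. linear over smooth functions; as \<open>Hess0 D\<close> is of second order, so is \<open>Mo\<close>.\<close>

definition Moebius_structure ::
    "('a, 'm) density_op \<Rightarrow> bool"
  where "Moebius_structure Mo \<longleftrightarrow>
    (\<forall>S l. density_field 1 S l \<longrightarrow>
       (\<forall>p\<in>S. bilinear (Mo l p) \<and> (\<forall>x y. Mo l p x y = Mo l p y x) \<and> ctrace p UNIV (Mo l p) = 0)) \<and>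
    (\<forall>S l X Y. density_field 1 S l \<and> vector_field S X \<and> vector_field S Y \<longrightarrow>
       density_field 1 S (\<lambda>q. Mo l q (X q) (Y q))) \<and>
    (\<forall>S l l'. density_field 1 S l \<and> density_field 1 S l' \<and> (\<forall>q\<in>S. l q = l' q) \<longrightarrow>
       (\<forall>p\<in>S. Mo l p = Mo l' p)) \<and>
    (\<forall>S l l' r s. density_field 1 S l \<and> density_field 1 S l' \<longrightarrow>
       (\<forall>p\<in>S. \<forall>x y. Mo (\<lambda>q. r * l q + s * l' q) p x y = r * Mo l p x y + s * Mo l' p x y)) \<and>
    (\<exists>D. Weyl_structure D \<and>
       (\<forall>S f l. smooth_fun S f \<and> density_field 1 S l \<longrightarrow>
          (\<forall>p\<in>S. \<forall>x y. Mo (\<lambda>q. f q * l q) p x y - Hess0 D (\<lambda>q. f q * l q) p x y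
                       = f p * (Mo l p x y - Hess0 D l p x y))))"

text \<open>\<open>Mo - Hess0 D\<close> as a bilinear form on \<open>T\<^sub>pM\<close>, read off on a local positive section of \<open>L\<close>.\<close>

definition h0_Moebius ::
    "('a, 'm) density_op \<Rightarrow>
     ('a, 'm) connection_op \<Rightarrow>
     'a \<Rightarrow> real ^ 'm \<Rightarrow> real ^ 'm \<Rightarrow> real"
  where "h0_Moebius Mo D p x y =
    (let l = coord_dens (ref_chart p) in (Mo l p x y - Hess0 D l p x y) / l p)"

text \<open>The Schouten-Weyl tensor; \<open>Mo\<close> is used only in dimension 2.\<close>

definition Schouten_Weyl ::
    "('a, 'm) density_op \<Rightarrow>
     ('a, 'm) connection_op \<Rightarrow>
     'a \<Rightarrow> real ^ 'm \<Rightarrow> real ^ 'm \<Rightarrow> real"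
  where "Schouten_Weyl Mo D p x y =
    (if CARD('m) = 2
     then h0_Moebius Mo D p x y + 1 / 2 * sigma D p * c p x y - 1 / 2 * Faraday D p x y
     else 1 / (real CARD('m) - 2) * sym_tracefree p (Ric D p) x y
          + 1 / real CARD('m) * sigma D p * c p x y - 1 / 2 * Faraday D p x y)"

section \<open>Submanifolds\<close>

context
  fixes n :: nat and N :: "'a set"
begin

definition slice_chart :: "('a, 'm) chart \<Rightarrow> 'm set \<Rightarrow> bool"
  where "slice_chart a I \<longleftrightarrow> a \<in> A \<and> card I = n \<and>
    fst a \<inter> N = {q \<in> fst a. \<forall>i. i \<notin> I \<longrightarrow> snd a q $ i = 0}"

definition submanifold :: bool
  where "submanifold \<longleftrightarrow> (\<forall>p\<in>N. \<exists>a I. slice_chart a I \<and> p \<in> fst a)"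

definition tangent_bundle :: "'a \<Rightarrow> (real ^ 'm) set"
  where "tangent_bundle p =
    {v. \<exists>a I. slice_chart a I \<and> p \<in> fst a \<and> (\<forall>i. i \<notin> I \<longrightarrow> jac a p v $ i = 0)}"

definition normal_bundle :: "'a \<Rightarrow> (real ^ 'm) set"
  where "normal_bundle p = {\<xi>. \<forall>x\<in>tangent_bundle p. c p \<xi> x = 0}"

definition tan_part :: "'a \<Rightarrow> real ^ 'm \<Rightarrow> real ^ 'm"
  where "tan_part p v = (THE w. w \<in> tangent_bundle p \<and> v - w \<in> normal_bundle p)"

definition nor_part :: "'a \<Rightarrow> real ^ 'm \<Rightarrow> real ^ 'm"
  where "nor_part p v = v - tan_part p v"

text \<open>Differentiation along \<open>N\<close> is carried out on local extensions to \<open>M\<close>: of a function on \<open>N\<close>,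
  of a section of \<open>TM\<close> along \<open>N\<close>, and of a single tangent or normal vector at \<open>p\<close> to a field
  that is tangent or normal along \<open>N\<close>. The derivatives do not depend on the choice of the first
  two; the expressions below are tensorial in the last two.\<close>

definition fun_ext :: "'a \<Rightarrow> ('a \<Rightarrow> real) \<Rightarrow> 'a \<Rightarrow> real"
  where "fun_ext p f = (SOME g. \<exists>S. p \<in> S \<and> smooth_fun S g \<and> (\<forall>q\<in>S \<inter> N. g q = f q))"

definition sec_ext :: "'a \<Rightarrow> ('a \<Rightarrow> real ^ 'm) \<Rightarrow> 'a \<Rightarrow> real ^ 'm"
  where "sec_ext p s = (SOME Y. \<exists>S. p \<in> S \<and> vector_field S Y \<and> (\<forall>q\<in>S \<inter> N. Y q = s q))"

definition tan_ext :: "'a \<Rightarrow> real ^ 'm \<Rightarrow> 'a \<Rightarrow> real ^ 'm"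
  where "tan_ext p y =
    (SOME Y. \<exists>S. p \<in> S \<and> vector_field S Y \<and> Y p = y \<and> (\<forall>q\<in>S \<inter> N. Y q \<in> tangent_bundle q))"

definition nor_ext :: "'a \<Rightarrow> real ^ 'm \<Rightarrow> 'a \<Rightarrow> real ^ 'm"
  where "nor_ext p \<xi> =
    (SOME Y. \<exists>S. p \<in> S \<and> vector_field S Y \<and> Y p = \<xi> \<and> (\<forall>q\<in>S \<inter> N. Y q \<in> normal_bundle q))"

text \<open>Trace of an endomorphism of a subspace \<open>V\<close>.\<close>

definition trace_on :: "(real ^ 'm) set \<Rightarrow> (real ^ 'm \<Rightarrow> real ^ 'm) \<Rightarrow> real"
  where "trace_on V f =
    (let B = (SOME B. independent B \<and> span B = V) in \<Sum>b\<in>B. representation B (f b) b)"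

definition fund_form ::
    "('a, 'm) connection_op \<Rightarrow>
     'a \<Rightarrow> real ^ 'm \<Rightarrow> real ^ 'm \<Rightarrow> real ^ 'm"
  where "fund_form D p x y = nor_part p (cov D p x (tan_ext p y))"

definition mean_curv ::
    "('a, 'm) connection_op \<Rightarrow> 'a \<Rightarrow> real ^ 'm \<Rightarrow> real"
  where "mean_curv D p \<xi> =
    - (1 / real n) * trace_on (tangent_bundle p) (\<lambda>x. tan_part p (cov D p x (nor_ext p \<xi>)))"

text \<open>The mean curvature as a normal vector (of weight -2).\<close>

definition mean_curv_vec ::
    "('a, 'm) connection_op \<Rightarrow> 'a \<Rightarrow> real ^ 'm"
  where "mean_curv_vec D p =
    (THE \<eta>. \<eta> \<in> normal_bundle p \<and> (\<forall>\<xi>\<in>normal_bundle p. c p \<eta> \<xi> = mean_curv D p \<xi>))"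

definition B0 ::
    "('a, 'm) connection_op \<Rightarrow>
     'a \<Rightarrow> real ^ 'm \<Rightarrow> real ^ 'm \<Rightarrow> real ^ 'm"
  where "B0 D p x y = fund_form D p x y - c p x y *\<^sub>R mean_curv_vec D p"

text \<open>\<open>(\<nabla>\<^sub>x H)(\<xi>)\<close>, for the connection on the dual of the normal bundle.\<close>

definition cov_mean_curv ::
    "('a, 'm) connection_op \<Rightarrow>
     'a \<Rightarrow> real ^ 'm \<Rightarrow> real ^ 'm \<Rightarrow> real"
  where "cov_mean_curv D p x \<xi> =
    (let \<Xi> = nor_ext p \<xi>
     in dir_deriv p x (fun_ext p (\<lambda>q. mean_curv D q (\<Xi> q)))
        - mean_curv D p (nor_part p (cov D p x \<Xi>)))"

text \<open>\<open>(\<nabla>\<^sub>x B0)(y, z)\<close>, for the connection built from those on \<open>TN\<close> and on the normal bundle.\<close>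

definition cov_B0 ::
    "('a, 'm) connection_op \<Rightarrow>
     'a \<Rightarrow> real ^ 'm \<Rightarrow> real ^ 'm \<Rightarrow> real ^ 'm \<Rightarrow> real ^ 'm"
  where "cov_B0 D p x y z =
    (let Y = tan_ext p y; Z = tan_ext p z
     in nor_part p (cov D p x (sec_ext p (\<lambda>q. B0 D q (Y q) (Z q))))
        - B0 D p (tan_part p (cov D p x Y)) z
        - B0 D p y (tan_part p (cov D p x Z)))"

definition codiff_B0 ::
    "('a, 'm) connection_op \<Rightarrow>
     'a \<Rightarrow> real ^ 'm \<Rightarrow> real ^ 'm"
  where "codiff_B0 D p x = ctrace p (tangent_bundle p) (\<lambda>e f. cov_B0 D p e x f)"

text \<open>In the last term \<open>codiff_B0\<close>, a normal vector of weight -2, is paired with \<open>\<xi>\<close> by \<open>c\<close>.\<close>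

definition mixed_Schouten_Weyl ::
    "('a, 'm) density_op \<Rightarrow>
     ('a, 'm) connection_op \<Rightarrow>
     'a \<Rightarrow> real ^ 'm \<Rightarrow> real ^ 'm \<Rightarrow> real"
  where "mixed_Schouten_Weyl Mo D p x \<xi> =
    Schouten_Weyl Mo D p x \<xi> - cov_mean_curv D p x \<xi>
    + (if n = 1 then 0 else 1 / (real n - 1) * c p (codiff_B0 D p x) \<xi>)"

end

end

end

end

theory Submission
  imports Defs
begin

text \<open>
  Two Weyl structures differ by a 1-form \<open>\<theta>\<close>:
  \<open>\<nabla>'\<^sub>X Y = \<nabla>\<^sub>X Y + \<theta>(X) Y + \<theta>(Y) X - c(X,Y) \<theta>\<^sup>#\<close>. Let \<open>X\<close> be tangent and \<open>\<xi>\<close> normal to \<open>N\<close>.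
  As \<open>c(X,\<xi>) = 0\<close>, all trace terms drop out of the Schouten-Weyl tensor, and
  \<open>h'(X,\<xi>) - h(X,\<xi>) = \<theta>(X) \<theta>(\<xi>) - (\<nabla>\<^sub>X \<theta>)(\<xi>)\<close>. The fundamental form changes by
  \<open>- c(X,Y) (\<theta>\<^sup>#)\<^sup>\<bottom>\<close>, so \<open>B\<^sub>0\<close> is invariant, and \<open>(\<nabla>\<^sub>X H)(\<xi>)\<close> changes by
  \<open>\<theta>(X) \<theta>(\<xi>) - (\<nabla>\<^sub>X \<theta>)(\<xi>) + c(B\<^sub>0(X,\<tau>),\<xi>)\<close> where \<open>\<tau>\<close> is the tangential part of \<open>\<theta>\<^sup>#\<close>.
  Since \<open>B\<^sub>0\<close> is symmetric and trace-free, the codifferential changes by \<open>(n - 1) B\<^sub>0(X,\<tau>)\<close>, which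
  compensates the last term; for \<open>n = 1\<close> one has \<open>B\<^sub>0 = 0\<close>. The derivatives of \<open>H\<close> and \<open>B\<^sub>0\<close> are
  meaningful because both have smooth expressions in a local orthogonal frame adapted to \<open>N\<close>.
\<close>

section \<open>Calculus of smooth maps\<close>

text \<open>The obstacle is the encoding: components at a point refer to a chart chosen freely point
  by point, and derivatives along \<open>N\<close> refer to arbitrarily chosen extensions. Both
  choices are removed by working over one chart \<open>a\<close>. There \<open>c\<close> is replaced
  by the metric \<open>gm a\<close>, that is l^(-2) c for l = \<open>coord_dens A a\<close>, and a
  Weyl structure by a torsion-free connection with \<nabla>g = -2 \<alpha> g, where \<alpha> =
  \<open>conn_form a D\<close> is the connection form of L in the gauge l. These objects are smooth
  in the ordinary sense, and \<theta> is the difference of the two forms \<alpha>. At the point in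
  question \<open>a\<close> is the reference chart, so that l = 1 and \<open>gm a\<close> agrees
  with \<open>c\<close> there, and the coordinate fields hidden in the definitions of curvature are
  those of \<open>a\<close>. The submanifold is straight in another chart \<open>b\<close>, hence
  the frame is made orthogonal for \<open>gm a\<close> but built from the coordinate fields of
  \<open>b\<close>. Frame components that vanish on \<open>N\<close> have vanishing tangential
  derivatives, which disposes of the chosen extensions.\<close>

lemma Ck_on_cong:
  assumes "open S" "\<And>x. x \<in> S \<Longrightarrow> f x = g x" "Ck_on k S f"
  shows "Ck_on k S g"
  using assms(2,3)
proof (induction k arbitrary: f g)
  case 0
  then show ?case by (metis Ck_on.simps(1) continuous_on_cong)
next
  case (Suc k)
  have d: "(g has_derivative frechet_derivative f (at x)) (at x)" if "x \<in> S" for x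
    using that Suc.prems assms(1)
    by (auto intro: has_derivative_transform_within_open simp: frechet_derivative_works)
  then have e: "frechet_derivative g (at x) = frechet_derivative f (at x)" if "x \<in> S" for x
    using that frechet_derivative_at by metis
  show ?case
    using d e Suc.prems Suc.IH by (auto simp: differentiable_def)
qed

lemma Ck_on_subset: "Ck_on k S f \<Longrightarrow> T \<subseteq> S \<Longrightarrow> Ck_on k T f"
  by (induction k arbitrary: f) (auto intro: continuous_on_subset)

lemma Ck_on_Suc_imp: "Ck_on (Suc k) S f \<Longrightarrow> Ck_on k S f"
proof (induction k arbitrary: f)
  case 0
  then show ?case
    by (auto simp: continuous_at_imp_continuous_on differentiable_imp_continuous_within)
qed auto

text \<open>Uniqueness of the derivative lets a closed formula \<open>f'\<close> replace
  \<open>frechet_derivative\<close>. The closure properties below are inductions through this rule: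
  the formula is built from functions of one order less, to which the induction hypothesis
  applies.\<close>

lemma Ck_on_SucI:
  assumes "open S" "\<And>x. x \<in> S \<Longrightarrow> (f has_derivative f' x) (at x)"
    and "\<And>v. Ck_on k S (\<lambda>x. f' x v)"
  shows "Ck_on (Suc k) S f"
proof -
  have "frechet_derivative f (at x) = f' x" if "x \<in> S" for x
    using assms(2) that frechet_derivative_at by metis
  then have "Ck_on k S (\<lambda>x. frechet_derivative f (at x) v)" for v
    using assms(1,3) by (auto intro: Ck_on_cong)
  then show ?thesis
    using assms(2) by (auto simp: differentiable_def)
qed

lemma Ck_on_SucD:
  assumes "Ck_on (Suc k) S f" "x \<in> S"
  shows "(f has_derivative frechet_derivative f (at x)) (at x)"
  using assms by (simp add: frechet_derivative_works)

lemma Ck_on_const: "open S \<Longrightarrow> Ck_on k S (\<lambda>x. c)"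
  by (induction k arbitrary: c) auto

lemma Ck_on_bounded_linear:
  assumes "open S" "bounded_linear L" "Ck_on k S f"
  shows "Ck_on k S (\<lambda>x. L (f x))"
  using assms(3)
proof (induction k arbitrary: f)
  case 0
  then show ?case
    using assms(2) by (auto intro: bounded_linear.continuous_on)
next
  case (Suc k)
  show ?case
  proof (rule Ck_on_SucI[OF assms(1)])
    show "((\<lambda>x. L (f x)) has_derivative (\<lambda>v. L (frechet_derivative f (at x) v))) (at x)"
      if "x \<in> S" for x
      using Ck_on_SucD[OF Suc.prems that] bounded_linear.has_derivative[OF assms(2)] by blast
    show "Ck_on k S (\<lambda>x. L (frechet_derivative f (at x) v))" for v
      using Suc by auto
  qed
qed

lemma Ck_on_add:
  assumes "open S" "Ck_on k S f" "Ck_on k S g"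
  shows "Ck_on k S (\<lambda>x. f x + g x)"
  using assms(2,3)
proof (induction k arbitrary: f g)
  case 0
  then show ?case by (auto intro: continuous_on_add)
next
  case (Suc k)
  show ?case
  proof (rule Ck_on_SucI[OF assms(1)])
    show "((\<lambda>x. f x + g x) has_derivative
        (\<lambda>v. frechet_derivative f (at x) v + frechet_derivative g (at x) v)) (at x)"
      if "x \<in> S" for x
      using Ck_on_SucD that Suc.prems by (blast intro: has_derivative_add)
    show "Ck_on k S (\<lambda>x. frechet_derivative f (at x) v + frechet_derivative g (at x) v)" for v
      using Suc by auto
  qed
qed

text \<open>The product rule keeps the undifferentiated factors, whose order has to be lowered by
  \<open>Ck_on_Suc_imp\<close> before the induction hypothesis applies to them.\<close>

lemma Ck_on_bilinear:
  assumes "open S" "bounded_bilinear b" "Ck_on k S f" "Ck_on k S g"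
  shows "Ck_on k S (\<lambda>x. b (f x) (g x))"
  using assms(3,4)
proof (induction k arbitrary: f g)
  case 0
  then show ?case using assms(2) by (auto intro: bounded_bilinear.continuous_on)
next
  case (Suc k)
  show ?case
  proof (rule Ck_on_SucI[OF assms(1)])
    show "((\<lambda>x. b (f x) (g x)) has_derivative
        (\<lambda>v. b (f x) (frechet_derivative g (at x) v) + b (frechet_derivative f (at x) v) (g x))) (at x)"
      if "x \<in> S" for x
      by (rule bounded_bilinear.FDERIV[OF assms(2)]; rule Ck_on_SucD[OF _ that]; fact)
    show "Ck_on k S (\<lambda>x. b (f x) (frechet_derivative g (at x) v)
        + b (frechet_derivative f (at x) v) (g x))" for v
      using Suc.IH Suc.prems Ck_on_Suc_imp[OF Suc.prems(1)] Ck_on_Suc_imp[OF Suc.prems(2)] assms(1)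
      by (intro Ck_on_add) auto
  qed
qed

lemma Ck_on_sum:
  assumes "open S" "\<And>i. i \<in> I \<Longrightarrow> Ck_on k S (f i)"
  shows "Ck_on k S (\<lambda>x. \<Sum>i\<in>I. f i x)"
  using assms(2)
  by (induction I rule: infinite_finite_induct) (auto intro: Ck_on_add Ck_on_const assms(1))

lemma Ck_on_inverse:
  fixes f :: "'x::real_normed_vector \<Rightarrow> real"
  assumes "open S" "\<And>x. x \<in> S \<Longrightarrow> f x \<noteq> 0" "Ck_on k S f"
  shows "Ck_on k S (\<lambda>x. inverse (f x))"
  using assms(3)
proof (induction k)
  case 0
  then show ?case using assms(2) by (auto intro!: continuous_on_inverse)
next
  case (Suc k)
  show ?case
  proof (rule Ck_on_SucI[OF assms(1)])
    show "((\<lambda>x. inverse (f x)) has_derivative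
        (\<lambda>v. - (inverse (f x) * frechet_derivative f (at x) v * inverse (f x)))) (at x)"
      if "x \<in> S" for x
      using Deriv.has_derivative_inverse[OF assms(2)[OF that] Ck_on_SucD[OF Suc.prems that]] .
    show "Ck_on k S (\<lambda>x. - (inverse (f x) * frechet_derivative f (at x) v * inverse (f x)))" for v
      using Suc Ck_on_Suc_imp[OF Suc.prems] assms(1)
      by (intro Ck_on_bounded_linear[OF assms(1) bounded_linear_minus[OF bounded_linear_ident]]
          Ck_on_bilinear[OF assms(1) bounded_bilinear_mult]) auto
  qed
qed

text \<open>Separates the direction from the base point: a derivative applied to a varying vector
  becomes a finite sum of scalar functions times derivatives in fixed directions, the only ones that
  \<open>Ck_on\<close> speaks about.\<close>

lemma linear_euclidean_expansion:
  fixes f :: "'x::euclidean_space \<Rightarrow> 'y::real_normed_vector"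
  assumes "linear f"
  shows "f v = (\<Sum>b\<in>Basis. (v \<bullet> b) *\<^sub>R f b)"
  by (subst euclidean_representation[of v, symmetric])
    (simp add: linear_sum[OF assms] linear_cmul[OF assms])

text \<open>The chain rule differentiates \<open>g\<close> in a direction that moves with x, so this
  direction is expanded in a basis of the Euclidean middle space. The induction generalizes
  \<open>g\<close> because its hypothesis is applied to directional derivatives of
  \<open>g\<close>.\<close>

lemma Ck_on_compose:
  fixes f :: "'x::real_normed_vector \<Rightarrow> 'y::euclidean_space" and g :: "'y \<Rightarrow> 'z::real_normed_vector"
  assumes "open S" "open T" "f ` S \<subseteq> T" "Ck_on k S f" "Ck_on k T g"
  shows "Ck_on k S (g \<circ> f)"
  using assms(4,5)
proof (induction k arbitrary: g)
  case 0
  then show ?case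
    using assms(3) continuous_on_compose[of S f g] continuous_on_subset[of T g] by auto
next
  case (Suc k)
  show ?case
  proof (rule Ck_on_SucI[OF assms(1)])
    fix x assume x: "x \<in> S"
    then have gd: "(g has_derivative frechet_derivative g (at (f x))) (at (f x))"
      using Suc.prems(2) assms(3) by (blast intro: Ck_on_SucD)
    note lin = linear_euclidean_expansion[OF has_derivative_linear[OF gd]]
    have "((g \<circ> f) has_derivative
        (frechet_derivative g (at (f x)) \<circ> frechet_derivative f (at x))) (at x)"
      using diff_chain_at[OF Ck_on_SucD[OF Suc.prems(1) x] gd] .
    also have "frechet_derivative g (at (f x)) \<circ> frechet_derivative f (at x) =
        (\<lambda>v. \<Sum>b\<in>Basis. (frechet_derivative f (at x) v \<bullet> b) *\<^sub>R frechet_derivative g (at (f x)) b)"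
      by (intro ext, subst o_apply, rule lin)
    finally show "((g \<circ> f) has_derivative
        (\<lambda>v. \<Sum>b\<in>Basis. (frechet_derivative f (at x) v \<bullet> b) *\<^sub>R frechet_derivative g (at (f x)) b)) (at x)" .
  next
    fix v
    have "Ck_on k S ((\<lambda>y. frechet_derivative g (at y) b) \<circ> f)" for b
      by (rule Suc.IH[OF Ck_on_Suc_imp[OF Suc.prems(1)]]) (use Suc.prems(2) in simp)
    moreover have "Ck_on k S (\<lambda>x. frechet_derivative f (at x) v)"
      using Suc.prems by simp
    ultimately show "Ck_on k S (\<lambda>x. \<Sum>b\<in>Basis. (frechet_derivative f (at x) v \<bullet> b) *\<^sub>R
        frechet_derivative g (at (f x)) b)"
      by (intro Ck_on_sum Ck_on_bilinear[OF _ bounded_bilinear_scaleR]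
          Ck_on_bounded_linear[OF _ bounded_linear_inner_left] assms(1)) (auto simp: o_def)
  qed
qed

section \<open>Closure properties of smooth maps on open sets\<close>

lemma smooth_on_cong:
  "open S \<Longrightarrow> (\<And>x. x \<in> S \<Longrightarrow> f x = g x) \<Longrightarrow> smooth_on S f \<Longrightarrow> smooth_on S g"
  unfolding smooth_on_def using Ck_on_cong by blast

lemma smooth_on_subset: "smooth_on S f \<Longrightarrow> T \<subseteq> S \<Longrightarrow> smooth_on T f"
  unfolding smooth_on_def using Ck_on_subset by blast

lemma smooth_on_const: "open S \<Longrightarrow> smooth_on S (\<lambda>x. c)"
  unfolding smooth_on_def using Ck_on_const by blast

lemma smooth_on_bounded_linear:
  "open S \<Longrightarrow> bounded_linear L \<Longrightarrow> smooth_on S f \<Longrightarrow> smooth_on S (\<lambda>x. L (f x))"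
  unfolding smooth_on_def using Ck_on_bounded_linear by blast

lemma smooth_on_add:
  "open S \<Longrightarrow> smooth_on S f \<Longrightarrow> smooth_on S g \<Longrightarrow> smooth_on S (\<lambda>x. f x + g x)"
  unfolding smooth_on_def using Ck_on_add by blast

lemma smooth_on_scaleR:
  "open S \<Longrightarrow> smooth_on S f \<Longrightarrow> smooth_on S g \<Longrightarrow> smooth_on S (\<lambda>x. f x *\<^sub>R g x)"
  unfolding smooth_on_def using Ck_on_bilinear[OF _ bounded_bilinear_scaleR] by blast

lemma smooth_on_mult:
  fixes f g :: "'x::real_normed_vector \<Rightarrow> real"
  shows "open S \<Longrightarrow> smooth_on S f \<Longrightarrow> smooth_on S g \<Longrightarrow> smooth_on S (\<lambda>x. f x * g x)"
  unfolding smooth_on_def using Ck_on_bilinear[OF _ bounded_bilinear_mult] by blast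

lemma smooth_on_sum:
  "open S \<Longrightarrow> (\<And>i. i \<in> I \<Longrightarrow> smooth_on S (f i)) \<Longrightarrow> smooth_on S (\<lambda>x. \<Sum>i\<in>I. f i x)"
  by (simp add: smooth_on_def Ck_on_sum)

lemma smooth_on_inverse:
  fixes f :: "'x::real_normed_vector \<Rightarrow> real"
  shows "open S \<Longrightarrow> (\<And>x. x \<in> S \<Longrightarrow> f x \<noteq> 0) \<Longrightarrow> smooth_on S f \<Longrightarrow> smooth_on S (\<lambda>x. inverse (f x))"
  by (simp add: smooth_on_def Ck_on_inverse)

lemma smooth_on_compose:
  fixes f :: "'x::real_normed_vector \<Rightarrow> 'y::euclidean_space" and g :: "'y \<Rightarrow> 'z::real_normed_vector"
  shows "open S \<Longrightarrow> open T \<Longrightarrow> f ` S \<subseteq> T \<Longrightarrow> smooth_on S f \<Longrightarrow> smooth_on T g \<Longrightarrow> smooth_on S (g \<circ> f)"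
  by (simp add: smooth_on_def Ck_on_compose)

lemma smooth_on_has_derivative:
  "smooth_on S f \<Longrightarrow> x \<in> S \<Longrightarrow> (f has_derivative frechet_derivative f (at x)) (at x)"
  unfolding smooth_on_def using Ck_on_SucD by blast

lemma smooth_on_differentiable: "smooth_on S f \<Longrightarrow> x \<in> S \<Longrightarrow> f differentiable (at x)"
  using smooth_on_has_derivative differentiable_def by blast

lemma smooth_on_linear_frechet: "smooth_on S f \<Longrightarrow> x \<in> S \<Longrightarrow> linear (frechet_derivative f (at x))"
  using smooth_on_has_derivative has_derivative_linear by blast

lemma smooth_on_frechet_derivative:
  "smooth_on S f \<Longrightarrow> smooth_on S (\<lambda>x. frechet_derivative f (at x) v)"
  unfolding smooth_on_def using Ck_on.simps(2) by blast

lemma smooth_on_frechet_derivative_along: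
  fixes f :: "'x::euclidean_space \<Rightarrow> 'y::real_normed_vector"
  assumes "open S" "smooth_on S f" "smooth_on S V"
  shows "smooth_on S (\<lambda>x. frechet_derivative f (at x) (V x))"
proof -
  have "smooth_on S (\<lambda>x. \<Sum>b\<in>Basis. (V x \<bullet> b) *\<^sub>R frechet_derivative f (at x) b)"
    by (intro smooth_on_sum smooth_on_scaleR smooth_on_frechet_derivative
        smooth_on_bounded_linear[OF _ bounded_linear_inner_left] assms)
  then show ?thesis
    by (rule smooth_on_cong[rotated 2])
      (use assms in \<open>simp_all add: linear_euclidean_expansion[OF smooth_on_linear_frechet, symmetric]\<close>)
qed

lemma smooth_on_continuous: "smooth_on S f \<Longrightarrow> continuous_on S f"
  unfolding smooth_on_def by (metis Ck_on.simps(1))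

text \<open>Symmetry of the second derivative: the second difference quotient along \<open>u\<close> and \<open>v\<close>
  is, by the mean value theorem applied twice, a value of the iterated derivative.\<close>

lemma second_difference:
  fixes f :: "'x::real_normed_vector \<Rightarrow> real"
  assumes S: "smooth_on S f" and t: "0 < t"
    and sub: "\<And>r s. 0 \<le> r \<Longrightarrow> r \<le> t \<Longrightarrow> 0 \<le> s \<Longrightarrow> s \<le> t \<Longrightarrow> x + r *\<^sub>R u + s *\<^sub>R v \<in> S"
  shows "\<exists>r s. 0 < r \<and> r < t \<and> 0 < s \<and> s < t \<and>
    f (x + t *\<^sub>R u + t *\<^sub>R v) - f (x + t *\<^sub>R u) - f (x + t *\<^sub>R v) + f x =
    t * t * frechet_derivative (\<lambda>z. frechet_derivative f (at z) u) (at (x + r *\<^sub>R u + s *\<^sub>R v)) v"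
proof -
  define fu where "fu = (\<lambda>z. frechet_derivative f (at z) u)"
  have fu: "smooth_on S fu"
    unfolding fu_def by (rule smooth_on_frechet_derivative[OF S])
  have du: "((\<lambda>r. f (x + r *\<^sub>R u + s *\<^sub>R v)) has_real_derivative fu (x + r *\<^sub>R u + s *\<^sub>R v)) (at r)"
    if "0 \<le> r" "r \<le> t" "0 \<le> s" "s \<le> t" for r s
  proof -
    note d = smooth_on_has_derivative[OF S sub[OF that]]
    have "((\<lambda>r. x + r *\<^sub>R u + s *\<^sub>R v) has_derivative (\<lambda>h. h *\<^sub>R u)) (at r)"
      by (auto intro!: derivative_eq_intros)
    from diff_chain_at[OF this d] show ?thesis
      by (simp add: has_field_derivative_def o_def fu_def mult_commute_abs
          linear_cmul[OF has_derivative_linear[OF d]])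
  qed
  have dv: "((\<lambda>s. fu (x + r *\<^sub>R u + s *\<^sub>R v)) has_real_derivative
      frechet_derivative fu (at (x + r *\<^sub>R u + s *\<^sub>R v)) v) (at s)"
    if "0 \<le> r" "r \<le> t" "0 \<le> s" "s \<le> t" for r s
  proof -
    note d = smooth_on_has_derivative[OF fu sub[OF that]]
    have "((\<lambda>s. x + r *\<^sub>R u + s *\<^sub>R v) has_derivative (\<lambda>h. h *\<^sub>R v)) (at s)"
      by (auto intro!: derivative_eq_intros)
    from diff_chain_at[OF this d] show ?thesis
      by (simp add: has_field_derivative_def o_def mult_commute_abs
          linear_cmul[OF has_derivative_linear[OF d]])
  qed
  \<comment> \<open>Difference in the direction v as a function of the u parameter; the term
    \<open>0 *\<^sub>R v\<close> gives both summands the shape covered by \<open>du\<close>.\<close>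
  define \<phi> where "\<phi> r = f (x + r *\<^sub>R u + t *\<^sub>R v) - f (x + r *\<^sub>R u + 0 *\<^sub>R v)" for r
  have "\<exists>z>0. z < t \<and> \<phi> t - \<phi> 0 = (t - 0) *
      (fu (x + z *\<^sub>R u + t *\<^sub>R v) - fu (x + z *\<^sub>R u + 0 *\<^sub>R v))"
    by (rule MVT2[OF t]) (unfold \<phi>_def, intro DERIV_diff du, use t in auto)
  then obtain r where r: "0 < r" "r < t"
    "\<phi> t - \<phi> 0 = t * (fu (x + r *\<^sub>R u + t *\<^sub>R v) - fu (x + r *\<^sub>R u + 0 *\<^sub>R v))" by auto
  have "\<exists>z>0. z < t \<and> fu (x + r *\<^sub>R u + t *\<^sub>R v) - fu (x + r *\<^sub>R u + 0 *\<^sub>R v) =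
      (t - 0) * frechet_derivative fu (at (x + r *\<^sub>R u + z *\<^sub>R v)) v"
    by (rule MVT2[OF t]) (rule dv, use r in auto)
  then obtain s where s: "0 < s" "s < t" "fu (x + r *\<^sub>R u + t *\<^sub>R v) - fu (x + r *\<^sub>R u + 0 *\<^sub>R v) =
      t * frechet_derivative fu (at (x + r *\<^sub>R u + s *\<^sub>R v)) v" by auto
  have "f (x + t *\<^sub>R u + t *\<^sub>R v) - f (x + t *\<^sub>R u) - f (x + t *\<^sub>R v) + f x = \<phi> t - \<phi> 0"
    by (simp add: \<phi>_def)
  also have "\<dots> = t * t * frechet_derivative fu (at (x + r *\<^sub>R u + s *\<^sub>R v)) v"
    using r s by simp
  finally show ?thesis
    using r s unfolding fu_def by blast
qed

lemma symmetric_second_derivative_real: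
  fixes f :: "'x::real_normed_vector \<Rightarrow> real"
  assumes S: "open S" "smooth_on S f" "x \<in> S"
  shows "frechet_derivative (\<lambda>z. frechet_derivative f (at z) u) (at x) v =
    frechet_derivative (\<lambda>z. frechet_derivative f (at z) v) (at x) u"
proof (rule ccontr)
  define P where "P u v z = frechet_derivative (\<lambda>z. frechet_derivative f (at z) u) (at z) v" for u v z
  assume "\<not> ?thesis"
  then have ne: "P u v x \<noteq> P v u x" unfolding P_def .
  \<comment> \<open>Half the gap: values less than e away from the two limits cannot coincide,
    whereas the common second difference forces two such values to be equal.\<close>
  define e where "e = \<bar>P u v x - P v u x\<bar> / 2"
  have e: "e > 0" using ne by (simp add: e_def)
  have cont: "isCont (P a b) x" for a b
    unfolding P_def by (rule continuous_on_interior[OF smooth_on_continuous[OF smooth_on_frechet_derivative[OF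
            smooth_on_frechet_derivative[OF S(2)]]]]) (simp add: interior_open S)
  have ex: "\<exists>d>0. \<forall>z. dist z x < d \<longrightarrow> dist (P a b z) (P a b x) < e" for a b
    using cont[of a b] e unfolding continuous_at_eps_delta dist_norm by blast
  obtain d1 where d1: "d1 > 0" "\<And>z. dist z x < d1 \<Longrightarrow> dist (P u v z) (P u v x) < e"
    using ex by blast
  obtain d2 where d2: "d2 > 0" "\<And>z. dist z x < d2 \<Longrightarrow> dist (P v u z) (P v u x) < e"
    using ex by blast
  obtain d3 where d3: "d3 > 0" "ball x d3 \<subseteq> S"
    using S open_contains_ball by blast
  define d where "d = Min {d1, d2, d3}"
  have d: "d > 0" "d \<le> d1" "d \<le> d2" "d \<le> d3" using d1 d2 d3 by (auto simp: d_def)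
  \<comment> \<open>Keeps the whole parallelogram with sides t u and t v within distance d of x; the
    summand 1 keeps the denominator positive when u and v both vanish.\<close>
  define t where "t = d / (2 * (norm u + norm v + 1))"
  have t: "t > 0" unfolding t_def using d by (auto simp: add_nonneg_pos)
  have near: "dist (x + r *\<^sub>R a + s *\<^sub>R b) x < d"
    if "0 \<le> r" "r \<le> t" "0 \<le> s" "s \<le> t" "a = u \<and> b = v \<or> a = v \<and> b = u" for r s a b
  proof -
    have "norm (r *\<^sub>R a + s *\<^sub>R b) \<le> norm (r *\<^sub>R a) + norm (s *\<^sub>R b)"
      by (rule norm_triangle_ineq)
    also have "\<dots> \<le> t * norm a + t * norm b"
      using that by (auto intro!: add_mono mult_right_mono)
    also have "\<dots> \<le> t * (norm u + norm v + 1)"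
      using that t by (auto simp: algebra_simps)
    also have "\<dots> = d / 2"
      unfolding t_def by (simp add: field_simps add_nonneg_eq_0_iff)
    also have "\<dots> < d" using d by simp
    finally show ?thesis by (simp add: dist_norm algebra_simps)
  qed
  have inS: "x + r *\<^sub>R a + s *\<^sub>R b \<in> S"
    if "0 \<le> r" "r \<le> t" "0 \<le> s" "s \<le> t" "a = u \<and> b = v \<or> a = v \<and> b = u" for r s a b
    using near[OF that] d(4) d3(2) by (auto simp: dist_commute)
  obtain r s where rs: "0 < r" "r < t" "0 < s" "s < t"
    "f (x + t *\<^sub>R u + t *\<^sub>R v) - f (x + t *\<^sub>R u) - f (x + t *\<^sub>R v) + f x =
      t * t * P u v (x + r *\<^sub>R u + s *\<^sub>R v)"
    using second_difference[OF S(2) t, of x u v] inS unfolding P_def by blast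
  obtain r' s' where rs': "0 < r'" "r' < t" "0 < s'" "s' < t"
    "f (x + t *\<^sub>R v + t *\<^sub>R u) - f (x + t *\<^sub>R v) - f (x + t *\<^sub>R u) + f x =
      t * t * P v u (x + r' *\<^sub>R v + s' *\<^sub>R u)"
    using second_difference[OF S(2) t, of x v u] inS unfolding P_def by blast
  have "f (x + t *\<^sub>R v + t *\<^sub>R u) - f (x + t *\<^sub>R v) - f (x + t *\<^sub>R u) + f x =
      f (x + t *\<^sub>R u + t *\<^sub>R v) - f (x + t *\<^sub>R u) - f (x + t *\<^sub>R v) + f x"
    by (simp add: algebra_simps)
  then have "P u v (x + r *\<^sub>R u + s *\<^sub>R v) = P v u (x + r' *\<^sub>R v + s' *\<^sub>R u)"
    using rs(5) rs'(5) t by simp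
  moreover have "dist (P u v (x + r *\<^sub>R u + s *\<^sub>R v)) (P u v x) < e"
    by (rule d1(2)) (use near[of r s u v] rs d in auto)
  moreover have "dist (P v u (x + r' *\<^sub>R v + s' *\<^sub>R u)) (P v u x) < e"
    by (rule d2(2)) (use near[of r' s' v u] rs' d in auto)
  ultimately show False
    unfolding e_def dist_real_def by (auto simp: abs_if split: if_splits)
qed

lemma symmetric_second_derivative:
  fixes f :: "'x::real_normed_vector \<Rightarrow> 'y::euclidean_space"
  assumes S: "open S" "smooth_on S f" "x \<in> S"
  shows "frechet_derivative (\<lambda>z. frechet_derivative f (at z) u) (at x) v =
    frechet_derivative (\<lambda>z. frechet_derivative f (at z) v) (at x) u"
proof (rule euclidean_eqI)
  fix b :: 'y assume "b \<in> Basis"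
  have inner: "frechet_derivative (\<lambda>z. h z \<bullet> b) (at z) w = frechet_derivative h (at z) w \<bullet> b"
    if "smooth_on S h" "z \<in> S" for h :: "'x \<Rightarrow> 'y" and z w
    using frechet_derivative_at[OF bounded_linear.has_derivative[OF bounded_linear_inner_left
          smooth_on_has_derivative[OF that], of b]] by metis
  have fb: "smooth_on S (\<lambda>z. f z \<bullet> b)"
    by (rule smooth_on_bounded_linear[OF S(1) bounded_linear_inner_left S(2)])
  have two: "frechet_derivative (\<lambda>z. frechet_derivative f (at z) u) (at x) v \<bullet> b =
      frechet_derivative (\<lambda>z. frechet_derivative (\<lambda>z. f z \<bullet> b) (at z) u) (at x) v" for u v
  proof -
    have "frechet_derivative (\<lambda>z. frechet_derivative f (at z) u) (at x) v \<bullet> b =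
        frechet_derivative (\<lambda>z. frechet_derivative f (at z) u \<bullet> b) (at x) v"
      using inner[OF smooth_on_frechet_derivative[OF S(2)] S(3)] by simp
    also have "frechet_derivative (\<lambda>z. frechet_derivative f (at z) u \<bullet> b) (at x) =
        frechet_derivative (\<lambda>z. frechet_derivative (\<lambda>z. f z \<bullet> b) (at z) u) (at x)"
      by (rule frechet_derivative_transform_within_open[OF _ S(1,3)])
        (use inner[OF S(2)] smooth_on_differentiable[OF smooth_on_bounded_linear[OF S(1)
            bounded_linear_inner_left smooth_on_frechet_derivative[OF S(2)]] S(3)] in auto)
    finally show ?thesis .
  qed
  show "frechet_derivative (\<lambda>z. frechet_derivative f (at z) u) (at x) v \<bullet> b =
      frechet_derivative (\<lambda>z. frechet_derivative f (at z) v) (at x) u \<bullet> b"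
    unfolding two by (rule symmetric_second_derivative_real[OF S(1) fb S(3)])
qed

section \<open>Charts\<close>

locale smooth_mfd =
  fixes A :: "('a::{t2_space,second_countable_topology}, 'm::finite) chart set"
  assumes mfd: "smooth_manifold A"
begin

lemma chart_homeo:
  assumes "a \<in> A"
  shows "open (fst a)" "open (snd a ` fst a)"
    "homeomorphism (fst a) (snd a ` fst a) (snd a) (inv_chart a)"
  using mfd assms unfolding smooth_manifold_def is_chart_def by auto

lemma chart_inv [simp]: "a \<in> A \<Longrightarrow> q \<in> fst a \<Longrightarrow> inv_chart a (snd a q) = q"
  using chart_homeo(3) homeomorphism_apply1 by metis

lemma chart_image_open:
  assumes "a \<in> A" "open S"
  shows "open (snd a ` (fst a \<inter> S))"
proof -
  have "openin (top_of_set (fst a)) (fst a \<inter> S)"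
    using assms by (auto intro: openin_open_Int)
  then have "openin (top_of_set (snd a ` fst a)) (snd a ` (fst a \<inter> S))"
    using homeomorphism_imp_open_map[OF chart_homeo(3)[OF assms(1)]] by blast
  then show ?thesis
    using chart_homeo(2)[OF assms(1)] openin_open_eq by blast
qed

lemma ref_chart: "ref_chart A p \<in> A" "p \<in> fst (ref_chart A p)"
proof -
  have "p \<in> (\<Union>a\<in>A. fst a)" using mfd unfolding smooth_manifold_def by simp
  then have "\<exists>a. a \<in> A \<and> p \<in> fst a" by blast
  then have "ref_chart A p \<in> A \<and> p \<in> fst (ref_chart A p)"
    unfolding ref_chart_def by (rule someI_ex)
  then show "ref_chart A p \<in> A" "p \<in> fst (ref_chart A p)" by auto
qed

text \<open>Coordinate change differentiated at a manifold point. \<open>jac\<close> and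
  \<open>coord_field\<close> are its special cases with the reference chart as source or target, so
  linearity and the cocycle law proved once here yield every change of frame.\<close>

definition trans_deriv :: "('a, 'm) chart \<Rightarrow> ('a, 'm) chart \<Rightarrow> 'a \<Rightarrow> real ^ 'm \<Rightarrow> real ^ 'm"
  where "trans_deriv a b q = frechet_derivative (snd b \<circ> inv_chart a) (at (snd a q))"

lemma trans_smooth:
  assumes "a \<in> A" "b \<in> A"
  shows "smooth_on (snd a ` (fst a \<inter> fst b)) (snd b \<circ> inv_chart a)"
  using mfd assms unfolding smooth_manifold_def compatible_def by blast

lemma trans_has_derivative:
  assumes "a \<in> A" "b \<in> A" "q \<in> fst a" "q \<in> fst b"
  shows "((snd b \<circ> inv_chart a) has_derivative trans_deriv a b q) (at (snd a q))"
  unfolding trans_deriv_def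
  by (rule smooth_on_has_derivative[OF trans_smooth[OF assms(1,2)]]) (use assms in auto)

lemma trans_deriv_linear:
  assumes "a \<in> A" "b \<in> A" "q \<in> fst a" "q \<in> fst b"
  shows "linear (trans_deriv a b q)"
  using has_derivative_linear[OF trans_has_derivative[OF assms]] .

lemma has_derivative_change_chart:
  assumes "a \<in> A" "b \<in> A" "q \<in> fst a" "q \<in> fst b"
    and "((f \<circ> inv_chart b) has_derivative L) (at (snd b q))"
  shows "((f \<circ> inv_chart a) has_derivative (L \<circ> trans_deriv a b q)) (at (snd a q))"
proof -
  have "(((f \<circ> inv_chart b) \<circ> (snd b \<circ> inv_chart a)) has_derivative (L \<circ> trans_deriv a b q))
      (at (snd a q))"
    using diff_chain_at[OF trans_has_derivative[OF assms(1-4)], of "f \<circ> inv_chart b" L] assms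
    by simp
  then show ?thesis
    by (rule has_derivative_transform_within_open[where s = "snd a ` (fst a \<inter> fst b)"])
      (use assms chart_image_open chart_homeo in auto)
qed

lemma trans_deriv_refl:
  assumes "a \<in> A" "q \<in> fst a"
  shows "trans_deriv a a q v = v"
proof -
  have "((\<lambda>z. z) has_derivative (\<lambda>z. z)) (at (snd a q))" by simp
  then have "((snd a \<circ> inv_chart a) has_derivative (\<lambda>z. z)) (at (snd a q))"
    by (rule has_derivative_transform_within_open[where s = "snd a ` (fst a \<inter> fst a)"])
      (use assms chart_image_open[of a "fst a"] chart_homeo in auto)
  then show ?thesis
    using frechet_derivative_at[symmetric] unfolding trans_deriv_def by metis
qed

lemma trans_deriv_trans:
  assumes "a \<in> A" "b \<in> A" "d \<in> A" "q \<in> fst a" "q \<in> fst b" "q \<in> fst d"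
  shows "trans_deriv b d q (trans_deriv a b q v) = trans_deriv a d q v"
proof -
  have "((snd d \<circ> inv_chart a) has_derivative (trans_deriv b d q \<circ> trans_deriv a b q)) (at (snd a q))"
    using has_derivative_change_chart trans_has_derivative assms by blast
  from frechet_derivative_at[OF this] show ?thesis
    unfolding trans_deriv_def[of a d] by (metis o_apply)
qed

lemma jac_eq: "jac A a q = trans_deriv (ref_chart A q) a q"
  unfolding jac_def trans_deriv_def ..

lemma coord_field_eq: "coord_field A a u q = trans_deriv a (ref_chart A q) q u"
  unfolding coord_field_def trans_deriv_def ..

lemma linear_jac: "a \<in> A \<Longrightarrow> q \<in> fst a \<Longrightarrow> linear (jac A a q)"
  unfolding jac_eq using trans_deriv_linear ref_chart by blast

lemma linear_coord_field: "a \<in> A \<Longrightarrow> q \<in> fst a \<Longrightarrow> linear (\<lambda>u. coord_field A a u q)"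
  unfolding coord_field_eq using trans_deriv_linear ref_chart by blast

lemma jac_coord_field: "a \<in> A \<Longrightarrow> q \<in> fst a \<Longrightarrow> jac A a q (coord_field A a u q) = u"
  unfolding coord_field_eq jac_eq by (simp add: trans_deriv_trans trans_deriv_refl ref_chart)

lemma coord_field_jac: "a \<in> A \<Longrightarrow> q \<in> fst a \<Longrightarrow> coord_field A a (jac A a q v) q = v"
  unfolding coord_field_eq jac_eq by (simp add: trans_deriv_trans trans_deriv_refl ref_chart)

lemma jac_ref_chart: "jac A (ref_chart A q) q v = v"
  unfolding jac_eq by (simp add: trans_deriv_refl ref_chart)

lemma coord_field_ref_chart: "coord_field A (ref_chart A q) u q = u"
  unfolding coord_field_eq by (simp add: trans_deriv_refl ref_chart)

lemma jac_change_chart: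
  "a \<in> A \<Longrightarrow> b \<in> A \<Longrightarrow> q \<in> fst a \<Longrightarrow> q \<in> fst b \<Longrightarrow> jac A b q v = trans_deriv a b q (jac A a q v)"
  unfolding jac_eq by (simp add: trans_deriv_trans ref_chart)

lemma det_jac_nonzero:
  assumes "a \<in> A" "q \<in> fst a"
  shows "det (matrix (jac A a q)) \<noteq> 0"
proof -
  have "inj (jac A a q)"
    using coord_field_jac[OF assms] by (metis injI)
  then show ?thesis
    using linear_jac[OF assms] det_nz_iff_inj by blast
qed

section \<open>Smooth functions and vector fields\<close>

text \<open>By the chain rule the reference chart in the definition may be exchanged for any chart
  around q, once the direction is converted by \<open>jac\<close>.\<close>

lemma dir_deriv_eqI:
  assumes "a \<in> A" "q \<in> fst a" "((f \<circ> inv_chart a) has_derivative L) (at (snd a q))"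
  shows "dir_deriv A q v f = L (jac A a q v)"
  using frechet_derivative_at[OF has_derivative_change_chart[OF ref_chart(1) assms(1) ref_chart(2)
        assms(2,3)], symmetric]
  unfolding dir_deriv_def jac_eq by simp

lemma smooth_fun_has_derivative:
  assumes "smooth_fun A S f" "a \<in> A" "q \<in> fst a" "q \<in> S"
  shows "((f \<circ> inv_chart a) has_derivative frechet_derivative (f \<circ> inv_chart a) (at (snd a q)))
    (at (snd a q))"
  by (rule smooth_on_has_derivative[where S = "snd a ` (fst a \<inter> S)"])
    (use assms in \<open>auto simp: smooth_fun_def\<close>)

lemma dir_deriv_chart:
  assumes "smooth_fun A S f" "a \<in> A" "q \<in> fst a" "q \<in> S"
  shows "dir_deriv A q v f = frechet_derivative (f \<circ> inv_chart a) (at (snd a q)) (jac A a q v)"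
  using dir_deriv_eqI[OF assms(2,3) smooth_fun_has_derivative[OF assms]] .

lemma dir_deriv_has_derivative:
  assumes "smooth_fun A S f" "q \<in> S"
  shows "((f \<circ> inv_chart (ref_chart A q)) has_derivative (\<lambda>v. dir_deriv A q v f))
    (at (snd (ref_chart A q) q))"
  using smooth_fun_has_derivative[OF assms(1) ref_chart assms(2)] unfolding dir_deriv_def .

lemma dir_derivI:
  assumes "((f \<circ> inv_chart (ref_chart A q)) has_derivative L) (at (snd (ref_chart A q) q))"
  shows "dir_deriv A q v f = L v"
  using dir_deriv_eqI[OF ref_chart assms] by (simp add: jac_ref_chart)

text \<open>\<open>frechet_derivative\<close> chooses among all derivatives, and functions equal
  near q have the same ones. The argument thus also covers components of densities whose smoothness
  is not yet known.\<close>

lemma dir_deriv_cong: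
  assumes "open S" "q \<in> S" "\<And>z. z \<in> S \<Longrightarrow> f z = g z"
  shows "dir_deriv A q v f = dir_deriv A q v g"
proof -
  let ?r = "ref_chart A q"
  have *: "((g \<circ> inv_chart ?r) has_derivative L) (at (snd ?r q))"
    if "((f \<circ> inv_chart ?r) has_derivative L) (at (snd ?r q))"
      "\<And>z. z \<in> S \<Longrightarrow> f z = g z" for L and f g :: "'a \<Rightarrow> 'b"
    by (rule has_derivative_transform_within_open[OF that(1), where s = "snd ?r ` (fst ?r \<inter> S)"])
      (use assms ref_chart chart_image_open that(2) in auto)
  have "((f \<circ> inv_chart ?r) has_derivative L) (at (snd ?r q)) \<longleftrightarrow>
      ((g \<circ> inv_chart ?r) has_derivative L) (at (snd ?r q))" for L
    using *[of f L g] *[of g L f] assms(3) by auto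
  then show ?thesis
    unfolding dir_deriv_def frechet_derivative_def by simp
qed

section \<open>Locality and module operations for smooth functions and vector fields\<close>

lemma smooth_fun_open: "smooth_fun A S f \<Longrightarrow> open S"
  unfolding smooth_fun_def by simp

lemma vector_field_open: "vector_field A S X \<Longrightarrow> open S"
  unfolding vector_field_def by simp

lemma smooth_fun_subset: "smooth_fun A S f \<Longrightarrow> open T \<Longrightarrow> T \<subseteq> S \<Longrightarrow> smooth_fun A T f"
  unfolding smooth_fun_def
  by (intro conjI ballI) (auto intro: smooth_on_subset[where S = "snd a ` (fst a \<inter> S)" for a])

lemma vector_field_subset: "vector_field A S X \<Longrightarrow> open T \<Longrightarrow> T \<subseteq> S \<Longrightarrow> vector_field A T X"
  unfolding vector_field_def
  by (intro conjI ballI) (auto intro: smooth_on_subset[where S = "snd a ` (fst a \<inter> S)" for a])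

lemma smooth_fun_cong:
  assumes "smooth_fun A S f" "\<And>q. q \<in> S \<Longrightarrow> f q = g q"
  shows "smooth_fun A S g"
  unfolding smooth_fun_def
proof (intro conjI ballI)
  show "open S" using assms smooth_fun_open by blast
  fix a assume "a \<in> A"
  then show "smooth_on (snd a ` (fst a \<inter> S)) (g \<circ> inv_chart a)"
    by (intro smooth_on_cong[of _ "f \<circ> inv_chart a" "g \<circ> inv_chart a"])
      (use assms chart_image_open in \<open>auto simp: smooth_fun_def\<close>)
qed

lemma vector_field_cong:
  assumes "vector_field A S X" "\<And>q. q \<in> S \<Longrightarrow> X q = Y q"
  shows "vector_field A S Y"
  unfolding vector_field_def
proof (intro conjI ballI)
  show "open S" using assms vector_field_open by blast
  fix a assume "a \<in> A"
  then show "smooth_on (snd a ` (fst a \<inter> S)) (vec_comp A a Y \<circ> inv_chart a)"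
    by (intro smooth_on_cong[of _ "vec_comp A a X \<circ> inv_chart a" "vec_comp A a Y \<circ> inv_chart a"])
      (use assms chart_image_open in \<open>auto simp: vector_field_def vec_comp_def\<close>)
qed

lemma smooth_fun_const: "open S \<Longrightarrow> smooth_fun A S (\<lambda>q. r)"
  unfolding smooth_fun_def by (auto simp: o_def intro: smooth_on_const chart_image_open)

lemma smooth_fun_add:
  "smooth_fun A S f \<Longrightarrow> smooth_fun A S g \<Longrightarrow> smooth_fun A S (\<lambda>q. f q + g q)"
  unfolding smooth_fun_def by (auto simp: o_def intro!: smooth_on_add chart_image_open)

lemma smooth_fun_mult:
  "smooth_fun A S f \<Longrightarrow> smooth_fun A S g \<Longrightarrow> smooth_fun A S (\<lambda>q. f q * g q)"
  unfolding smooth_fun_def by (auto simp: o_def intro!: smooth_on_mult chart_image_open)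

lemma smooth_fun_cmult: "smooth_fun A S f \<Longrightarrow> smooth_fun A S (\<lambda>q. r * f q)"
  using smooth_fun_mult smooth_fun_const smooth_fun_open by blast

lemma smooth_fun_diff:
  "smooth_fun A S f \<Longrightarrow> smooth_fun A S g \<Longrightarrow> smooth_fun A S (\<lambda>q. f q - g q)"
  using smooth_fun_add[of S f "\<lambda>q. - 1 * g q"] smooth_fun_cmult[of S g "- 1"] by simp

lemma smooth_fun_inverse:
  "smooth_fun A S f \<Longrightarrow> (\<And>q. q \<in> S \<Longrightarrow> f q \<noteq> 0) \<Longrightarrow> smooth_fun A S (\<lambda>q. inverse (f q))"
  unfolding smooth_fun_def o_def
  by (intro conjI ballI smooth_on_inverse chart_image_open)
    (auto simp del: split_paired_All split_paired_Ex, metis chart_inv fst_conv snd_conv)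

lemma smooth_fun_divide:
  "smooth_fun A S f \<Longrightarrow> smooth_fun A S g \<Longrightarrow> (\<And>q. q \<in> S \<Longrightarrow> g q \<noteq> 0) \<Longrightarrow>
    smooth_fun A S (\<lambda>q. f q / g q)"
  unfolding divide_inverse by (intro smooth_fun_mult smooth_fun_inverse)

lemma vector_field_add:
  assumes "vector_field A S X" "vector_field A S Y"
  shows "vector_field A S (\<lambda>q. X q + Y q)"
  unfolding vector_field_def
proof (intro conjI ballI)
  show "open S" using assms vector_field_open by blast
  fix a assume a: "a \<in> A"
  have "smooth_on (snd a ` (fst a \<inter> S))
      (\<lambda>z. (vec_comp A a X \<circ> inv_chart a) z + (vec_comp A a Y \<circ> inv_chart a) z)"
    by (intro smooth_on_add chart_image_open) (use assms a in \<open>auto simp: vector_field_def o_def\<close>)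
  then show "smooth_on (snd a ` (fst a \<inter> S)) (vec_comp A a (\<lambda>q. X q + Y q) \<circ> inv_chart a)"
    by (rule smooth_on_cong[rotated 2])
      (use a assms vector_field_open in
        \<open>auto simp: vec_comp_def linear_add[OF linear_jac] intro: chart_image_open\<close>)
qed

lemma vector_field_scaleR:
  assumes "smooth_fun A S f" "vector_field A S X"
  shows "vector_field A S (\<lambda>q. f q *\<^sub>R X q)"
  unfolding vector_field_def
proof (intro conjI ballI)
  show "open S" using assms vector_field_open by blast
  fix a assume a: "a \<in> A"
  have "smooth_on (snd a ` (fst a \<inter> S))
      (\<lambda>z. (f \<circ> inv_chart a) z *\<^sub>R (vec_comp A a X \<circ> inv_chart a) z)"
    by (intro smooth_on_scaleR chart_image_open)
      (use assms a in \<open>auto simp: vector_field_def smooth_fun_def o_def\<close>)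
  then show "smooth_on (snd a ` (fst a \<inter> S)) (vec_comp A a (\<lambda>q. f q *\<^sub>R X q) \<circ> inv_chart a)"
    by (rule smooth_on_cong[rotated 2])
      (use a assms vector_field_open in
        \<open>auto simp: vec_comp_def linear_cmul[OF linear_jac] intro: chart_image_open\<close>)
qed

lemma vector_field_cmult: "vector_field A S X \<Longrightarrow> vector_field A S (\<lambda>q. r *\<^sub>R X q)"
  using vector_field_scaleR smooth_fun_const vector_field_open by blast

lemma vector_field_diff:
  "vector_field A S X \<Longrightarrow> vector_field A S Y \<Longrightarrow> vector_field A S (\<lambda>q. X q - Y q)"
  using vector_field_add[of S X "\<lambda>q. (- 1) *\<^sub>R Y q"] vector_field_cmult[of S Y "- 1"] by simp

lemma vector_field_zero: "open S \<Longrightarrow> vector_field A S (\<lambda>q. 0)"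
  unfolding vector_field_def
proof (intro conjI ballI)
  fix a assume a: "a \<in> A" and S: "open S"
  show "smooth_on (snd a ` (fst a \<inter> S)) (vec_comp A a (\<lambda>q. 0) \<circ> inv_chart a)"
    by (rule smooth_on_cong[OF _ _ smooth_on_const[of _ 0]])
      (use a S chart_image_open in \<open>auto simp: vec_comp_def linear_0[OF linear_jac]\<close>)
qed

lemma vector_field_sum:
  "open S \<Longrightarrow> (\<And>i. i \<in> I \<Longrightarrow> vector_field A S (X i)) \<Longrightarrow> vector_field A S (\<lambda>q. \<Sum>i\<in>I. X i q)"
  by (induction I rule: infinite_finite_induct) (auto intro: vector_field_zero vector_field_add)

text \<open>Smoothness in one chart covering S passes to every other chart by composition with the
  coordinate change on the overlap.\<close>

lemma smooth_fun_chartI: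
  assumes "a \<in> A" "open S" "S \<subseteq> fst a" "smooth_on (snd a ` (fst a \<inter> S)) (f \<circ> inv_chart a)"
  shows "smooth_fun A S f"
  unfolding smooth_fun_def
proof (intro conjI ballI)
  show "open S" by fact
  fix b assume b: "b \<in> A"
  have "smooth_on (snd b ` (fst b \<inter> S)) ((f \<circ> inv_chart a) \<circ> (snd a \<circ> inv_chart b))"
  proof (rule smooth_on_compose[OF _ _ _ _ assms(4)])
    show "smooth_on (snd b ` (fst b \<inter> S)) (snd a \<circ> inv_chart b)"
      by (rule smooth_on_subset[OF trans_smooth[OF b assms(1)]]) (use assms in auto)
  qed (use assms b chart_image_open in auto)
  then show "smooth_on (snd b ` (fst b \<inter> S)) (f \<circ> inv_chart b)"
    by (rule smooth_on_cong[rotated 2]) (use assms b chart_image_open in auto)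
qed

text \<open>The components in another chart are the differential of the coordinate change applied to
  the components in \<open>a\<close>, read at the changed point. Smoothness of a differential along
  a varying vector is \<open>smooth_on_frechet_derivative_along\<close>.\<close>

lemma vector_field_chartI:
  assumes "a \<in> A" "open S" "S \<subseteq> fst a" "smooth_on (snd a ` (fst a \<inter> S)) (vec_comp A a X \<circ> inv_chart a)"
  shows "vector_field A S X"
  unfolding vector_field_def
proof (intro conjI ballI)
  show "open S" by fact
  fix b assume b: "b \<in> A"
  have tr: "smooth_on (snd b ` (fst b \<inter> S)) (snd a \<circ> inv_chart b)"
    by (rule smooth_on_subset[OF trans_smooth[OF b assms(1)]]) (use assms in auto)
  have S: "snd a ` (fst a \<inter> (fst b \<inter> S)) \<subseteq> snd a ` (fst a \<inter> fst b)"
    "snd a ` (fst a \<inter> (fst b \<inter> S)) \<subseteq> snd a ` (fst a \<inter> S)" by auto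
  have o: "open (snd a ` (fst a \<inter> (fst b \<inter> S)))"
    using assms b chart_image_open chart_homeo by blast
  have "smooth_on (snd a ` (fst a \<inter> (fst b \<inter> S)))
      (\<lambda>z. frechet_derivative (snd b \<circ> inv_chart a) (at z) ((vec_comp A a X \<circ> inv_chart a) z))"
    using smooth_on_frechet_derivative_along[OF o smooth_on_subset[OF trans_smooth[OF assms(1) b] S(1)]
        smooth_on_subset[OF assms(4) S(2)]] .
  then have "smooth_on (snd b ` (fst b \<inter> S))
      ((\<lambda>z. frechet_derivative (snd b \<circ> inv_chart a) (at z) ((vec_comp A a X \<circ> inv_chart a) z))
        \<circ> (snd a \<circ> inv_chart b))"
    by (rule smooth_on_compose[OF _ o _ tr, rotated 2]) (use assms b chart_image_open in auto)
  then show "smooth_on (snd b ` (fst b \<inter> S)) (vec_comp A b X \<circ> inv_chart b)"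
  proof (rule smooth_on_cong[rotated 2])
    fix z assume "z \<in> snd b ` (fst b \<inter> S)"
    then obtain q where q: "q \<in> fst b" "q \<in> S" "z = snd b q" by blast
    then show "((\<lambda>z. frechet_derivative (snd b \<circ> inv_chart a) (at z) ((vec_comp A a X \<circ> inv_chart a) z))
        \<circ> (snd a \<circ> inv_chart b)) z = (vec_comp A b X \<circ> inv_chart b) z"
      using assms b jac_change_chart[of a b q]
      by (auto simp: vec_comp_def trans_deriv_def subset_iff)
  qed (use assms b chart_image_open in auto)
qed

lemma coord_field_vector_field:
  assumes "a \<in> A" "open S" "S \<subseteq> fst a"
  shows "vector_field A S (coord_field A a u)"
proof (rule vector_field_chartI[OF assms])
  show "smooth_on (snd a ` (fst a \<inter> S)) (vec_comp A a (coord_field A a u) \<circ> inv_chart a)"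
    by (rule smooth_on_cong[OF _ _ smooth_on_const[of _ u]])
      (use assms chart_image_open in \<open>auto simp: vec_comp_def jac_coord_field\<close>)
qed

lemma vec_comp_smooth_fun:
  assumes "a \<in> A" "S \<subseteq> fst a" "vector_field A S X"
  shows "smooth_fun A S (\<lambda>q. vec_comp A a X q $ i)"
proof (rule smooth_fun_chartI[OF assms(1) vector_field_open[OF assms(3)] assms(2)])
  have "smooth_on (snd a ` (fst a \<inter> S)) (\<lambda>z. (vec_comp A a X \<circ> inv_chart a) z $ i)"
    by (rule smooth_on_bounded_linear[OF _ bounded_linear_vec_nth])
      (use assms vector_field_open chart_image_open in \<open>auto simp: vector_field_def o_def\<close>)
  then show "smooth_on (snd a ` (fst a \<inter> S)) ((\<lambda>q. vec_comp A a X q $ i) \<circ> inv_chart a)"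
    by (simp add: o_def)
qed

lemma coord_expansion:
  assumes "a \<in> A" "q \<in> fst a"
  shows "X q = (\<Sum>i\<in>UNIV. vec_comp A a X q $ i *\<^sub>R coord_field A a (axis i 1) q)"
proof -
  have "coord_field A a (jac A a q (X q)) q =
      coord_field A a (\<Sum>i\<in>UNIV. (jac A a q (X q) $ i) *\<^sub>R axis i 1) q"
    by (simp add: basis_expansion[where 'a = real, unfolded scalar_mult_eq_scaleR])
  then show ?thesis
    using assms by (simp add: coord_field_jac vec_comp_def linear_sum[OF linear_coord_field]
        linear_cmul[OF linear_coord_field])
qed

text \<open>Bridges two descriptions of one subspace: the slice condition on coordinates, as in
  \<open>tangent_bundle\<close>, and the span of frame vectors, as preserved by
  orthogonalization.\<close>

lemma span_coord_field:
  assumes "b \<in> A" "q \<in> fst b"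
  shows "span ((\<lambda>i. coord_field A b (axis i 1) q) ` I) = {v. \<forall>i. i \<notin> I \<longrightarrow> jac A b q v $ i = 0}"
proof (intro equalityI subsetI CollectI allI impI)
  note l = linear_jac[OF assms]
  fix v i assume "v \<in> span ((\<lambda>i. coord_field A b (axis i 1) q) ` I)" and i: "i \<notin> I"
  then show "jac A b q v $ i = 0"
  proof (induction rule: span_induct_alt)
    case base
    then show ?case by (simp add: linear_0[OF l])
  next
    case (step r x y)
    then obtain j where "j \<in> I" "x = coord_field A b (axis j 1) q" by blast
    moreover have "axis j 1 $ i = (0 :: real)" if "j \<in> I" for j
      using that i by (auto simp: axis_def)
    ultimately show ?case
      using step(2) i by (simp add: linear_add[OF l] linear_cmul[OF l] jac_coord_field[OF assms])
  qed
next
  fix v assume v: "v \<in> {v. \<forall>i. i \<notin> I \<longrightarrow> jac A b q v $ i = 0}"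
  have "v = (\<Sum>i\<in>UNIV. jac A b q v $ i *\<^sub>R coord_field A b (axis i 1) q)"
    using coord_expansion[OF assms, of "\<lambda>_. v"] by (simp add: vec_comp_def)
  also have "\<dots> \<in> span ((\<lambda>i. coord_field A b (axis i 1) q) ` I)"
  proof (rule span_sum)
    fix i
    show "jac A b q v $ i *\<^sub>R coord_field A b (axis i 1) q \<in> span ((\<lambda>i. coord_field A b (axis i 1) q) ` I)"
      using v by (cases "i \<in> I") (auto intro: span_scale[OF span_base] simp: span_zero)
  qed
  finally show "v \<in> span ((\<lambda>i. coord_field A b (axis i 1) q) ` I)" .
qed

lemma smooth_fun_dir_deriv:
  assumes "a \<in> A" "S \<subseteq> fst a" "vector_field A S X" "smooth_fun A S f"
  shows "smooth_fun A S (\<lambda>q. dir_deriv A q (X q) f)"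
proof (rule smooth_fun_chartI[OF assms(1) vector_field_open[OF assms(3)] assms(2)])
  have o: "open (snd a ` (fst a \<inter> S))"
    using assms chart_image_open vector_field_open by blast
  have "smooth_on (snd a ` (fst a \<inter> S))
      (\<lambda>z. frechet_derivative (f \<circ> inv_chart a) (at z) ((vec_comp A a X \<circ> inv_chart a) z))"
    by (rule smooth_on_frechet_derivative_along[OF o])
      (use assms in \<open>auto simp: smooth_fun_def vector_field_def o_def\<close>)
  then show "smooth_on (snd a ` (fst a \<inter> S)) ((\<lambda>q. dir_deriv A q (X q) f) \<circ> inv_chart a)"
    by (rule smooth_on_cong[OF o, rotated])
      (use assms dir_deriv_chart[OF assms(4,1)] in \<open>auto simp: vec_comp_def\<close>)
qed

section \<open>Derivation rules for directional derivatives\<close>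

lemma dir_deriv_const: "dir_deriv A q v (\<lambda>z. r) = 0"
  by (rule dir_derivI[where L = "\<lambda>v. 0"]) (simp add: o_def)

lemma dir_deriv_add:
  assumes "smooth_fun A S f" "smooth_fun A S g" "q \<in> S"
  shows "dir_deriv A q v (\<lambda>z. f z + g z) = dir_deriv A q v f + dir_deriv A q v g"
  by (rule dir_derivI)
    (use has_derivative_add[OF dir_deriv_has_derivative[OF assms(1,3)]
        dir_deriv_has_derivative[OF assms(2,3)]] in \<open>simp add: o_def\<close>)

lemma dir_deriv_mult:
  assumes "smooth_fun A S f" "smooth_fun A S g" "q \<in> S"
  shows "dir_deriv A q v (\<lambda>z. f z * g z) = dir_deriv A q v f * g q + f q * dir_deriv A q v g"
proof (rule dir_derivI)
  show "((\<lambda>z. f z * g z) \<circ> inv_chart (ref_chart A q) has_derivative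
      (\<lambda>v. dir_deriv A q v f * g q + f q * dir_deriv A q v g)) (at (snd (ref_chart A q) q))"
    using has_derivative_mult[OF dir_deriv_has_derivative[OF assms(1,3)]
        dir_deriv_has_derivative[OF assms(2,3)]]
    by (simp add: o_def ref_chart add.commute)
qed

lemma dir_deriv_cmult:
  "smooth_fun A S f \<Longrightarrow> q \<in> S \<Longrightarrow> dir_deriv A q v (\<lambda>z. r * f z) = r * dir_deriv A q v f"
  using dir_deriv_mult[of S "\<lambda>z. r" f q v] smooth_fun_const[OF smooth_fun_open, of S f r]
  by (simp add: dir_deriv_const)

lemma dir_deriv_diff:
  "smooth_fun A S f \<Longrightarrow> smooth_fun A S g \<Longrightarrow> q \<in> S \<Longrightarrow>
    dir_deriv A q v (\<lambda>z. f z - g z) = dir_deriv A q v f - dir_deriv A q v g"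
  using dir_deriv_add[of S f "\<lambda>z. - 1 * g z" q v] dir_deriv_cmult[of S g q v "- 1"]
    smooth_fun_cmult[of S g "- 1"] by simp

text \<open>In the reference chart at q the components of a coordinate field of \<open>a\<close> are
  derivatives of the coordinate change in a fixed direction. The bracket is thus the antisymmetric
  part of a second derivative, which vanishes.\<close>

lemma lie_bracket_coord_field:
  assumes "a \<in> A" "q \<in> fst a"
  shows "lie_bracket A (coord_field A a u) (coord_field A a w) q = 0"
proof -
  let ?r = "ref_chart A q"
  let ?S = "snd a ` (fst a \<inter> fst ?r)"
  let ?h = "snd ?r \<circ> inv_chart a"
  have o: "open ?S" using assms ref_chart chart_homeo chart_image_open by blast
  have sm: "smooth_on ?S ?h" using trans_smooth assms ref_chart by blast
  have q: "snd a q \<in> ?S" using assms ref_chart by blast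
  have *: "dir_deriv A q (coord_field A a u q) (vec_comp A ?r (coord_field A a w)) =
      frechet_derivative (\<lambda>z. frechet_derivative ?h (at z) w) (at (snd a q)) u" for u w
  proof -
    have "((vec_comp A ?r (coord_field A a w) \<circ> inv_chart a) has_derivative
        frechet_derivative (\<lambda>z. frechet_derivative ?h (at z) w) (at (snd a q))) (at (snd a q))"
    proof (rule has_derivative_transform_within_open[OF smooth_on_has_derivative[OF
            smooth_on_frechet_derivative[OF sm] q] o q])
      fix z assume "z \<in> ?S"
      then obtain q' where q': "q' \<in> fst a" "q' \<in> fst ?r" "z = snd a q'" by blast
      then show "frechet_derivative ?h (at z) w = (vec_comp A ?r (coord_field A a w) \<circ> inv_chart a) z"
        using jac_change_chart[of a ?r q'] assms ref_chart
        by (simp add: vec_comp_def jac_coord_field trans_deriv_def)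
    qed
    from dir_deriv_eqI[OF assms this] show ?thesis
      using assms by (simp add: jac_coord_field)
  qed
  show ?thesis
    unfolding lie_bracket_def * using symmetric_second_derivative[OF o sm q] by simp
qed

end

section \<open>Connections as pointwise operators\<close>

context smooth_mfd
begin

lemma ref_chart_open: "open (fst (ref_chart A p))"
  using chart_homeo(1) ref_chart by blast

lemma coord_field_nonzero:
  assumes "a \<in> A" "q \<in> fst a" "u \<noteq> 0"
  shows "coord_field A a u q \<noteq> 0"
  using assms(3) jac_coord_field[OF assms(1,2), of u] linear_0[OF linear_jac[OF assms(1,2)]] by metis

lemma
  assumes "connection A D"
  shows conn_vector_field:
      "\<And>S X Y. vector_field A S X \<Longrightarrow> vector_field A S Y \<Longrightarrow> vector_field A S (D X Y)"
    and conn_cong: "\<And>S X X' Y Y' p. vector_field A S X \<Longrightarrow> vector_field A S X' \<Longrightarrow>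
      vector_field A S Y \<Longrightarrow> vector_field A S Y' \<Longrightarrow>
      (\<And>q. q \<in> S \<Longrightarrow> X q = X' q) \<Longrightarrow> (\<And>q. q \<in> S \<Longrightarrow> Y q = Y' q) \<Longrightarrow> p \<in> S \<Longrightarrow> D X Y p = D X' Y' p"
    and conn_add_left: "\<And>S X X' Y p. vector_field A S X \<Longrightarrow> vector_field A S X' \<Longrightarrow>
      vector_field A S Y \<Longrightarrow> p \<in> S \<Longrightarrow> D (\<lambda>q. X q + X' q) Y p = D X Y p + D X' Y p"
    and conn_add_right: "\<And>S X Y Y' p. vector_field A S X \<Longrightarrow> vector_field A S Y \<Longrightarrow>
      vector_field A S Y' \<Longrightarrow> p \<in> S \<Longrightarrow> D X (\<lambda>q. Y q + Y' q) p = D X Y p + D X Y' p"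
    and conn_scaleR_left: "\<And>S f X Y p. smooth_fun A S f \<Longrightarrow> vector_field A S X \<Longrightarrow>
      vector_field A S Y \<Longrightarrow> p \<in> S \<Longrightarrow> D (\<lambda>q. f q *\<^sub>R X q) Y p = f p *\<^sub>R D X Y p"
    and conn_scaleR_right: "\<And>S f X Y p. smooth_fun A S f \<Longrightarrow> vector_field A S X \<Longrightarrow>
      vector_field A S Y \<Longrightarrow> p \<in> S \<Longrightarrow>
      D X (\<lambda>q. f q *\<^sub>R Y q) p = dir_deriv A p (X p) f *\<^sub>R Y p + f p *\<^sub>R D X Y p"
proof -
  note [simp del] = split_paired_All split_paired_Ex
  fix S X X' Y Y' p f
  note c = assms[unfolded connection_def]
  show "vector_field A S X \<Longrightarrow> vector_field A S Y \<Longrightarrow> vector_field A S (D X Y)"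
    using c[THEN conjunct1] by blast
  show "vector_field A S X \<Longrightarrow> vector_field A S X' \<Longrightarrow>
      vector_field A S Y \<Longrightarrow> vector_field A S Y' \<Longrightarrow>
      (\<And>q. q \<in> S \<Longrightarrow> X q = X' q) \<Longrightarrow> (\<And>q. q \<in> S \<Longrightarrow> Y q = Y' q) \<Longrightarrow> p \<in> S \<Longrightarrow> D X Y p = D X' Y' p"
    using c[THEN conjunct2, THEN conjunct1] by blast
  show "vector_field A S X \<Longrightarrow> vector_field A S X' \<Longrightarrow>
      vector_field A S Y \<Longrightarrow> p \<in> S \<Longrightarrow> D (\<lambda>q. X q + X' q) Y p = D X Y p + D X' Y p"
    using c[THEN conjunct2, THEN conjunct2, THEN conjunct1] by blast
  show "vector_field A S X \<Longrightarrow> vector_field A S Y \<Longrightarrow>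
      vector_field A S Y' \<Longrightarrow> p \<in> S \<Longrightarrow> D X (\<lambda>q. Y q + Y' q) p = D X Y p + D X Y' p"
    using c[THEN conjunct2, THEN conjunct2, THEN conjunct2, THEN conjunct1] by blast
  show "smooth_fun A S f \<Longrightarrow> vector_field A S X \<Longrightarrow>
      vector_field A S Y \<Longrightarrow> p \<in> S \<Longrightarrow> D (\<lambda>q. f q *\<^sub>R X q) Y p = f p *\<^sub>R D X Y p"
    using c[THEN conjunct2, THEN conjunct2, THEN conjunct2, THEN conjunct2, THEN conjunct1] by blast
  show "smooth_fun A S f \<Longrightarrow> vector_field A S X \<Longrightarrow> vector_field A S Y \<Longrightarrow> p \<in> S \<Longrightarrow>
      D X (\<lambda>q. f q *\<^sub>R Y q) p = dir_deriv A p (X p) f *\<^sub>R Y p + f p *\<^sub>R D X Y p"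
    using c[THEN conjunct2, THEN conjunct2, THEN conjunct2, THEN conjunct2, THEN conjunct2] by blast
qed

lemma conn_sum_left:
  assumes "connection A D" "open S" "finite I" "\<And>i. i \<in> I \<Longrightarrow> smooth_fun A S (f i)"
    "\<And>i. i \<in> I \<Longrightarrow> vector_field A S (X i)" "vector_field A S Y" "p \<in> S"
  shows "D (\<lambda>q. \<Sum>i\<in>I. f i q *\<^sub>R X i q) Y p = (\<Sum>i\<in>I. f i p *\<^sub>R D (X i) Y p)"
  using assms(3,4,5)
proof (induction I rule: finite_induct)
  case empty
  \<comment> \<open>The axioms of a connection contain no separate rule for the zero field; its
    value comes from scaling by the constant 0.\<close>
  have "D (\<lambda>q. 0 *\<^sub>R 0) Y p = 0 *\<^sub>R D (\<lambda>q. 0) Y p"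
    using conn_scaleR_left[OF assms(1) smooth_fun_const[OF assms(2)] vector_field_zero[OF assms(2)]
        assms(6,7), of 0] .
  then show ?case by simp
next
  case (insert i I)
  have "D (\<lambda>q. f i q *\<^sub>R X i q + (\<Sum>i\<in>I. f i q *\<^sub>R X i q)) Y p =
      D (\<lambda>q. f i q *\<^sub>R X i q) Y p + D (\<lambda>q. \<Sum>i\<in>I. f i q *\<^sub>R X i q) Y p"
    by (rule conn_add_left[OF assms(1) _ _ assms(6,7)])
      (use insert.prems assms(2) in \<open>auto intro!: vector_field_scaleR vector_field_sum\<close>)
  then show ?case
    using insert conn_scaleR_left[OF assms(1) _ _ assms(6,7), of "f i" "X i"] by simp
qed

text \<open>Expand X in the coordinate fields of a chart around p: linearity over functions in the
  first argument leaves only the components of X at p.\<close>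

lemma conn_tensorial:
  assumes "connection A D" "vector_field A S X" "vector_field A S X'" "vector_field A S Y" "p \<in> S"
    "X p = X' p"
  shows "D X Y p = D X' Y p"
proof -
  let ?a = "ref_chart A p"
  let ?T = "S \<inter> fst ?a"
  note a = ref_chart[of p]
  have T: "open ?T" "?T \<subseteq> S" "?T \<subseteq> fst ?a" "p \<in> ?T"
    using assms vector_field_open ref_chart_open a by auto
  have *: "D X Y p = (\<Sum>i\<in>UNIV. vec_comp A ?a X p $ i *\<^sub>R D (coord_field A ?a (axis i 1)) Y p)"
    if X: "vector_field A S X" for X
  proof -
    have Y: "vector_field A ?T Y" and X: "vector_field A ?T X"
      using vector_field_subset X assms T by blast+
    note s = vec_comp_smooth_fun[OF a(1) T(3) X] coord_field_vector_field[OF a(1) T(1,3)]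
    have "D X Y p = D (\<lambda>q. \<Sum>i\<in>UNIV. vec_comp A ?a X q $ i *\<^sub>R coord_field A ?a (axis i 1) q) Y p"
      by (rule conn_cong[OF assms(1) X _ Y Y _ _ T(4)])
        (use s T coord_expansion[OF a(1), of _ X] in \<open>auto intro!: vector_field_sum vector_field_scaleR\<close>)
    also have "\<dots> = (\<Sum>i\<in>UNIV. vec_comp A ?a X p $ i *\<^sub>R D (coord_field A ?a (axis i 1)) Y p)"
      by (rule conn_sum_left[OF assms(1) T(1) _ _ _ Y T(4)]) (use s in auto)
    finally show ?thesis .
  qed
  show ?thesis
    using *[OF assms(2)] *[OF assms(3)] assms(6) by (simp add: vec_comp_def)
qed

text \<open>Replaces the operator on fields by \<open>cov\<close>, whose direction is a single
  vector; the change formulas below are stated for \<open>cov\<close>.\<close>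

lemma conn_eq_cov:
  assumes "connection A D" "vector_field A S X" "vector_field A S Y" "p \<in> S"
  shows "D X Y p = cov A D p (X p) Y"
proof -
  let ?a = "ref_chart A p"
  let ?T = "S \<inter> fst ?a"
  have T: "open ?T" "?T \<subseteq> S" "?T \<subseteq> fst ?a" "p \<in> ?T"
    using assms vector_field_open ref_chart_open ref_chart by auto
  show ?thesis
    unfolding cov_def
    by (rule conn_tensorial[OF assms(1) _ _ _ T(4)])
      (use T assms vector_field_subset coord_field_vector_field ref_chart coord_field_ref_chart in auto)
qed

lemma cov_vector_field:
  assumes "connection A D" "vector_field A S X" "vector_field A S Y"
  shows "vector_field A S (\<lambda>q. cov A D q (X q) Y)"
  by (rule vector_field_cong[OF conn_vector_field[OF assms]]) (use conn_eq_cov[OF assms] in auto)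

text \<open>Extends the arguments of \<open>cov\<close> to fields, so that the rules of \<open>connection\<close> apply.\<close>

lemma obtain_extension:
  assumes "open S" "p \<in> S"
  obtains T where "open T" "p \<in> T" "T \<subseteq> S" "T \<subseteq> fst (ref_chart A p)"
    "\<And>x. vector_field A T (coord_field A (ref_chart A p) x)"
    "\<And>x. coord_field A (ref_chart A p) x p = x"
proof -
  let ?T = "S \<inter> fst (ref_chart A p)"
  have "open ?T" "p \<in> ?T" "?T \<subseteq> S" "?T \<subseteq> fst (ref_chart A p)"
    using assms ref_chart_open ref_chart by auto
  then show thesis
    using that[of ?T] coord_field_vector_field ref_chart coord_field_ref_chart by blast
qed

lemma cov_linear:
  assumes "connection A D" "vector_field A S Y" "p \<in> S"
  shows "linear (\<lambda>x. cov A D p x Y)"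
proof -
  let ?E = "coord_field A (ref_chart A p)"
  obtain T where T: "open T" "p \<in> T" "T \<subseteq> S" "T \<subseteq> fst (ref_chart A p)"
    "\<And>x. vector_field A T (?E x)" "\<And>x. ?E x p = x"
    using obtain_extension vector_field_open assms by metis
  have Y: "vector_field A T Y" using vector_field_subset assms T by blast
  have "cov A D p (x + y) Y = cov A D p x Y + cov A D p y Y" for x y
  proof -
    have "cov A D p (x + y) Y = D (\<lambda>q. ?E x q + ?E y q) Y p"
      using conn_eq_cov[OF assms(1) vector_field_add[OF T(5) T(5)] Y T(2)] T(6) by simp
    then show ?thesis
      using conn_add_left[OF assms(1) T(5) T(5) Y T(2)] by (simp add: cov_def)
  qed
  moreover have "cov A D p (r *\<^sub>R x) Y = r *\<^sub>R cov A D p x Y" for r x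
  proof -
    have "cov A D p (r *\<^sub>R x) Y = D (\<lambda>q. r *\<^sub>R ?E x q) Y p"
      using conn_eq_cov[OF assms(1) vector_field_cmult[OF T(5)] Y T(2)] T(6) by simp
    then show ?thesis
      using conn_scaleR_left[OF assms(1) smooth_fun_const[OF T(1)] T(5) Y T(2)] by (simp add: cov_def)
  qed
  ultimately show ?thesis by (rule linearI)
qed

lemma cov_cong:
  assumes "connection A D" "vector_field A S Y" "vector_field A S Y'" "p \<in> S"
    "\<And>q. q \<in> S \<Longrightarrow> Y q = Y' q"
  shows "cov A D p x Y = cov A D p x Y'"
proof -
  obtain T where T: "open T" "p \<in> T" "T \<subseteq> S" "\<And>x. vector_field A T (coord_field A (ref_chart A p) x)"
    using obtain_extension vector_field_open assms by metis
  show ?thesis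
    unfolding cov_def
    by (rule conn_cong[OF assms(1) T(4) T(4) _ _ _ _ T(2)])
      (use assms T vector_field_subset in auto)
qed

lemma cov_add:
  assumes "connection A D" "vector_field A S Y" "vector_field A S Y'" "p \<in> S"
  shows "cov A D p x (\<lambda>q. Y q + Y' q) = cov A D p x Y + cov A D p x Y'"
proof -
  obtain T where T: "open T" "p \<in> T" "T \<subseteq> S" "\<And>x. vector_field A T (coord_field A (ref_chart A p) x)"
    using obtain_extension vector_field_open assms by metis
  show ?thesis
    unfolding cov_def
    by (rule conn_add_right[OF assms(1) T(4) _ _ T(2)]) (use assms T vector_field_subset in auto)
qed

lemma cov_scaleR:
  assumes "connection A D" "smooth_fun A S f" "vector_field A S Y" "p \<in> S"
  shows "cov A D p x (\<lambda>q. f q *\<^sub>R Y q) = dir_deriv A p x f *\<^sub>R Y p + f p *\<^sub>R cov A D p x Y"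
proof -
  obtain T where T: "open T" "p \<in> T" "T \<subseteq> S" "\<And>x. vector_field A T (coord_field A (ref_chart A p) x)"
    "\<And>x. coord_field A (ref_chart A p) x p = x"
    using obtain_extension vector_field_open assms by metis
  show ?thesis
    unfolding cov_def
    by (subst conn_scaleR_right[OF assms(1) _ T(4) _ T(2)])
      (use assms T vector_field_subset smooth_fun_subset in auto)
qed

lemma cov_diff:
  assumes "connection A D" "vector_field A S Y" "vector_field A S Y'" "p \<in> S"
  shows "cov A D p x (\<lambda>q. Y q - Y' q) = cov A D p x Y - cov A D p x Y'"
proof -
  have "cov A D p x (\<lambda>q. Y q + (- 1) *\<^sub>R Y' q) = cov A D p x Y + cov A D p x (\<lambda>q. (- 1) *\<^sub>R Y' q)"
    using cov_add[OF assms(1,2) vector_field_cmult assms(4)] assms(3) .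
  moreover have "cov A D p x (\<lambda>q. (- 1) *\<^sub>R Y' q) = - cov A D p x Y'"
    using cov_scaleR[OF assms(1) smooth_fun_const[OF vector_field_open[OF assms(3)]] assms(3,4), of x "- 1"]
    by (simp add: dir_deriv_const)
  ultimately show ?thesis by simp
qed

lemma cov_sum:
  assumes "connection A D" "open S" "finite I" "\<And>i. i \<in> I \<Longrightarrow> vector_field A S (Y i)" "p \<in> S"
  shows "cov A D p x (\<lambda>q. \<Sum>i\<in>I. Y i q) = (\<Sum>i\<in>I. cov A D p x (Y i))"
  using assms(3,4)
proof (induction I rule: finite_induct)
  case empty
  have "cov A D p x (\<lambda>q. 0 *\<^sub>R 0) = dir_deriv A p x (\<lambda>q. 0) *\<^sub>R 0 + 0 *\<^sub>R cov A D p x (\<lambda>q. 0)"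
    using cov_scaleR[OF assms(1) smooth_fun_const[OF assms(2)] vector_field_zero[OF assms(2)]
        assms(5), of x 0] .
  then show ?case by simp
next
  case (insert i I)
  then have "cov A D p x (\<lambda>q. Y i q + (\<Sum>i\<in>I. Y i q)) =
      cov A D p x (Y i) + cov A D p x (\<lambda>q. \<Sum>i\<in>I. Y i q)"
    by (intro cov_add[OF assms(1) _ vector_field_sum[OF assms(2)] assms(5)]) auto
  then show ?case using insert by simp
qed

lemma cov_torsion:
  assumes "connection A D" "torsion_free A D" "vector_field A S X" "vector_field A S Y" "p \<in> S"
  shows "cov A D p (X p) Y - cov A D p (Y p) X = lie_bracket A X Y p"
  using assms conn_eq_cov[OF assms(1,3,4,5)] conn_eq_cov[OF assms(1,4,3,5)]
  unfolding torsion_free_def by metis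

end

section \<open>Weyl structures in a local trivialization\<close>

locale conformal_mfd = smooth_mfd A
  for A :: "('a::{t2_space,second_countable_topology}, 'm::finite) chart set" +
  fixes c :: "'a \<Rightarrow> real ^ 'm \<Rightarrow> real ^ 'm \<Rightarrow> real"
  assumes cf: "conformal_structure A c"
begin

text \<open>The metric in the conformal class that corresponds to the section \<open>coord_dens A a\<close> of \<open>L\<close>.\<close>

definition gm :: "('a, 'm) chart \<Rightarrow> 'a \<Rightarrow> real ^ 'm \<Rightarrow> real ^ 'm \<Rightarrow> real"
  where "gm a q x y = \<bar>det (matrix (jac A a q))\<bar> powr (2 / real CARD('m)) * c q x y"

lemma c_bilinear: "bilinear (c q)"
  using cf unfolding conformal_structure_def by blast

lemma gm_bilinear: "bilinear (gm a q)"
  using c_bilinear[of q] unfolding bilinear_def gm_def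
  by (auto simp: linear_iff algebra_simps)

lemma gm_sym: "gm a q x y = gm a q y x"
  using cf unfolding conformal_structure_def gm_def by auto

lemma c_pos: "x \<noteq> 0 \<Longrightarrow> c q x x > 0"
  using cf unfolding conformal_structure_def by blast

lemma gm_pos: "a \<in> A \<Longrightarrow> q \<in> fst a \<Longrightarrow> x \<noteq> 0 \<Longrightarrow> gm a q x x > 0"
  using det_jac_nonzero c_pos unfolding gm_def by simp

lemmas gm_linear_simps =
  bilinear_ladd[OF gm_bilinear] bilinear_radd[OF gm_bilinear]
  bilinear_lmul[OF gm_bilinear] bilinear_rmul[OF gm_bilinear]
  bilinear_lsub[OF gm_bilinear] bilinear_rsub[OF gm_bilinear]
  bilinear_lzero[OF gm_bilinear] bilinear_rzero[OF gm_bilinear]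
  bilinear_lneg[OF gm_bilinear] bilinear_rneg[OF gm_bilinear]

lemma gm_linear: "linear (gm a q x)" "linear (\<lambda>x. gm a q x y)"
  using gm_bilinear unfolding bilinear_def by auto

lemma gm_ref_chart: "gm (ref_chart A q) q = c q"
proof -
  have "jac A (ref_chart A q) q = (\<lambda>v. v)" using jac_ref_chart by auto
  then show ?thesis unfolding gm_def by (simp add: matrix_id_mat_1[unfolded id_def])
qed

lemma gm_dens_comp: "gm a q (X q) (Y q) = dens_comp A 2 a (\<lambda>q. c q (X q) (Y q)) q"
  unfolding gm_def dens_comp_def by simp

lemma gm_smooth:
  assumes "a \<in> A" "S \<subseteq> fst a" "vector_field A S X" "vector_field A S Y"
  shows "smooth_fun A S (\<lambda>q. gm a q (X q) (Y q))"
proof (rule smooth_fun_chartI[OF assms(1) vector_field_open[OF assms(3)] assms(2)])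
  have "density_field A 2 S (\<lambda>q. c q (X q) (Y q))"
    using cf assms unfolding conformal_structure_def by blast
  then have "smooth_on (snd a ` (fst a \<inter> S)) (dens_comp A 2 a (\<lambda>q. c q (X q) (Y q)) \<circ> inv_chart a)"
    using assms unfolding density_field_def by blast
  then show "smooth_on (snd a ` (fst a \<inter> S)) ((\<lambda>q. gm a q (X q) (Y q)) \<circ> inv_chart a)"
    by (simp add: gm_dens_comp o_def)
qed

text \<open>The 1-form \<alpha> of the connection on L in the gauge l =
  \<open>coord_dens A a\<close>, determined by \<nabla>l = \<alpha> l. Dividing by l turns an
  L-valued number into a scalar.\<close>

definition conn_form ::
    "('a, 'm) chart \<Rightarrow> ('a, 'm) connection_op \<Rightarrow> 'a \<Rightarrow> real ^ 'm \<Rightarrow> real"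
  where "conn_form a D q v =
    cov_dens A D 1 (coord_field A (ref_chart A q) v) (coord_dens A a) q / coord_dens A a q"

lemma coord_dens_pos: "a \<in> A \<Longrightarrow> q \<in> fst a \<Longrightarrow> coord_dens A a q > 0"
  using det_jac_nonzero unfolding coord_dens_def by simp

lemma coord_dens_ref_chart: "coord_dens A (ref_chart A q) q = 1"
proof -
  have "jac A (ref_chart A q) q = (\<lambda>v. v)" using jac_ref_chart by auto
  then show ?thesis unfolding coord_dens_def by (simp add: matrix_id_mat_1[unfolded id_def])
qed

lemma c_eq_gm: "a \<in> A \<Longrightarrow> q \<in> fst a \<Longrightarrow> c q x y = (coord_dens A a q)\<^sup>2 * gm a q x y"
  using det_jac_nonzero[of a q]
  unfolding coord_dens_def gm_def power2_eq_square
  by (simp add: mult.assoc[symmetric] powr_add[symmetric])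

text \<open>Near \<open>q\<close>, the section \<open>coord_dens A a\<close> in the trivialization of the reference chart at \<open>q\<close>.
  It is the square root of a quotient of two metrics in the conformal class, hence differentiable.\<close>

lemma transition_dens:
  assumes a: "a \<in> A" "q \<in> fst a"
  obtains s ds where
    "((s \<circ> inv_chart (ref_chart A q)) has_derivative ds) (at (snd (ref_chart A q) q))"
    "s q = coord_dens A a q"
    "\<And>z l. z \<in> fst a \<Longrightarrow> z \<in> fst (ref_chart A q) \<Longrightarrow>
      dens_comp A 1 (ref_chart A q) (\<lambda>z. l z * coord_dens A a z) z = l z * s z"
    "\<And>z X Y. z \<in> fst a \<Longrightarrow> z \<in> fst (ref_chart A q) \<Longrightarrow>
      gm (ref_chart A q) z (X z) (Y z) = (s z)\<^sup>2 * gm a z (X z) (Y z)"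
proof -
  let ?r = "ref_chart A q"
  let ?S = "fst a \<inter> fst ?r"
  define s where "s z = \<bar>det (matrix (jac A ?r z))\<bar> powr (1 / real CARD('m)) * coord_dens A a z" for z
  have S: "open ?S" "q \<in> ?S" "?S \<subseteq> fst a" "?S \<subseteq> fst ?r"
    using a ref_chart ref_chart_open chart_homeo(1)[OF a(1)] by auto
  have scale: "gm ?r z x y = (s z)\<^sup>2 * gm a z x y" if "z \<in> fst a" "z \<in> fst ?r" for z x y
  proof -
    have "\<bar>det (matrix (jac A ?r z))\<bar> powr (2 / real CARD('m)) =
        (\<bar>det (matrix (jac A ?r z))\<bar> powr (1 / real CARD('m)))\<^sup>2"
      by (simp add: power2_eq_square powr_add[symmetric])
    then show ?thesis
      using c_eq_gm[OF a(1) that(1), of x y] unfolding gm_def[of ?r] s_def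
      by (simp add: power_mult_distrib)
  qed
  \<comment> \<open>Any nowhere zero field serves, since the quotient of the two metrics does not
    depend on the vector; this one has all components equal to 1 in \<open>a\<close>.\<close>
  define Y where "Y = coord_field A a (1 :: real ^ 'm)"
  have Y: "vector_field A ?S Y" unfolding Y_def by (rule coord_field_vector_field[OF a(1) S(1,3)])
  have nz: "Y z \<noteq> 0" if "z \<in> ?S" for z
    unfolding Y_def using that coord_field_nonzero[OF a(1)] by simp
  have sm: "smooth_fun A ?S (\<lambda>z. gm ?r z (Y z) (Y z) / gm a z (Y z) (Y z))"
    by (intro smooth_fun_divide gm_smooth Y a ref_chart S)
      (use nz gm_pos[OF a(1)] in force)
  have sq: "gm ?r z (Y z) (Y z) / gm a z (Y z) (Y z) = (s z)\<^sup>2" if "z \<in> ?S" for z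
    using scale[of z] that nz[OF that] gm_pos[OF a(1), of z "Y z"] by auto
  have spos: "s z > 0" if "z \<in> ?S" for z
    unfolding s_def using that coord_dens_pos[OF a(1)] det_jac_nonzero[OF ref_chart(1)] by auto
  define L where "L v = dir_deriv A q v (\<lambda>z. gm ?r z (Y z) (Y z) / gm a z (Y z) (Y z))" for v
  have "(((\<lambda>z. gm ?r z (Y z) (Y z) / gm a z (Y z) (Y z)) \<circ> inv_chart ?r) has_derivative L)
      (at (snd ?r q))"
    unfolding L_def by (rule dir_deriv_has_derivative[OF sm S(2)])
  then have L: "(((\<lambda>z. (s z)\<^sup>2) \<circ> inv_chart ?r) has_derivative L) (at (snd ?r q))"
    by (rule has_derivative_transform_within_open[where s = "snd ?r ` (fst ?r \<inter> ?S)"])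
      (use ref_chart S sq chart_image_open in auto)
  have "((\<lambda>x. sqrt (((\<lambda>z. (s z)\<^sup>2) \<circ> inv_chart ?r) x)) has_derivative
      (\<lambda>v. (inverse (sqrt (((\<lambda>z. (s z)\<^sup>2) \<circ> inv_chart ?r) (snd ?r q))) / 2) * L v)) (at (snd ?r q))"
    using DERIV_compose_FDERIV[OF DERIV_real_sqrt L] spos[OF S(2)] ref_chart
    by (simp add: mult.commute)
  then have 1: "((s \<circ> inv_chart ?r) has_derivative
      (\<lambda>v. (inverse (sqrt (((\<lambda>z. (s z)\<^sup>2) \<circ> inv_chart ?r) (snd ?r q))) / 2) * L v)) (at (snd ?r q))"
    by (rule has_derivative_transform_within_open[where s = "snd ?r ` (fst ?r \<inter> ?S)"])
      (use ref_chart S abs_of_pos[OF spos] chart_image_open in auto)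
  have 2: "s q = coord_dens A a q"
  proof -
    have "jac A ?r q = (\<lambda>v. v)" using jac_ref_chart by auto
    then show ?thesis unfolding s_def by (simp add: matrix_id_mat_1[unfolded id_def])
  qed
  have 3: "dens_comp A 1 ?r (\<lambda>z. l z * coord_dens A a z) z = l z * s z" for z l
    unfolding dens_comp_def s_def by simp
  show thesis
    by (rule that[OF 1 2 3 scale])
qed

lemma Weyl_connection: "Weyl_structure A c D \<Longrightarrow> connection A D"
  and Weyl_torsion_free: "Weyl_structure A c D \<Longrightarrow> torsion_free A D"
  unfolding Weyl_structure_def by auto

text \<open>In the trivialization of the reference chart at q, the section
  \<open>coord_dens A a\<close> is a function s, and the connection on \<open>L^k\<close> is d + k
  \<kappa>. Hence \<alpha> = ds/s + \<kappa>. Metricity of c, which has weight 2 and component s^2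
  g, reads d(s^2 g) + 2 \<kappa> s^2 g = s^2 (g(\<nabla>Y, Z) + g(Y, \<nabla>Z)), and division by
  s^2 gives the formula for the derivative of g.\<close>

lemma trivialization:
  assumes W: "Weyl_structure A c D" and a: "a \<in> A" "q \<in> fst a" "S \<subseteq> fst a" "q \<in> S"
  shows cov_dens_trivial: "vector_field A S X \<Longrightarrow> smooth_fun A S f \<Longrightarrow>
      cov_dens A D 1 X (\<lambda>z. f z * coord_dens A a z) q =
      (dir_deriv A q (X q) f + conn_form a D q (X q) * f q) * coord_dens A a q"
    and Weyl_metric: "vector_field A S Y \<Longrightarrow> vector_field A S Z \<Longrightarrow>
      dir_deriv A q v (\<lambda>z. gm a z (Y z) (Z z)) =
      gm a q (cov A D q v Y) (Z q) + gm a q (Y q) (cov A D q v Z)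
      - 2 * conn_form a D q v * gm a q (Y q) (Z q)"
    and conn_form_linear: "linear (conn_form a D q)"
proof -
  let ?r = "ref_chart A q"
  note C = Weyl_connection[OF W]
  define \<kappa> where "\<kappa> v = trace (matrix (\<lambda>u. cov A D q v (coord_field A ?r u))) / real CARD('m)" for v
  obtain s ds where s: "((s \<circ> inv_chart ?r) has_derivative ds) (at (snd ?r q))"
    "s q = coord_dens A a q"
    "\<And>z l. z \<in> fst a \<Longrightarrow> z \<in> fst ?r \<Longrightarrow> dens_comp A 1 ?r (\<lambda>z. l z * coord_dens A a z) z = l z * s z"
    "\<And>z X Y. z \<in> fst a \<Longrightarrow> z \<in> fst ?r \<Longrightarrow>
      gm ?r z (X z) (Y z) = (s z)\<^sup>2 * gm a z (X z) (Y z)"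
    by (rule transition_dens[OF a(1,2)]) (rule that; assumption)
  have l0: "coord_dens A a q > 0" using coord_dens_pos a by blast
  have loc: "open (fst a \<inter> fst ?r)" "q \<in> fst a \<inter> fst ?r"
    using a ref_chart ref_chart_open chart_homeo(1)[OF a(1)] by auto
  have tr: "trace (matrix (\<lambda>u. D X (coord_field A ?r u) q)) = real CARD('m) * \<kappa> (X q)"
    if "vector_field A T X" "q \<in> T" for X T
  proof -
    have T: "open (T \<inter> fst ?r)" "T \<inter> fst ?r \<subseteq> T" "T \<inter> fst ?r \<subseteq> fst ?r" "q \<in> T \<inter> fst ?r"
      using that vector_field_open ref_chart ref_chart_open by auto
    have "D X (coord_field A ?r u) q = cov A D q (X q) (coord_field A ?r u)" for u
      by (rule conn_eq_cov[OF C _ _ T(4)])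
        (use vector_field_subset[OF that(1) T(1,2)] coord_field_vector_field[OF ref_chart(1) T(1,3)] in auto)
    then show ?thesis unfolding \<kappa>_def by simp
  qed
  have main: "cov_dens A D 1 X (\<lambda>z. f z * coord_dens A a z) q =
      dir_deriv A q (X q) f * coord_dens A a q + f q * (ds (X q) + \<kappa> (X q) * coord_dens A a q)"
    if X: "vector_field A T X" and f: "smooth_fun A T f" and qT: "q \<in> T" for X f T
  proof -
    have "dir_deriv A q (X q) (dens_comp A 1 ?r (\<lambda>z. f z * coord_dens A a z)) =
        dir_deriv A q (X q) (\<lambda>z. f z * s z)"
      by (rule dir_deriv_cong[OF loc]) (use s(3) in auto)
    also have "\<dots> = f q * ds (X q) + dir_deriv A q (X q) f * s q"
      by (rule dir_derivI)
        (use has_derivative_mult[OF dir_deriv_has_derivative[OF f qT] s(1)] ref_chart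
          in \<open>simp add: o_def\<close>)
    finally show ?thesis
      unfolding cov_dens_def using tr[OF X qT] s(2) by (simp add: algebra_simps)
  qed
  have form: "conn_form a D q v = (ds v + \<kappa> v * coord_dens A a q) / coord_dens A a q" for v
  proof -
    have "cov_dens A D 1 (coord_field A ?r v) (\<lambda>z. 1 * coord_dens A a z) q =
        dir_deriv A q (coord_field A ?r v q) (\<lambda>z. 1) * coord_dens A a q
        + 1 * (ds (coord_field A ?r v q) + \<kappa> (coord_field A ?r v q) * coord_dens A a q)"
      by (rule main[where T = "fst ?r"])
        (use ref_chart ref_chart_open coord_field_vector_field smooth_fun_const in auto)
    then show ?thesis
      unfolding conn_form_def by (simp add: dir_deriv_const coord_field_ref_chart)
  qed
  show "vector_field A S X \<Longrightarrow> smooth_fun A S f \<Longrightarrow>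
      cov_dens A D 1 X (\<lambda>z. f z * coord_dens A a z) q =
      (dir_deriv A q (X q) f + conn_form a D q (X q) * f q) * coord_dens A a q"
    using main[OF _ _ a(4)] l0 by (simp add: form field_simps)
  show "linear (conn_form a D q)"
  proof -
    have "linear \<kappa>"
    proof -
      have l: "linear (\<lambda>v. cov A D q v (coord_field A ?r u))" for u
        by (rule cov_linear[OF C, where S = "fst ?r"])
          (use coord_field_vector_field ref_chart ref_chart_open in auto)
      show ?thesis
        unfolding \<kappa>_def trace_def matrix_def
        by (rule linearI) (simp_all add: linear_add[OF l] linear_cmul[OF l] sum.distrib
            sum_distrib_left add_divide_distrib)
    qed
    moreover have "linear ds" using s(1) has_derivative_linear by blast
    ultimately show ?thesis
      unfolding form by (auto simp: linear_iff algebra_simps add_divide_distrib)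
  qed
  show "dir_deriv A q v (\<lambda>z. gm a z (Y z) (Z z)) =
      gm a q (cov A D q v Y) (Z q) + gm a q (Y q) (cov A D q v Z)
      - 2 * conn_form a D q v * gm a q (Y q) (Z q)"
    if Y: "vector_field A S Y" and Z: "vector_field A S Z"
  proof -
    obtain T where T: "open T" "q \<in> T" "T \<subseteq> S" "T \<subseteq> fst ?r" "\<And>x. vector_field A T (coord_field A ?r x)"
      "\<And>x. coord_field A ?r x q = x"
      using obtain_extension[OF vector_field_open[OF Y] a(4)] by metis
    let ?X = "coord_field A ?r v"
    have YT: "vector_field A T Y" and ZT: "vector_field A T Z"
      using vector_field_subset Y Z T by blast+
    note g = gm_smooth[OF a(1) _ YT ZT]
    have gT: "smooth_fun A T (\<lambda>z. gm a z (Y z) (Z z))" using g T a by blast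
    have "dir_deriv A q v (dens_comp A 2 ?r (\<lambda>z. c z (Y z) (Z z))) =
        dir_deriv A q v (\<lambda>z. s z * (s z * gm a z (Y z) (Z z)))"
      by (rule dir_deriv_cong[OF loc])
        (use s(4) gm_dens_comp[of ?r _ Y Z, symmetric] in \<open>auto simp: power2_eq_square\<close>)
    also have "\<dots> = s q * (s q * dir_deriv A q v (\<lambda>z. gm a z (Y z) (Z z)) + ds v * gm a q (Y q) (Z q))
        + ds v * (s q * gm a q (Y q) (Z q))"
      by (rule dir_derivI)
        (use has_derivative_mult[OF s(1) has_derivative_mult[OF s(1)
              dir_deriv_has_derivative[OF gT T(2)]]] ref_chart in \<open>simp add: o_def\<close>)
    finally have d: "cov_dens A D 2 ?X (\<lambda>z. c z (Y z) (Z z)) q =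
        s q * (s q * dir_deriv A q v (\<lambda>z. gm a z (Y z) (Z z)) + ds v * gm a q (Y q) (Z q))
        + ds v * (s q * gm a q (Y q) (Z q)) + 2 * \<kappa> v * c q (Y q) (Z q)"
      unfolding cov_dens_def using tr[OF T(5) T(2), of v] T(6) by simp
    have "cov_dens A D 2 ?X (\<lambda>z. c z (Y z) (Z z)) q = c q (D ?X Y q) (Z q) + c q (Y q) (D ?X Z q)"
      using W T(2) T(5)[of v] YT ZT unfolding Weyl_structure_def by blast
    also have "\<dots> = (s q)\<^sup>2 * (gm a q (cov A D q v Y) (Z q) + gm a q (Y q) (cov A D q v Z))"
      using c_eq_gm[OF a(1,2)] s(2) by (simp add: cov_def algebra_simps)
    finally have *: "cov_dens A D 2 ?X (\<lambda>z. c z (Y z) (Z z)) q =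
        (s q)\<^sup>2 * (gm a q (cov A D q v Y) (Z q) + gm a q (Y q) (cov A D q v Z))" .
    have "(s q)\<^sup>2 * dir_deriv A q v (\<lambda>z. gm a z (Y z) (Z z)) =
        (s q)\<^sup>2 * (gm a q (cov A D q v Y) (Z q) + gm a q (Y q) (cov A D q v Z)
        - 2 * conn_form a D q v * gm a q (Y q) (Z q))"
    proof -
      have ds: "ds v = conn_form a D q v * s q - \<kappa> v * s q"
        using form[of v] s(2) l0 by (simp add: field_simps)
      show ?thesis
        using * unfolding d c_eq_gm[OF a(1,2)] s(2)[symmetric] ds
        by (simp add: algebra_simps power2_eq_square)
    qed
    then show ?thesis using s(2) l0 by simp
  qed
qed

text \<open>The definition of \<open>conn_form\<close> passes through the reference chart at each
  point, so its smoothness is not visible there. Metricity applied to one nowhere zero field Y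
  solves for it: 2 \<alpha>(X) g(Y,Y) = 2 g(\<nabla>_X Y, Y) - X g(Y,Y).\<close>

lemma conn_form_smooth:
  assumes W: "Weyl_structure A c D" and a: "a \<in> A" "S \<subseteq> fst a" and X: "vector_field A S X"
  shows "smooth_fun A S (\<lambda>q. conn_form a D q (X q))"
proof -
  define Y where "Y = coord_field A a (1 :: real ^ 'm)"
  note o = vector_field_open[OF X]
  have Y: "vector_field A S Y" unfolding Y_def by (rule coord_field_vector_field[OF a(1) o a(2)])
  have pos: "gm a z (Y z) (Y z) > 0" if "z \<in> S" for z
    unfolding Y_def using that a gm_pos[OF a(1) _ coord_field_nonzero[OF a(1)]] by auto
  have "smooth_fun A S (\<lambda>q. (2 * gm a q (cov A D q (X q) Y) (Y q)
      - dir_deriv A q (X q) (\<lambda>z. gm a z (Y z) (Y z))) / (2 * gm a q (Y q) (Y q)))"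
    by (intro smooth_fun_divide smooth_fun_diff smooth_fun_cmult smooth_fun_dir_deriv[OF a X]
        gm_smooth[OF a] cov_vector_field Weyl_connection[OF W] Y X) (use pos in force)
  then show ?thesis
  proof (rule smooth_fun_cong)
    fix q assume q: "q \<in> S"
    show "(2 * gm a q (cov A D q (X q) Y) (Y q) - dir_deriv A q (X q) (\<lambda>z. gm a z (Y z) (Y z))) /
        (2 * gm a q (Y q) (Y q)) = conn_form a D q (X q)"
    proof -
      have "dir_deriv A q (X q) (\<lambda>z. gm a z (Y z) (Y z)) = 2 * gm a q (cov A D q (X q) Y) (Y q)
          - 2 * conn_form a D q (X q) * gm a q (Y q) (Y q)"
        using Weyl_metric[OF W a(1) _ a(2) q Y Y, of "X q"] q a(2)
        by (simp add: subset_iff gm_sym[of a q "Y q" "cov A D q (X q) Y"])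
      then show ?thesis using pos[OF q] by simp
    qed
  qed
qed

end

section \<open>Orthogonal families and traces\<close>

lemma orthogonal_family_expansion:
  fixes e :: "'i \<Rightarrow> 'v::real_vector" and b :: "'v \<Rightarrow> 'v \<Rightarrow> real"
  assumes "bilinear b" "finite J" "\<And>i. i \<in> J \<Longrightarrow> b (e i) (e i) \<noteq> 0"
    "\<And>i j. i \<in> J \<Longrightarrow> j \<in> J \<Longrightarrow> i \<noteq> j \<Longrightarrow> b (e i) (e j) = 0"
    and "v \<in> span (e ` J)"
  shows "v = (\<Sum>i\<in>J. (b v (e i) / b (e i) (e i)) *\<^sub>R e i)"
  using assms(5)
proof (induction rule: span_induct_alt)
  case base
  then show ?case by (simp add: bilinear_lzero[OF assms(1)])
next
  case (step r x y)
  then obtain k where k: "k \<in> J" "x = e k" by blast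
  have "(\<Sum>i\<in>J. (b (e k) (e i) / b (e i) (e i)) *\<^sub>R e i) = (\<Sum>i\<in>J. if i = k then e k else 0)"
    by (rule sum.cong) (use assms k in auto)
  also have "\<dots> = x" using k assms(2) by simp
  finally have "r *\<^sub>R x = r *\<^sub>R (\<Sum>i\<in>J. (b x (e i) / b (e i) (e i)) *\<^sub>R e i)"
    using k by simp
  then have "r *\<^sub>R x = (\<Sum>i\<in>J. (r * (b x (e i) / b (e i) (e i))) *\<^sub>R e i)"
    by (simp add: scaleR_sum_right)
  moreover have "(\<Sum>i\<in>J. (b (r *\<^sub>R x + y) (e i) / b (e i) (e i)) *\<^sub>R e i) =
      (\<Sum>i\<in>J. (r * (b x (e i) / b (e i) (e i))) *\<^sub>R e i) +
      (\<Sum>i\<in>J. (b y (e i) / b (e i) (e i)) *\<^sub>R e i)"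
    by (simp add: bilinear_ladd[OF assms(1)] bilinear_lmul[OF assms(1)]
        add_divide_distrib scaleR_add_left sum.distrib)
  ultimately show ?case using step(2) by metis
qed

lemma orthogonal_family_independent:
  fixes e :: "'i \<Rightarrow> 'v::real_vector" and b :: "'v \<Rightarrow> 'v \<Rightarrow> real"
  assumes "bilinear b" "finite J" "\<And>i. i \<in> J \<Longrightarrow> b (e i) (e i) \<noteq> 0"
    "\<And>i j. i \<in> J \<Longrightarrow> j \<in> J \<Longrightarrow> i \<noteq> j \<Longrightarrow> b (e i) (e j) = 0"
  shows "inj_on e J" "independent (e ` J)"
proof -
  show inj: "inj_on e J" using assms(3,4) by (metis inj_onI)
  have fin: "finite (e ` J)" using assms(2) by simp
  show "independent (e ` J)"
  proof (rule independent_if_scalars_zero[OF fin])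
    fix f x assume 0: "(\<Sum>x\<in>e ` J. f x *\<^sub>R x) = 0" and "x \<in> e ` J"
    then obtain k where k: "k \<in> J" "x = e k" by blast
    have "0 = b (\<Sum>i\<in>J. f (e i) *\<^sub>R e i) (e k)"
      using 0 inj by (simp add: sum.reindex bilinear_lzero[OF assms(1)])
    also have "\<dots> = (\<Sum>i\<in>J. if i = k then f (e k) * b (e k) (e k) else 0)"
      using assms(1) unfolding bilinear_def
      by (auto simp: linear_sum[of "\<lambda>x. b x (e k)"] linear_cmul[of "\<lambda>x. b x (e k)"] assms(4) k
          intro!: sum.cong)
    also have "\<dots> = f (e k) * b (e k) (e k)" using k assms(2) by simp
    finally show "f x = 0" using assms(3) k by simp
  qed
qed

text \<open>\<open>trace_on\<close> sums over an unspecified basis B of V. Expanding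
  \<open>f v\<close> in the orthogonal family and each member of the family back in B, and
  exchanging the two sums, removes B.\<close>

lemma trace_on_orthogonal_family:
  fixes e :: "'i \<Rightarrow> real ^ 'm::finite" and b :: "real ^ 'm \<Rightarrow> real ^ 'm \<Rightarrow> real"
  assumes b: "bilinear b" "finite J" "\<And>i. i \<in> J \<Longrightarrow> b (e i) (e i) \<noteq> 0"
    "\<And>i j. i \<in> J \<Longrightarrow> j \<in> J \<Longrightarrow> i \<noteq> j \<Longrightarrow> b (e i) (e j) = 0"
    and V: "span (e ` J) = V" and f: "linear f" "\<And>v. v \<in> V \<Longrightarrow> f v \<in> V"
  shows "trace_on V f = (\<Sum>i\<in>J. b (f (e i)) (e i) / b (e i) (e i))"
proof -
  define B where "B = (SOME B. independent B \<and> span B = V)"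
  have "\<exists>B. independent B \<and> span B = V"
    using orthogonal_family_independent[of b J e] b V by blast
  then have "independent B \<and> span B = V" unfolding B_def by (rule someI_ex)
  then have B: "independent B" "span B = V" by auto
  have finB: "finite B" using B(1) independent_imp_finite by blast
  have eV: "e i \<in> span B" if "i \<in> J" for i
    using span_base[of "e i" "e ` J"] that V B(2) by simp
  have lb: "linear (\<lambda>x. b x y)" for y using b(1) unfolding bilinear_def by blast
  have step: "representation B (f v) v = (\<Sum>i\<in>J. b (f v) (e i) / b (e i) (e i) * representation B (e i) v)"
    if "v \<in> B" for v
  proof -
    have "v \<in> V" using span_base[OF that] B(2) by simp
    then have "f v \<in> span (e ` J)" using f(2) V by simp
    then have "f v = (\<Sum>i\<in>J. (b (f v) (e i) / b (e i) (e i)) *\<^sub>R e i)"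
      by (intro orthogonal_family_expansion) (use b in auto)
    then have "representation B (f v) v =
        representation B (\<Sum>i\<in>J. (b (f v) (e i) / b (e i) (e i)) *\<^sub>R e i) v" by simp
    also have "\<dots> = (\<Sum>i\<in>J. representation B ((b (f v) (e i) / b (e i) (e i)) *\<^sub>R e i) v)"
      by (subst representation_sum[OF B(1)]) (use eV span_scale in auto)
    also have "\<dots> = (\<Sum>i\<in>J. b (f v) (e i) / b (e i) (e i) * representation B (e i) v)"
      by (rule sum.cong) (simp_all add: representation_scale[OF B(1) eV])
    finally show ?thesis .
  qed
  have "trace_on V f = (\<Sum>v\<in>B. representation B (f v) v)"
    unfolding trace_on_def B_def Let_def ..
  also have "\<dots> = (\<Sum>v\<in>B. \<Sum>i\<in>J. b (f v) (e i) / b (e i) (e i) * representation B (e i) v)"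
    by (rule sum.cong) (simp_all add: step)
  also have "\<dots> = (\<Sum>i\<in>J. \<Sum>v\<in>B. b (f v) (e i) / b (e i) (e i) * representation B (e i) v)"
    by (rule sum.swap)
  also have "\<dots> = (\<Sum>i\<in>J. b (f (e i)) (e i) / b (e i) (e i))"
  proof (rule sum.cong[OF refl])
    fix i assume i: "i \<in> J"
    have "e i = (\<Sum>v\<in>B. representation B (e i) v *\<^sub>R v)"
      using sum_representation_eq[OF B(1) eV[OF i] finB] by simp
    then have "b (f (e i)) (e i) = b (f (\<Sum>v\<in>B. representation B (e i) v *\<^sub>R v)) (e i)" by simp
    also have "\<dots> = (\<Sum>v\<in>B. representation B (e i) v * b (f v) (e i))"
      by (simp add: linear_sum[OF f(1)] linear_cmul[OF f(1)] linear_sum[OF lb] linear_cmul[OF lb])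
    finally show "(\<Sum>v\<in>B. b (f v) (e i) / b (e i) (e i) * representation B (e i) v) =
        b (f (e i)) (e i) / b (e i) (e i)"
      by (simp add: sum_divide_distrib mult.commute)
  qed
  finally show ?thesis .
qed

text \<open>Covers the endomorphisms of rank one that make up the change of curvature, so that its
  Ricci trace can be read off summand by summand.\<close>

lemma trace_matrix_scaleR:
  assumes "linear \<phi>"
  shows "trace (matrix (\<lambda>z. \<phi> z *\<^sub>R (v :: real ^ 'm::finite))) = \<phi> v"
proof -
  have "\<phi> v = \<phi> (\<Sum>i\<in>UNIV. (v $ i) *\<^sub>R axis i 1)"
    by (simp add: basis_expansion[where 'a = real, unfolded scalar_mult_eq_scaleR])
  then show ?thesis
    by (simp add: trace_def matrix_def linear_sum[OF assms] linear_cmul[OF assms] mult.commute)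
qed

lemma trace_matrix_add: "trace (matrix (\<lambda>z. f z + g z)) = trace (matrix f) + trace (matrix g)"
  by (simp add: trace_def matrix_def sum.distrib)

lemma trace_matrix_diff: "trace (matrix (\<lambda>z. f z - g z)) = trace (matrix f) - trace (matrix g)"
  for f g :: "real ^ 'm::finite \<Rightarrow> real ^ 'm"
  by (simp add: trace_def matrix_def sum_subtractf)

lemma trace_matrix_const: "trace (matrix (\<lambda>z. k *\<^sub>R (z :: real ^ 'm::finite))) = k * real CARD('m)"
  by (simp add: trace_def matrix_def)

section \<open>Adapted orthogonal frames\<close>

context conformal_mfd
begin

text \<open>The members are left unnormalized: dividing by \<open>gm a q (e j q) (e j q)\<close> in
  the formulas avoids square roots, so smoothness needs only quotients.\<close>

definition orthogonalized ::
    "('a, 'm) chart \<Rightarrow> 'a set \<Rightarrow> ('m \<Rightarrow> 'a \<Rightarrow> real ^ 'm) \<Rightarrow> 'm set \<Rightarrow> ('m \<Rightarrow> 'a \<Rightarrow> real ^ 'm) \<Rightarrow> bool"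
  where "orthogonalized a S E J e \<longleftrightarrow>
    (\<forall>j\<in>J. vector_field A S (e j)) \<and>
    (\<forall>q\<in>S. \<forall>i\<in>J. \<forall>j\<in>J. i \<noteq> j \<longrightarrow> gm a q (e i q) (e j q) = 0) \<and>
    (\<forall>q\<in>S. \<forall>j\<in>J. e j q \<noteq> 0) \<and>
    (\<forall>q\<in>S. span ((\<lambda>j. e j q) ` J) = span ((\<lambda>j. E j q) ` J))"

lemma orthogonalizedD:
  assumes "orthogonalized a S E J e"
  shows "\<And>j. j \<in> J \<Longrightarrow> vector_field A S (e j)"
    and "\<And>q i j. q \<in> S \<Longrightarrow> i \<in> J \<Longrightarrow> j \<in> J \<Longrightarrow> i \<noteq> j \<Longrightarrow> gm a q (e i q) (e j q) = 0"
    and "\<And>q j. q \<in> S \<Longrightarrow> j \<in> J \<Longrightarrow> e j q \<noteq> 0"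
    and "\<And>q. q \<in> S \<Longrightarrow> span ((\<lambda>j. e j q) ` J) = span ((\<lambda>j. E j q) ` J)"
  using assms by (simp_all add: orthogonalized_def)

text \<open>Subtract from \<open>E k\<close> its orthogonal projection onto the members already
  built; the difference is nonzero by independence. Earlier members stay unchanged, so a frame for a
  subset of indices survives in the full frame.\<close>

lemma gram_schmidt_step:
  assumes a: "a \<in> A" "open S" "S \<subseteq> fst a"
    and E: "\<And>i. vector_field A S (E i)"
    and ind: "\<And>q J k. q \<in> S \<Longrightarrow> k \<notin> J \<Longrightarrow> E k q \<notin> span ((\<lambda>j. E j q) ` J)"
    and J: "orthogonalized a S E J e" "k \<notin> J"
  shows "\<exists>e'. orthogonalized a S E (insert k J) e' \<and> (\<forall>j\<in>J. e' j = e j)"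
proof -
  note Jd = orthogonalizedD[OF J(1)]
  define w where "w q = (\<Sum>j\<in>J. (gm a q (E k q) (e j q) / gm a q (e j q) (e j q)) *\<^sub>R e j q)" for q
  define e' where "e' = e(k := \<lambda>q. E k q - w q)"
  have e': "e' j = e j" if "j \<in> J" for j using that J(2) by (auto simp: e'_def)
  have k: "e' k q = E k q - w q" for q by (simp add: e'_def)
  have pos: "gm a q (e j q) (e j q) > 0" if "q \<in> S" "j \<in> J" for q j
    using that gm_pos[OF a(1) _ Jd(3)] a(3) by blast
  then have nzj: "gm a q (e j q) (e j q) \<noteq> 0" if "q \<in> S" "j \<in> J" for q j
    using that less_irrefl by metis
  have vf: "vector_field A S w"
    unfolding w_def
    by (intro vector_field_sum vector_field_scaleR smooth_fun_divide gm_smooth a E)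
      (use Jd(1) nzj in auto)
  have w: "w q \<in> span ((\<lambda>j. e j q) ` J)" for q
    unfolding w_def by (intro span_sum span_scale span_base) auto
  have spJ: "span ((\<lambda>j. e j q) ` J) = span ((\<lambda>j. E j q) ` J)" if "q \<in> S" for q
    using Jd(4)[OF that] .
  have orth: "gm a q (E k q - w q) (e j q) = 0" if "q \<in> S" "j \<in> J" for q j
  proof -
    have "gm a q (w q) (e j q) = (\<Sum>i\<in>J. if i = j then gm a q (E k q) (e j q) else 0)"
      unfolding w_def linear_sum[OF gm_linear(2)] linear_cmul[OF gm_linear(2)]
      by (rule sum.cong) (use Jd(2) that nzj[OF that] in auto)
    also have "\<dots> = gm a q (E k q) (e j q)" using that by simp
    finally show ?thesis by (simp add: gm_linear_simps)
  qed
  have nz: "E k q - w q \<noteq> 0" if "q \<in> S" for q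
    using ind[OF that J(2)] w[of q] spJ[OF that] by auto
  have sp: "span ((\<lambda>j. e' j q) ` insert k J) = span ((\<lambda>j. E j q) ` insert k J)" if "q \<in> S" for q
  proof -
    have "(\<lambda>j. e' j q) ` J = (\<lambda>j. e j q) ` J" using e' by (auto simp: image_iff)
    then have "span ((\<lambda>j. e' j q) ` insert k J) = span (insert (E k q - w q) ((\<lambda>j. e j q) ` J))"
      by (simp add: k)
    also have "\<dots> = span (insert (E k q) ((\<lambda>j. e j q) ` J))"
      by (rule eq_span_insert_eq) (use w span_neg in auto)
    also have "\<dots> = span (insert (E k q) ((\<lambda>j. E j q) ` J))"
      using spJ[OF that] by (simp add: span_insert)
    finally show ?thesis by simp
  qed
  have "orthogonalized a S E (insert k J) e'"
    unfolding orthogonalized_def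
  proof (intro conjI ballI impI)
    show "vector_field A S (e' j)" if "j \<in> insert k J" for j
      using that Jd(1) vector_field_diff[OF E vf] by (auto simp: e'_def)
    show "gm a q (e' i q) (e' j q) = 0" if "q \<in> S" "i \<in> insert k J" "j \<in> insert k J" "i \<noteq> j" for q i j
      using that Jd(2)[of q i j] orth[of q i] orth[of q j] gm_sym[of a q "e i q"] e' k by auto
    show "e' j q \<noteq> 0" if "q \<in> S" "j \<in> insert k J" for q j
      using that Jd(3)[of q j] nz[of q] e' k by auto
  qed (use sp in auto)
  then show ?thesis using e' by blast
qed

lemma gram_schmidt:
  assumes a: "a \<in> A" "open S" "S \<subseteq> fst a"
    and E: "\<And>i. vector_field A S (E i)"
    and ind: "\<And>q J k. q \<in> S \<Longrightarrow> k \<notin> J \<Longrightarrow> E k q \<notin> span ((\<lambda>j. E j q) ` J)"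
    and I: "orthogonalized a S E I e"
  shows "\<exists>e'. orthogonalized a S E UNIV e' \<and> (\<forall>j\<in>I. e' j = e j)"
proof -
  have "\<exists>e'. orthogonalized a S E (I \<union> K) e' \<and> (\<forall>j\<in>I. e' j = e j)" if "K \<inter> I = {}" "finite K" for K
    using that(2,1)
  proof (induction K rule: finite_induct)
    case empty
    then show ?case using I by auto
  next
    case (insert k K)
    then obtain e1 where e1: "orthogonalized a S E (I \<union> K) e1" "\<forall>j\<in>I. e1 j = e j" by auto
    then show ?case
      using gram_schmidt_step[OF a E ind e1(1), of k] insert by auto
  qed
  moreover have "(UNIV - I) \<inter> I = {}" "finite (UNIV - I)" "I \<union> (UNIV - I) = UNIV" by auto
  ultimately show ?thesis by metis
qed

lemma coord_field_independent:
  assumes "a \<in> A" "q \<in> fst a" "k \<notin> J"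
  shows "coord_field A a (axis k 1) q \<notin> span ((\<lambda>j. coord_field A a (axis j 1) q) ` J)"
  using assms(3) by (auto simp: span_coord_field[OF assms(1,2)] jac_coord_field[OF assms(1,2)])

text \<open>The two charts have different roles: \<open>a\<close> fixes the metric, \<open>b\<close>
  supplies the coordinate fields. With a slice chart as \<open>b\<close> and its tangent indices as
  \<open>I\<close>, the members in \<open>I\<close> span the tangent spaces of the submanifold and
  the others are normal to it.\<close>

lemma adapted_frame:
  assumes "a \<in> A" "b \<in> A" "open S" "S \<subseteq> fst a" "S \<subseteq> fst b"
  obtains e where "orthogonalized a S (\<lambda>i. coord_field A b (axis i 1)) UNIV e"
    "orthogonalized a S (\<lambda>i. coord_field A b (axis i 1)) I e"
proof -
  let ?E = "\<lambda>i. coord_field A b (axis i 1)"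
  note E = coord_field_vector_field[OF assms(2,3,5)]
  have ind: "?E k q \<notin> span ((\<lambda>j. ?E j q) ` J)" if "q \<in> S" "k \<notin> J" for q J k
    using coord_field_independent[OF assms(2) _ that(2)] that(1) assms(5) by blast
  have "\<exists>e. orthogonalized a S ?E J e" for J
  proof (induction J rule: finite_induct[OF finite])
    case 1
    then show ?case by (simp add: orthogonalized_def)
  next
    case (2 k J)
    then show ?case using gram_schmidt_step[OF assms(1,3,4) E ind _ 2(2)] by blast
  qed
  then obtain e where e: "orthogonalized a S ?E I e" by blast
  obtain e' where e': "orthogonalized a S ?E UNIV e'" "\<forall>j\<in>I. e' j = e j"
    using gram_schmidt[OF assms(1,3,4) E ind e] by blast
  have "orthogonalized a S ?E I e'"
    using e e'(2) unfolding orthogonalized_def by (simp cong: image_cong)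
  then show thesis using that e' by blast
qed

end

locale ortho_frame = conformal_mfd A c
  for A :: "('a::{t2_space,second_countable_topology}, 'm::finite) chart set" and c +
  fixes a :: "('a, 'm) chart" and S :: "'a set" and e :: "'m \<Rightarrow> 'a \<Rightarrow> real ^ 'm"
  assumes chart: "a \<in> A" "open S" "S \<subseteq> fst a"
    and frame_vf: "vector_field A S (e i)"
    and frame_orth: "q \<in> S \<Longrightarrow> i \<noteq> j \<Longrightarrow> gm a q (e i q) (e j q) = 0"
    and frame_nz: "q \<in> S \<Longrightarrow> e i q \<noteq> 0"
begin

abbreviation "g \<equiv> gm a"

lemma S_chart: "q \<in> S \<Longrightarrow> q \<in> fst a"
  using chart by blast

lemma frame_pos: "q \<in> S \<Longrightarrow> g q (e i q) (e i q) > 0"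
  using gm_pos[OF chart(1) S_chart frame_nz] .

lemma frame_norm_nz: "q \<in> S \<Longrightarrow> g q (e i q) (e i q) \<noteq> 0"
  using frame_pos by (metis less_irrefl)

lemma g_eqI:
  assumes "q \<in> S" "\<And>z. g q v z = g q w z"
  shows "v = w"
proof (rule ccontr)
  assume "v \<noteq> w"
  then have "g q (v - w) (v - w) > 0" using gm_pos[OF chart(1) S_chart] assms(1) by simp
  then show False using assms(2)[of "v - w"] by (simp add: gm_linear_simps)
qed

lemma frame_expansion:
  assumes "q \<in> S"
  shows "v = (\<Sum>i\<in>UNIV. (g q v (e i q) / g q (e i q) (e i q)) *\<^sub>R e i q)"
proof (rule orthogonal_family_expansion[OF gm_bilinear])
  have nz: "g q (e i q) (e i q) \<noteq> 0" for i using frame_pos[OF assms, of i] by simp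
  have ind: "inj (\<lambda>i. e i q)" "independent (range (\<lambda>i. e i q))"
    by (rule orthogonal_family_independent[where b = "g q", OF gm_bilinear];
        use nz frame_orth[OF assms] in simp)+
  have "card (range (\<lambda>i. e i q)) = dim (UNIV :: (real ^ 'm) set)"
    using card_image[OF ind(1)] by simp
  then have "UNIV \<subseteq> span (range (\<lambda>i. e i q))"
    using ind(2) card_eq_dim[of "range (\<lambda>i. e i q)" UNIV] by simp
  then show "v \<in> span (range (\<lambda>i. e i q))" by blast
qed (use frame_pos[OF assms] frame_orth[OF assms] in \<open>auto simp: less_le\<close>)

lemma frame_comp_smooth:
  assumes "vector_field A S X"
  shows "smooth_fun A S (\<lambda>q. g q (X q) (e i q) / g q (e i q) (e i q))"
  by (intro smooth_fun_divide gm_smooth chart assms frame_vf frame_norm_nz)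

end

section \<open>The 1-form relating two Weyl structures\<close>

locale weyl_pair = ortho_frame A c a S e
  for A :: "('a::{t2_space,second_countable_topology}, 'm::finite) chart set" and c a S e +
  fixes D D' :: "('a, 'm) connection_op"
  assumes W: "Weyl_structure A c D" and W': "Weyl_structure A c D'"
begin

lemmas C = Weyl_connection[OF W] and C' = Weyl_connection[OF W']

text \<open>\<open>U\<close> is metrically dual to the difference of the connection forms on \<open>L\<close>, the 1-form
  usually called \<open>\<theta>\<close>.\<close>

definition U :: "'a \<Rightarrow> real ^ 'm"
  where "U q = (\<Sum>i\<in>UNIV. ((conn_form a D' q (e i q) - conn_form a D q (e i q))
    / g q (e i q) (e i q)) *\<^sub>R e i q)"

lemma U_vector_field: "vector_field A S U"
  unfolding U_def
  by (intro vector_field_sum vector_field_scaleR smooth_fun_divide smooth_fun_diff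
      conn_form_smooth[OF W] conn_form_smooth[OF W'] gm_smooth chart frame_vf frame_norm_nz)

lemma conn_form_change:
  assumes "q \<in> S"
  shows "conn_form a D' q v = conn_form a D q v + g q (U q) v"
proof -
  note l = conn_form_linear[OF W chart(1) S_chart[OF assms] chart(3) assms]
  note l' = conn_form_linear[OF W' chart(1) S_chart[OF assms] chart(3) assms]
  let ?\<theta> = "\<lambda>v. conn_form a D' q v - conn_form a D q v"
  have "?\<theta> v = ?\<theta> (\<Sum>i\<in>UNIV. (g q v (e i q) / g q (e i q) (e i q)) *\<^sub>R e i q)"
    using frame_expansion[OF assms, of v] by simp
  also have "\<dots> = (\<Sum>i\<in>UNIV. (g q v (e i q) / g q (e i q) (e i q)) * ?\<theta> (e i q))"
    by (simp add: linear_sum[OF l] linear_sum[OF l'] linear_cmul[OF l] linear_cmul[OF l']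
        sum_subtractf[symmetric] right_diff_distrib)
  also have "\<dots> = g q (U q) v"
    unfolding U_def linear_sum[OF gm_linear(2)] linear_cmul[OF gm_linear(2)]
    by (simp add: gm_sym[of a q v] mult.commute)
  finally show ?thesis by simp
qed

text \<open>The Koszul argument: the difference of the two connections is symmetric, and the
  difference of their metricity equations determines it.\<close>

lemma cov_change:
  assumes q: "q \<in> S" and Y: "vector_field A T Y" "q \<in> T"
  shows "cov A D' q v Y =
    cov A D q v Y + g q (U q) v *\<^sub>R Y q + g q (U q) (Y q) *\<^sub>R v - g q v (Y q) *\<^sub>R U q"
proof -
  let ?T = "S \<inter> T"
  have T: "open ?T" "q \<in> ?T" "?T \<subseteq> fst a"
    using q Y chart vector_field_open by auto
  have qa: "q \<in> fst a" using S_chart q .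
  define E where "E v = coord_field A a (jac A a q v)" for v
  have E: "vector_field A ?T (E v)" "E v q = v" for v
    unfolding E_def using coord_field_vector_field chart T coord_field_jac qa by auto
  have Y': "vector_field A ?T Y" using vector_field_subset[OF Y(1) T(1)] by simp
  define B where "B v X = cov A D' q v X - cov A D q v X" for v X
  have met: "g q (B v X) (Z q) + g q (X q) (B v Z) = 2 * g q (U q) v * g q (X q) (Z q)"
    if "vector_field A ?T X" "vector_field A ?T Z" for v X Z
    using Weyl_metric[OF W chart(1) qa T(3,2) that, of v] Weyl_metric[OF W' chart(1) qa T(3,2) that, of v]
      conn_form_change[OF q]
    by (simp add: B_def gm_linear_simps algebra_simps)
  have sym: "B (X q) Z = B (Z q) X" if "vector_field A ?T X" "vector_field A ?T Z" for X Z
    using cov_torsion[OF C Weyl_torsion_free[OF W] that T(2)]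
      cov_torsion[OF C' Weyl_torsion_free[OF W'] that T(2)]
    by (simp add: B_def algebra_simps)
  have "B v Y = g q (U q) v *\<^sub>R Y q + g q (U q) (Y q) *\<^sub>R v - g q v (Y q) *\<^sub>R U q"
  proof (rule g_eqI[OF q])
    fix z
    have s: "B v (E z) = B z (E v)" "B z Y = B (Y q) (E z)" "B (Y q) (E v) = B v Y"
      using sym[of "E v" "E z"] sym[of "E z" Y] sym[of Y "E v"] E Y' by auto
    have m: "g q (B v Y) z + g q (Y q) (B v (E z)) = 2 * g q (U q) v * g q (Y q) z"
      "g q (B z (E v)) (Y q) + g q v (B z Y) = 2 * g q (U q) z * g q v (Y q)"
      "g q (B (Y q) (E z)) v + g q z (B (Y q) (E v)) = 2 * g q (U q) (Y q) * g q z v"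
      using met[of Y "E z" v] met[of "E v" Y z] met[of "E z" "E v" "Y q"] E Y' by auto
    \<comment> \<open>First relation of \<open>m\<close> minus the second plus the third: by
      \<open>s\<close> the mixed terms cancel in pairs, and g(B v Y, z) is counted twice.\<close>
    have "2 * g q (B v Y) z = 2 * g q (U q) v * g q (Y q) z
        - 2 * g q (U q) z * g q v (Y q) + 2 * g q (U q) (Y q) * g q v z"
      using m s gm_sym[of a q "Y q" "B z (E v)"] gm_sym[of a q v "B (Y q) (E z)"]
        gm_sym[of a q z "B v Y"] gm_sym[of a q z v] by simp
    then show "g q (B v Y) z =
        g q (g q (U q) v *\<^sub>R Y q + g q (U q) (Y q) *\<^sub>R v - g q v (Y q) *\<^sub>R U q) z"
      by (simp add: gm_linear_simps algebra_simps)
  qed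
  then show ?thesis by (simp add: B_def algebra_simps)
qed

text \<open>\<open>\<nabla>\<theta>\<close> expressed by \<open>U\<close>; the last term is due to \<open>\<nabla>g = - 2 conn_form \<otimes> g\<close>.\<close>

definition nabla_theta :: "'a \<Rightarrow> real ^ 'm \<Rightarrow> real ^ 'm \<Rightarrow> real"
  where "nabla_theta q x y = g q (cov A D q x U) y - 2 * conn_form a D q x * g q (U q) y"

lemma dir_deriv_theta:
  assumes "q \<in> S" "vector_field A T Y" "q \<in> T"
  shows "dir_deriv A q x (\<lambda>z. g z (U z) (Y z)) = nabla_theta q x (Y q) + g q (U q) (cov A D q x Y)"
proof -
  have T: "open (S \<inter> T)" "q \<in> S \<inter> T" "S \<inter> T \<subseteq> fst a" "S \<inter> T \<subseteq> S" "S \<inter> T \<subseteq> T"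
    using assms chart vector_field_open by auto
  show ?thesis
    using Weyl_metric[OF W chart(1) S_chart[OF assms(1)] T(3,2)
        vector_field_subset[OF U_vector_field T(1,4)] vector_field_subset[OF assms(2) T(1,5)], of x]
    unfolding nabla_theta_def by simp
qed

lemma nabla_theta_linear:
  assumes "q \<in> S"
  shows "linear (\<lambda>x. nabla_theta q x y)"
  using cov_linear[OF C U_vector_field assms] conn_form_linear[OF W chart(1) S_chart[OF assms] chart(3) assms]
  unfolding nabla_theta_def by (auto simp: linear_iff gm_linear_simps algebra_simps)

end

section \<open>Change of the Schouten-Weyl tensor\<close>

context conformal_mfd
begin

lemma coord_field_ref_vf: "open T \<Longrightarrow> T \<subseteq> fst (ref_chart A p) \<Longrightarrow> vector_field A T (coord_field A (ref_chart A p) x)"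
  by (rule coord_field_vector_field[OF ref_chart(1)])

lemma cov_coord_field_sym:
  assumes "Weyl_structure A c D"
  shows "cov A D p x (coord_field A (ref_chart A p) y) = cov A D p y (coord_field A (ref_chart A p) x)"
proof -
  have vf: "vector_field A (fst (ref_chart A p)) (coord_field A (ref_chart A p) x)" for x
    by (rule coord_field_ref_vf) (use ref_chart_open in auto)
  show ?thesis
    using cov_torsion[OF Weyl_connection[OF assms] Weyl_torsion_free[OF assms] vf vf ref_chart(2)]
      lie_bracket_coord_field[OF ref_chart] by (simp add: coord_field_ref_chart)
qed

text \<open>Coordinate fields commute, which removes the bracket term. The inner derivatives are
  rewritten as fields in terms of \<open>cov\<close>, the form to which
  \<open>cov_cov_change\<close> applies.\<close>

lemma curvature_coord_field:
  assumes W: "Weyl_structure A c D" and S: "open S" "p \<in> S" "S \<subseteq> fst (ref_chart A p)"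
  defines "E \<equiv> coord_field A (ref_chart A p)"
  shows "curvature A D (E z) (E x) (E y) p =
    cov A D p z (\<lambda>q. cov A D q (E x q) (E y)) - cov A D p x (\<lambda>q. cov A D q (E z q) (E y))"
proof -
  note C = Weyl_connection[OF W]
  have E: "vector_field A S (E x)" "E x p = x" for x
    unfolding E_def using coord_field_ref_vf S coord_field_ref_chart by auto
  have "D (E z) (D (E x) (E y)) p = cov A D p z (\<lambda>q. cov A D q (E x q) (E y))" for z x
  proof -
    note v = conn_vector_field[OF C E(1) E(1), of x y] cov_vector_field[OF C E(1) E(1), of x y]
    have "D (E z) (D (E x) (E y)) p = cov A D p z (D (E x) (E y))"
      using conn_eq_cov[OF C E(1) v(1) S(2)] by (simp add: E)
    also have "\<dots> = cov A D p z (\<lambda>q. cov A D q (E x q) (E y))"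
      by (rule cov_cong[OF C v S(2)]) (rule conn_eq_cov[OF C E(1) E(1)])
    finally show ?thesis .
  qed
  moreover have "D (lie_bracket A (E z) (E x)) (E y) p = 0"
  proof -
    have l: "lie_bracket A (E z) (E x) q = 0" if "q \<in> S" for q
      unfolding E_def by (rule lie_bracket_coord_field[OF ref_chart(1)]) (use S that in auto)
    have "vector_field A S (lie_bracket A (E z) (E x))"
      by (rule vector_field_cong[OF vector_field_zero[OF S(1)]]) (simp add: l)
    from conn_eq_cov[OF C this E(1) S(2)] show ?thesis
      using linear_0[OF cov_linear[OF C E(1) S(2)]] l[OF S(2)] by simp
  qed
  ultimately show ?thesis unfolding curvature_def by simp
qed

text \<open>Each differentiation multiplies the section by a value of \<alpha>; the second one also
  differentiates the coefficient produced by the first.\<close>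

lemma cov_dens_trivial_twice:
  assumes W: "Weyl_structure A c D" and a: "a \<in> A" "S \<subseteq> fst a" "q \<in> S"
    and X: "vector_field A S X" and Y: "vector_field A S Y"
  shows "cov_dens A D 1 X (coord_dens A a) q = conn_form a D q (X q) * coord_dens A a q"
    and "cov_dens A D 1 X (cov_dens A D 1 Y (coord_dens A a)) q =
      (dir_deriv A q (X q) (\<lambda>z. conn_form a D z (Y z)) + conn_form a D q (X q) * conn_form a D q (Y q))
      * coord_dens A a q"
proof -
  note o = vector_field_open[OF X]
  have 1: "cov_dens A D 1 X (coord_dens A a) z = conn_form a D z (X z) * coord_dens A a z"
    if "z \<in> S" "vector_field A S X" for z X
    using cov_dens_trivial[OF W a(1) _ a(2) that smooth_fun_const[OF o, of 1]] a(2) that(1)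
    by (auto simp: dir_deriv_const)
  show "cov_dens A D 1 X (coord_dens A a) q = conn_form a D q (X q) * coord_dens A a q"
    using 1 X a(3) by blast
  have "cov_dens A D 1 X (cov_dens A D 1 Y (coord_dens A a)) q =
      cov_dens A D 1 X (\<lambda>z. conn_form a D z (Y z) * coord_dens A a z) q"
  proof -
    \<comment> \<open>The first derivative is known in closed form on S only, so it is substituted
      under the second one by locality.\<close>
    have "dir_deriv A q (X q) (dens_comp A 1 (ref_chart A q) (cov_dens A D 1 Y (coord_dens A a))) =
        dir_deriv A q (X q) (dens_comp A 1 (ref_chart A q) (\<lambda>z. conn_form a D z (Y z) * coord_dens A a z))"
      by (rule dir_deriv_cong[OF o a(3)]) (simp add: dens_comp_def 1 Y)
    then show ?thesis
      unfolding cov_dens_def[of A D 1 X] using 1[OF a(3) Y] by simp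
  qed
  also have "\<dots> = (dir_deriv A q (X q) (\<lambda>z. conn_form a D z (Y z))
      + conn_form a D q (X q) * conn_form a D q (Y q)) * coord_dens A a q"
    by (rule cov_dens_trivial[OF W a(1) _ a(2,3) X conn_form_smooth[OF W a(1,2) Y]]) (use a in blast)
  finally show "cov_dens A D 1 X (cov_dens A D 1 Y (coord_dens A a)) q =
      (dir_deriv A q (X q) (\<lambda>z. conn_form a D z (Y z)) + conn_form a D q (X q) * conn_form a D q (Y q))
      * coord_dens A a q" .
qed

text \<open>F = d\<alpha> on commuting fields: the products \<alpha>(X) \<alpha>(Y) cancel by
  symmetry, the bracket term vanishes, and the section has value 1 at p.\<close>

lemma Faraday_eq:
  assumes W: "Weyl_structure A c D" and S: "open S" "p \<in> S" "S \<subseteq> fst (ref_chart A p)"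
  defines "E \<equiv> coord_field A (ref_chart A p)" and "a \<equiv> ref_chart A p"
  shows "Faraday A D p x y =
    dir_deriv A p x (\<lambda>q. conn_form a D q (E y q)) - dir_deriv A p y (\<lambda>q. conn_form a D q (E x q))"
proof -
  have E: "vector_field A S (E x)" "E x p = x" for x
    unfolding E_def using coord_field_ref_vf S coord_field_ref_chart by auto
  have l: "lie_bracket A (E x) (E y) q = 0" if "q \<in> S" for q
    unfolding E_def by (rule lie_bracket_coord_field[OF ref_chart(1)]) (use S that in auto)
  have "vector_field A S (lie_bracket A (E x) (E y))"
    by (rule vector_field_cong[OF vector_field_zero[OF S(1)]]) (simp add: l)
  from cov_dens_trivial_twice(1)[OF W ref_chart(1) S(3,2) this this]
  have "cov_dens A D 1 (lie_bracket A (E x) (E y)) (coord_dens A a) p = 0"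
    using linear_0[OF conn_form_linear[OF W ref_chart S(3,2)]] l[OF S(2)] by (simp add: a_def)
  moreover have "coord_dens A a p = 1" unfolding a_def by (rule coord_dens_ref_chart)
  ultimately show ?thesis
    unfolding Faraday_def Let_def E_def[symmetric]
    using cov_dens_trivial_twice(2)[OF W ref_chart(1) S(3,2) E(1) E(1)]
    by (simp add: E(2) a_def)
qed

lemma Hess_eq:
  assumes W: "Weyl_structure A c D" and S: "open S" "p \<in> S" "S \<subseteq> fst (ref_chart A p)"
  defines "E \<equiv> coord_field A (ref_chart A p)" and "a \<equiv> ref_chart A p"
  shows "Hess A D (coord_dens A a) p x y =
    dir_deriv A p x (\<lambda>q. conn_form a D q (E y q)) + conn_form a D p x * conn_form a D p y
    - conn_form a D p (cov A D p x (E y))"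
proof -
  have E: "vector_field A S (E x)" "E x p = x" for x
    unfolding E_def using coord_field_ref_vf S coord_field_ref_chart by auto
  note v = conn_vector_field[OF Weyl_connection[OF W] E(1) E(1)]
  have "coord_dens A a p = 1" unfolding a_def by (rule coord_dens_ref_chart)
  then show ?thesis
    unfolding Hess_def Let_def E_def[symmetric]
    using cov_dens_trivial_twice(2)[OF W ref_chart(1) S(3,2) E(1) E(1), of x y]
      cov_dens_trivial_twice(1)[OF W ref_chart(1) S(3,2) v v, of x y]
      conn_eq_cov[OF Weyl_connection[OF W] E(1) E(1) S(2), of x y]
    by (simp add: E(2) a_def)
qed

end

section \<open>Change of curvature, Faraday form and Hessian\<close>

context weyl_pair
begin

lemma conn_form_change_deriv:
  assumes "p \<in> S" "vector_field A S Y"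
  shows "dir_deriv A p x (\<lambda>q. conn_form a D' q (Y q)) =
    dir_deriv A p x (\<lambda>q. conn_form a D q (Y q)) + nabla_theta p x (Y p) + g p (U p) (cov A D p x Y)"
proof -
  have "dir_deriv A p x (\<lambda>q. conn_form a D' q (Y q)) =
      dir_deriv A p x (\<lambda>q. conn_form a D q (Y q) + g q (U q) (Y q))"
    by (rule dir_deriv_cong[OF chart(2) assms(1)]) (rule conn_form_change)
  also have "\<dots> = dir_deriv A p x (\<lambda>q. conn_form a D q (Y q)) + dir_deriv A p x (\<lambda>q. g q (U q) (Y q))"
    by (rule dir_deriv_add[OF conn_form_smooth[OF W chart(1,3) assms(2)]
          gm_smooth[OF chart(1,3) U_vector_field assms(2)] assms(1)])
  finally show ?thesis using dir_deriv_theta[OF assms(1,2,1)] by simp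
qed

text \<open>The change formula for \<open>cov\<close> is used twice. Inside, it holds on all of S
  and may be differentiated: its coefficients produce \<open>nabla_theta\<close> and, by metricity,
  the term with \<open>conn_form\<close>. Outside, it acts on the inner field, whose value at p is
  V.\<close>

lemma cov_cov_change:
  assumes p: "p \<in> S" and Y: "vector_field A S Y" and Z: "vector_field A S Z"
  defines "V \<equiv> cov A D p (Y p) Z + g p (U p) (Y p) *\<^sub>R Z p + g p (U p) (Z p) *\<^sub>R Y p
      - g p (Y p) (Z p) *\<^sub>R U p"
  shows "cov A D' p x (\<lambda>q. cov A D' q (Y q) Z) =
    cov A D p x (\<lambda>q. cov A D q (Y q) Z)
    + (nabla_theta p x (Y p) + g p (U p) (cov A D p x Y)) *\<^sub>R Z p + g p (U p) (Y p) *\<^sub>R cov A D p x Z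
    + (nabla_theta p x (Z p) + g p (U p) (cov A D p x Z)) *\<^sub>R Y p + g p (U p) (Z p) *\<^sub>R cov A D p x Y
    - (g p (cov A D p x Y) (Z p) + g p (Y p) (cov A D p x Z)
        - 2 * conn_form a D p x * g p (Y p) (Z p)) *\<^sub>R U p
    - g p (Y p) (Z p) *\<^sub>R cov A D p x U
    + g p (U p) x *\<^sub>R V + g p (U p) V *\<^sub>R x - g p x V *\<^sub>R U p"
proof -
  note pa = S_chart[OF p]
  note vfs = Y Z U_vector_field cov_vector_field[OF C Y Z]
    vector_field_scaleR[OF gm_smooth[OF chart(1,3) U_vector_field Y] Z]
    vector_field_scaleR[OF gm_smooth[OF chart(1,3) U_vector_field Z] Y]
    vector_field_scaleR[OF gm_smooth[OF chart(1,3) Y Z] U_vector_field]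
  let ?W = "\<lambda>q. cov A D q (Y q) Z + g q (U q) (Y q) *\<^sub>R Z q + g q (U q) (Z q) *\<^sub>R Y q
      - g q (Y q) (Z q) *\<^sub>R U q"
  have vW: "vector_field A S ?W"
    by (intro vector_field_diff vector_field_add vfs)
  have "cov A D' p x (\<lambda>q. cov A D' q (Y q) Z) = cov A D' p x ?W"
    by (rule cov_cong[OF C' cov_vector_field[OF C' Y Z] vW p]) (use cov_change[OF _ Z] in auto)
  also have "\<dots> = cov A D p x ?W + g p (U p) x *\<^sub>R V + g p (U p) V *\<^sub>R x - g p x V *\<^sub>R U p"
    unfolding V_def by (rule cov_change[OF p vW p])
  also have "cov A D p x ?W = cov A D p x (\<lambda>q. cov A D q (Y q) Z)
      + cov A D p x (\<lambda>q. g q (U q) (Y q) *\<^sub>R Z q) + cov A D p x (\<lambda>q. g q (U q) (Z q) *\<^sub>R Y q)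
      - cov A D p x (\<lambda>q. g q (Y q) (Z q) *\<^sub>R U q)"
    by (simp add: cov_diff[OF C _ _ p] cov_add[OF C _ _ p] vfs vector_field_add)
  also have "\<dots> = cov A D p x (\<lambda>q. cov A D q (Y q) Z)
    + ((nabla_theta p x (Y p) + g p (U p) (cov A D p x Y)) *\<^sub>R Z p + g p (U p) (Y p) *\<^sub>R cov A D p x Z)
    + ((nabla_theta p x (Z p) + g p (U p) (cov A D p x Z)) *\<^sub>R Y p + g p (U p) (Z p) *\<^sub>R cov A D p x Y)
    - ((g p (cov A D p x Y) (Z p) + g p (Y p) (cov A D p x Z)
        - 2 * conn_form a D p x * g p (Y p) (Z p)) *\<^sub>R U p
    + g p (Y p) (Z p) *\<^sub>R cov A D p x U)"
    using cov_scaleR[OF C gm_smooth[OF chart(1,3) U_vector_field Y] Z p, of x]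
      cov_scaleR[OF C gm_smooth[OF chart(1,3) U_vector_field Z] Y p, of x]
      cov_scaleR[OF C gm_smooth[OF chart(1,3) Y Z] U_vector_field p, of x]
      dir_deriv_theta[OF p Y p, of x] dir_deriv_theta[OF p Z p, of x]
      Weyl_metric[OF W chart(1) pa chart(3) p Y Z, of x] by simp
  finally show ?thesis by (simp add: algebra_simps)
qed

text \<open>Only the Ricci curvature of a tangent and a normal vector matters, whence \<open>g p x y = 0\<close>.\<close>

lemma curvature_change:
  assumes p: "p \<in> S" "a = ref_chart A p" and xy: "g p x y = 0"
  defines "E \<equiv> coord_field A (ref_chart A p)"
  shows "curvature A D' (E z) (E x) (E y) p - curvature A D (E z) (E x) (E y) p =
    (nabla_theta p z x - nabla_theta p x z) *\<^sub>R y
    + (nabla_theta p z y - g p (U p) z * g p (U p) y + g p (U p) (U p) * g p z y) *\<^sub>R x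
    - (nabla_theta p x y - g p (U p) x * g p (U p) y) *\<^sub>R z
    + (- (2 * conn_form a D p x + g p (U p) x) * g p z y) *\<^sub>R U p
    + g p z y *\<^sub>R cov A D p x U"
proof -
  have S: "S \<subseteq> fst (ref_chart A p)" using chart p by auto
  have E: "vector_field A S (E x)" "E x p = x" for x
    unfolding E_def using coord_field_ref_vf chart S coord_field_ref_chart by auto
  have sym: "cov A D p x (E z) = cov A D p z (E x)"
    unfolding E_def by (rule cov_coord_field_sym[OF W])
  \<comment> \<open>First derivatives of the coordinate fields. They are kept as atoms, since all
    terms containing them cancel in the antisymmetrization in z and x.\<close>
  define P where "P = cov A D p z (E x)"
  define Q where "Q = cov A D p x (E y)"
  define R where "R = cov A D p z (E y)"
  define t where "t v = g p (U p) v" for v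
  define G where "G = g p z y"
  have zy: "g p x z = g p z x" "g p y z = G" "g p z y = G" "g p y x = 0" "g p x y = 0"
    unfolding G_def using gm_sym[of a p] xy by auto
  have l: "t (v + w) = t v + t w" "t (v - w) = t v - t w" "t (r *\<^sub>R v) = r * t v" for v w r
    unfolding t_def by (simp_all add: gm_linear_simps)
  have two: "v * 2 = 2 *\<^sub>R v" for v :: "real ^ 'm"
    by (simp add: vec_eq_iff)
  have U: "g p v (U p) = t v" for v unfolding t_def by (rule gm_sym)
  show ?thesis
    using curvature_coord_field[OF W chart(2) p(1) S, of z x y, folded E_def]
      curvature_coord_field[OF W' chart(2) p(1) S, of z x y, folded E_def]
      cov_cov_change[OF p(1) E(1) E(1), of z x y] cov_cov_change[OF p(1) E(1) E(1), of x z y]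
    unfolding E(2) sym P_def[symmetric] Q_def[symmetric] R_def[symmetric] t_def[symmetric]
    by (simp add: l gm_linear_simps zy U) (simp add: algebra_simps two)
qed

text \<open>Each summand of \<open>curvature_change\<close> is an endomorphism of rank one in z or a
  multiple of the identity; the latter contributes the factor m. The \<open>conn_form\<close> part
  of the fourth summand turns the trace g(\<nabla>_x U, y) of the last one into
  \<open>nabla_theta p x y\<close>.\<close>

lemma Ric_change:
  assumes p: "p \<in> S" "a = ref_chart A p" and xy: "g p x y = 0"
  shows "Ric A D' p x y - Ric A D p x y =
    nabla_theta p x y + nabla_theta p y x - 2 * (g p (U p) x * g p (U p) y)
    - real CARD('m) * (nabla_theta p x y - g p (U p) x * g p (U p) y)"
proof -
  note nabla_theta = nabla_theta_linear[OF p(1)]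
  note lin = linear_iff gm_linear_simps linear_add[OF nabla_theta] linear_cmul[OF nabla_theta] algebra_simps
  have "Ric A D' p x y - Ric A D p x y = trace (matrix (\<lambda>z.
    (nabla_theta p z x - nabla_theta p x z) *\<^sub>R y
    + (nabla_theta p z y - g p (U p) z * g p (U p) y + g p (U p) (U p) * g p z y) *\<^sub>R x
    - (nabla_theta p x y - g p (U p) x * g p (U p) y) *\<^sub>R z
    + (- (2 * conn_form a D p x + g p (U p) x) * g p z y) *\<^sub>R U p
    + g p z y *\<^sub>R cov A D p x U))"
    unfolding Ric_def Let_def trace_matrix_diff[symmetric] curvature_change[OF p xy] ..
  also have "\<dots> = (nabla_theta p y x - nabla_theta p x y)
      + (nabla_theta p x y - g p (U p) x * g p (U p) y + g p (U p) (U p) * g p x y)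
      - (nabla_theta p x y - g p (U p) x * g p (U p) y) * real CARD('m)
      + (- (2 * conn_form a D p x + g p (U p) x) * g p (U p) y) + g p (cov A D p x U) y"
  proof -
    have "linear (\<lambda>z. nabla_theta p z x - nabla_theta p x z)"
      "linear (\<lambda>z. nabla_theta p z y - g p (U p) z * g p (U p) y + g p (U p) (U p) * g p z y)"
      "linear (\<lambda>z. - (2 * conn_form a D p x + g p (U p) x) * g p z y)"
      "linear (\<lambda>z. g p z y)"
      unfolding nabla_theta_def[of p x] by (auto simp: lin)
    then show ?thesis
      by (simp only: trace_matrix_add trace_matrix_diff trace_matrix_const trace_matrix_scaleR)
  qed
  also have "\<dots> = nabla_theta p x y + nabla_theta p y x - 2 * (g p (U p) x * g p (U p) y)
    - real CARD('m) * (nabla_theta p x y - g p (U p) x * g p (U p) y)"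
    unfolding xy by (simp add: nabla_theta_def[of p x y] algebra_simps)
  finally show ?thesis .
qed

text \<open>The Faraday form is d\<alpha>, so it changes by d\<theta>; for a torsion-free connection
  this is the antisymmetrization of \<nabla>\<theta>.\<close>

lemma Faraday_change:
  assumes p: "p \<in> S" "a = ref_chart A p"
  shows "Faraday A D' p x y - Faraday A D p x y = nabla_theta p x y - nabla_theta p y x"
proof -
  have S: "S \<subseteq> fst (ref_chart A p)" using chart p by auto
  let ?E = "coord_field A (ref_chart A p)"
  have E: "vector_field A S (?E x)" "?E x p = x" for x
    using coord_field_ref_vf chart S coord_field_ref_chart by auto
  show ?thesis
    using Faraday_eq[OF W chart(2) p(1) S, of x y] Faraday_eq[OF W' chart(2) p(1) S, of x y]
      conn_form_change_deriv[OF p(1) E(1), of x y] conn_form_change_deriv[OF p(1) E(1), of y x]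
      cov_coord_field_sym[OF W, of p x y]
    by (simp add: coord_field_ref_chart[of p, folded p(2)] p(2)[symmetric])
qed

text \<open>The mixed products of \<alpha> and \<theta> in \<alpha>'(x) \<alpha>'(y) cancel against
  \<alpha> of the change of \<nabla>_x y. Applying \<theta> to that change gives 2 \<theta>(x)
  \<theta>(y), which outweighs the product \<theta>(x) \<theta>(y) and leaves the minus
  sign.\<close>

lemma Hess_change:
  assumes p: "p \<in> S" "a = ref_chart A p" and xy: "g p x y = 0"
  shows "Hess A D' (coord_dens A a) p x y - Hess A D (coord_dens A a) p x y =
    nabla_theta p x y - g p (U p) x * g p (U p) y"
proof -
  have S: "S \<subseteq> fst (ref_chart A p)" using chart p by auto
  let ?E = "coord_field A (ref_chart A p)"
  have E: "vector_field A S (?E x)" "?E x p = x" for x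
    using coord_field_ref_vf chart S coord_field_ref_chart by auto
  note l = conn_form_linear[OF W chart(1) S_chart[OF p(1)] chart(3) p(1)]
  show ?thesis
    using Hess_eq[OF W chart(2) p(1) S, of x y] Hess_eq[OF W' chart(2) p(1) S, of x y]
      conn_form_change_deriv[OF p(1) E(1), of x y] cov_change[OF p(1) E(1) p(1), of x y]
    by (simp add: coord_field_ref_chart[of p, folded p(2)] p(2)[symmetric] xy conn_form_change[OF p(1)] gm_linear_simps linear_add[OF l]
        linear_cmul[OF l] algebra_simps)
qed

text \<open>On a pair with c(x,y) = 0 the operator \<open>sym_tracefree\<close> only symmetrizes.
  The symmetrized Ricci form changes by -(m - 2) times the symmetric part of \<nabla>\<theta> -
  \<theta> \<theta>, which the coefficient 1/(m - 2) normalizes; in dimension 2 minus the Hessian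
  changes in the same way. Minus half of d\<theta>, from the Faraday form, supplies the
  antisymmetric part of -\<nabla>\<theta>.\<close>

lemma Schouten_Weyl_change:
  assumes p: "p \<in> S" "a = ref_chart A p" and xy: "c p x y = 0" and m: "CARD('m) \<ge> 2"
  shows "Schouten_Weyl A c Mo D' p x y - Schouten_Weyl A c Mo D p x y =
    g p (U p) x * g p (U p) y - nabla_theta p x y"
proof -
  have xy': "g p x y = 0" "g p y x = 0" "c p y x = 0"
    using xy gm_ref_chart[of p] gm_sym[of a p y x] p(2) by auto
  note F = Faraday_change[OF p, of x y]
  show ?thesis
  proof (cases "CARD('m) = 2")
    case True
    have 1: "coord_dens A (ref_chart A p) p = 1" by (rule coord_dens_ref_chart)
    show ?thesis
      using Hess_change[OF p xy'(1)] Hess_change[OF p xy'(2)] F True xy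
      unfolding Schouten_Weyl_def h0_Moebius_def Let_def Hess0_def sym_tracefree_def p(2)[symmetric]
      using 1 by (simp add: p(2)[symmetric] field_simps)
  next
    case False
    define k where "k = real CARD('m) - 2"
    have k: "k \<noteq> 0" using False m unfolding k_def by auto
    define t where "t = g p (U p) x * g p (U p) y"
    have R: "Ric A D' p x y - Ric A D p x y + (Ric A D' p y x - Ric A D p y x) =
        - k * (nabla_theta p x y + nabla_theta p y x - 2 * t)"
      unfolding Ric_change[OF p xy'(1)] Ric_change[OF p xy'(2)] k_def t_def
      by (simp add: algebra_simps)
    have "Schouten_Weyl A c Mo D' p x y - Schouten_Weyl A c Mo D p x y =
        (Ric A D' p x y - Ric A D p x y + (Ric A D' p y x - Ric A D p y x)) / (2 * k)
        - (Faraday A D' p x y - Faraday A D p x y) / 2"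
      using False xy unfolding Schouten_Weyl_def sym_tracefree_def k_def[symmetric]
      by (simp add: diff_divide_distrib add_divide_distrib)
    also have "\<dots> = t - nabla_theta p x y"
      unfolding R F using k by (simp add: field_simps)
    finally show ?thesis unfolding t_def .
  qed
qed

end

section \<open>Submanifolds\<close>

context smooth_mfd
begin

text \<open>A tangent vector of \<open>N\<close> is the velocity of a straight line inside a slice.\<close>

lemma dir_deriv_along_submanifold:
  assumes f: "smooth_fun A T f" "q \<in> T" "\<And>z. z \<in> T \<Longrightarrow> z \<in> N \<Longrightarrow> f z = 0" and q: "q \<in> N"
    and v: "v \<in> tangent_bundle A n N q"
  shows "dir_deriv A q v f = 0"
proof -
  obtain b I where b: "slice_chart A n N b I" "q \<in> fst b" "\<And>i. i \<notin> I \<Longrightarrow> jac A b q v $ i = 0"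
    using v unfolding tangent_bundle_def by blast
  have bA: "b \<in> A" and slice: "fst b \<inter> N = {q \<in> fst b. \<forall>i. i \<notin> I \<longrightarrow> snd b q $ i = 0}"
    using b(1) unfolding slice_chart_def by auto
  define w where "w = jac A b q v"
  let ?O = "snd b ` (fst b \<inter> T)"
  define L where "L = frechet_derivative (f \<circ> inv_chart b) (at (snd b q))"
  have L: "((f \<circ> inv_chart b) has_derivative L) (at (snd b q))"
    unfolding L_def by (rule smooth_fun_has_derivative[OF f(1) bA b(2) f(2)])
  define \<gamma> where "\<gamma> t = snd b q + t *\<^sub>R w" for t :: real
  have \<gamma>: "(\<gamma> has_derivative (\<lambda>t. t *\<^sub>R w)) (at 0)"
    unfolding \<gamma>_def by (auto intro!: derivative_eq_intros)
  have "(((f \<circ> inv_chart b) \<circ> \<gamma>) has_derivative (L \<circ> (\<lambda>t. t *\<^sub>R w))) (at 0)"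
    by (rule diff_chain_at[OF \<gamma>]) (use L in \<open>simp add: \<gamma>_def\<close>)
  moreover have "((\<lambda>t. 0) has_derivative (\<lambda>t. 0)) (at (0::real))" by simp
  then have "(((f \<circ> inv_chart b) \<circ> \<gamma>) has_derivative (\<lambda>t. 0)) (at 0)"
  proof (rule has_derivative_transform_within_open[where s = "\<gamma> -` ?O"])
    show "open (\<gamma> -` ?O)"
      by (rule open_vimage[OF chart_image_open[OF bA smooth_fun_open[OF f(1)]]])
        (auto simp: \<gamma>_def intro!: continuous_intros)
    show "0 \<in> \<gamma> -` ?O" using b(2) f(2) by (simp add: \<gamma>_def)
    fix t assume "t \<in> \<gamma> -` ?O"
    then obtain z where z: "z \<in> fst b" "z \<in> T" "\<gamma> t = snd b z" by auto
    have "snd b z $ i = 0" if "i \<notin> I" for i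
      using that b(3) slice q b(2) unfolding z(3)[symmetric] \<gamma>_def w_def by auto
    then have "z \<in> N" using slice z(1) by blast
    then show "0 = ((f \<circ> inv_chart b) \<circ> \<gamma>) t" using f(3)[OF z(2)] z bA by simp
  qed
  ultimately have "L \<circ> (\<lambda>t. t *\<^sub>R w) = (\<lambda>t. 0)" by (rule has_derivative_unique)
  then have "L (1 *\<^sub>R w) = 0" by (metis o_apply)
  then show ?thesis
    using dir_deriv_eqI[OF bA b(2) L] w_def by simp
qed

text \<open>\<open>tangent_bundle\<close> is a union over all slice charts. A vector tangent in some
  slice chart annihilates every smooth function vanishing on \<open>N\<close>, in particular the
  transverse coordinates of \<open>b\<close>, so a single chart determines it.\<close>

lemma tangent_bundle_slice:
  assumes b: "slice_chart A n N b I" "q \<in> fst b" "q \<in> N"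
  shows "tangent_bundle A n N q = {v. \<forall>i. i \<notin> I \<longrightarrow> jac A b q v $ i = 0}"
proof
  show "{v. \<forall>i. i \<notin> I \<longrightarrow> jac A b q v $ i = 0} \<subseteq> tangent_bundle A n N q"
    unfolding tangent_bundle_def using b by blast
  have bA: "b \<in> A" and slice: "fst b \<inter> N = {q \<in> fst b. \<forall>i. i \<notin> I \<longrightarrow> snd b q $ i = 0}"
    using b(1) unfolding slice_chart_def by auto
  show "tangent_bundle A n N q \<subseteq> {v. \<forall>i. i \<notin> I \<longrightarrow> jac A b q v $ i = 0}"
  proof (intro subsetI CollectI allI impI)
    fix v i assume v: "v \<in> tangent_bundle A n N q" and i: "i \<notin> I"
    let ?x = "\<lambda>z. snd b z $ i"
    have o: "open (snd b ` (fst b \<inter> fst b))" using chart_homeo(2)[OF bA] by simp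
    have "smooth_on (snd b ` (fst b \<inter> fst b)) (\<lambda>z. (snd b \<circ> inv_chart b) z $ i)"
      by (rule smooth_on_bounded_linear[OF o bounded_linear_vec_nth trans_smooth[OF bA bA]])
    then have "smooth_fun A (fst b) ?x"
      by (intro smooth_fun_chartI[OF bA chart_homeo(1)[OF bA]]) (auto simp: o_def)
    then have "dir_deriv A q v ?x = 0"
      by (rule dir_deriv_along_submanifold[OF _ b(2) _ b(3) v]) (use slice i in blast)
    moreover have "dir_deriv A q v ?x = jac A b q v $ i"
    proof (rule dir_deriv_eqI[OF bA b(2)])
      have "trans_deriv b b q = (\<lambda>v. v)" using trans_deriv_refl[OF bA b(2)] by auto
      then show "(?x \<circ> inv_chart b has_derivative (\<lambda>v. v $ i)) (at (snd b q))"
        using bounded_linear.has_derivative[OF bounded_linear_vec_nth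
            trans_has_derivative[OF bA bA b(2,2)], of i] by (simp add: o_def)
    qed
    ultimately show "jac A b q v $ i = 0" by simp
  qed
qed

end

section \<open>Tangential and normal parts in an adapted frame\<close>

locale sub_frame = ortho_frame A c a S e
  for A :: "('a::{t2_space,second_countable_topology}, 'm::finite) chart set" and c a S e +
  fixes n :: nat and N :: "'a set" and I :: "'m set"
  assumes sub: "submanifold A n N"
    and tang: "q \<in> S \<Longrightarrow> q \<in> N \<Longrightarrow> tangent_bundle A n N q = span ((\<lambda>i. e i q) ` I)"
    and card_I: "card I = n" and n_pos: "1 \<le> n"
begin

abbreviation "TN \<equiv> tangent_bundle A n N"
abbreviation "NN \<equiv> normal_bundle A c n N"

text \<open>Orthogonal projection onto the span of the tangent members, defined on all of S. It
  extends \<open>tan_part\<close> from points of \<open>N\<close> in such a way that smooth fields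
  are mapped to smooth fields.\<close>

definition P :: "'a \<Rightarrow> real ^ 'm \<Rightarrow> real ^ 'm"
  where "P q v = (\<Sum>i\<in>I. (g q v (e i q) / g q (e i q) (e i q)) *\<^sub>R e i q)"

definition nor :: "'a \<Rightarrow> real ^ 'm \<Rightarrow> real ^ 'm"
  where "nor q v = v - P q v"

lemma P_linear: "linear (P q)"
  unfolding P_def
  by (rule linearI) (simp_all add: gm_linear_simps add_divide_distrib scaleR_add_left sum.distrib
      scaleR_sum_right)

lemma nor_linear: "linear (nor q)"
  unfolding nor_def using P_linear[of q] by (simp add: linear_iff algebra_simps)

lemma P_vector_field: "vector_field A S X \<Longrightarrow> vector_field A S (\<lambda>q. P q (X q))"
  unfolding P_def
  by (intro vector_field_sum vector_field_scaleR frame_comp_smooth frame_vf chart)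

lemma nor_vector_field: "vector_field A S X \<Longrightarrow> vector_field A S (\<lambda>q. nor q (X q))"
  unfolding nor_def by (intro vector_field_diff P_vector_field)

lemma P_frame: "q \<in> S \<Longrightarrow> j \<in> I \<Longrightarrow> P q (e j q) = e j q"
proof -
  assume q: "q \<in> S" and j: "j \<in> I"
  have "P q (e j q) = (\<Sum>i\<in>I. if i = j then e j q else 0)"
    unfolding P_def by (rule sum.cong) (use frame_orth[OF q] frame_norm_nz[OF q] in auto)
  then show ?thesis using j by simp
qed

lemma g_P_frame: "q \<in> S \<Longrightarrow> j \<in> I \<Longrightarrow> g q (P q v) (e j q) = g q v (e j q)"
proof -
  assume q: "q \<in> S" and j: "j \<in> I"
  have "g q (P q v) (e j q) = (\<Sum>i\<in>I. if i = j then g q v (e j q) else 0)"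
    unfolding P_def linear_sum[OF gm_linear(2)] linear_cmul[OF gm_linear(2)]
    by (rule sum.cong) (use frame_orth[OF q] frame_norm_nz[OF q] in auto)
  then show ?thesis using j by simp
qed

lemma P_in_span: "P q v \<in> span ((\<lambda>i. e i q) ` I)"
  unfolding P_def by (intro span_sum span_scale span_base) auto

lemma P_tangent: "q \<in> S \<Longrightarrow> q \<in> N \<Longrightarrow> P q v \<in> TN q"
  using tang P_in_span by simp

lemma P_id: "q \<in> S \<Longrightarrow> q \<in> N \<Longrightarrow> x \<in> TN q \<Longrightarrow> P q x = x"
proof -
  assume q: "q \<in> S" "q \<in> N" and "x \<in> TN q"
  then have "x \<in> span ((\<lambda>i. e i q) ` I)" using tang by simp
  then show ?thesis
    by (induction rule: span_induct_alt)
      (auto simp: linear_0[OF P_linear] linear_add[OF P_linear] linear_cmul[OF P_linear] P_frame q)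
qed

lemma c_zero_iff: "q \<in> S \<Longrightarrow> c q x y = 0 \<longleftrightarrow> g q x y = 0"
  using c_eq_gm[OF chart(1) S_chart] coord_dens_pos[OF chart(1) S_chart, of q] by auto

lemma normal_iff:
  assumes "q \<in> S" "q \<in> N"
  shows "\<xi> \<in> NN q \<longleftrightarrow> (\<forall>i\<in>I. g q \<xi> (e i q) = 0)"
proof
  assume "\<xi> \<in> NN q"
  then show "\<forall>i\<in>I. g q \<xi> (e i q) = 0"
    using tang[OF assms] span_base[of _ "(\<lambda>i. e i q) ` I"] c_zero_iff[OF assms(1)]
    unfolding normal_bundle_def by auto
next
  assume 0: "\<forall>i\<in>I. g q \<xi> (e i q) = 0"
  have "g q \<xi> x = 0" if "x \<in> span ((\<lambda>i. e i q) ` I)" for x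
    using that by (induction rule: span_induct_alt) (auto simp: gm_linear_simps 0)
  then show "\<xi> \<in> NN q"
    using tang[OF assms] c_zero_iff[OF assms(1)] unfolding normal_bundle_def by auto
qed

lemma normal_tangent: "q \<in> S \<Longrightarrow> \<xi> \<in> NN q \<Longrightarrow> x \<in> TN q \<Longrightarrow> g q \<xi> x = 0"
  unfolding normal_bundle_def using c_zero_iff by blast

lemma tangent_normal: "q \<in> S \<Longrightarrow> \<xi> \<in> NN q \<Longrightarrow> x \<in> TN q \<Longrightarrow> g q x \<xi> = 0"
  using normal_tangent gm_sym by metis

lemma nor_normal: "q \<in> S \<Longrightarrow> q \<in> N \<Longrightarrow> nor q v \<in> NN q"
  by (simp add: normal_iff nor_def gm_linear_simps g_P_frame)

lemma P_normal: "q \<in> S \<Longrightarrow> q \<in> N \<Longrightarrow> \<xi> \<in> NN q \<Longrightarrow> P q \<xi> = 0"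
  by (simp add: normal_iff P_def)

lemma nor_tangent: "q \<in> S \<Longrightarrow> q \<in> N \<Longrightarrow> x \<in> TN q \<Longrightarrow> nor q x = 0"
  by (simp add: nor_def P_id)

lemma nor_id: "q \<in> S \<Longrightarrow> q \<in> N \<Longrightarrow> \<xi> \<in> NN q \<Longrightarrow> nor q \<xi> = \<xi>"
  by (simp add: nor_def P_normal)

lemma g_P_tangent: "q \<in> S \<Longrightarrow> q \<in> N \<Longrightarrow> x \<in> TN q \<Longrightarrow> g q (P q v) x = g q v x"
  using normal_tangent[OF _ nor_normal, of q x v] by (simp add: nor_def gm_linear_simps)

lemma g_nor_normal: "q \<in> S \<Longrightarrow> q \<in> N \<Longrightarrow> \<xi> \<in> NN q \<Longrightarrow> g q (nor q v) \<xi> = g q v \<xi>"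
  using tangent_normal[OF _ _ P_tangent, of q \<xi> v] by (simp add: nor_def gm_linear_simps)

lemma tan_part_eq:
  assumes "q \<in> S" "q \<in> N"
  shows "tan_part A c n N q v = P q v"
  unfolding tan_part_def
proof (rule the_equality)
  show "P q v \<in> TN q \<and> v - P q v \<in> NN q"
    using P_tangent nor_normal[of q v] assms unfolding nor_def by auto
  fix w assume w: "w \<in> TN q \<and> v - w \<in> NN q"
  then have "0 = P q (v - w)" using P_normal assms by simp
  then show "w = P q v" using w P_id[OF assms] by (simp add: linear_diff[OF P_linear])
qed

lemma nor_part_eq: "q \<in> S \<Longrightarrow> q \<in> N \<Longrightarrow> nor_part A c n N q v = nor q v"
  unfolding nor_part_def nor_def by (simp add: tan_part_eq)

lemma obtain_tangent_ext:
  assumes "q \<in> S" "q \<in> N" "x \<in> TN q"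
  obtains X where "vector_field A S X" "X q = x" "\<And>z. z \<in> S \<Longrightarrow> z \<in> N \<Longrightarrow> X z \<in> TN z"
proof -
  \<comment> \<open>Constant coefficients in the frame reproduce x at q; the projection makes the
    field tangent along \<open>N\<close>.\<close>
  let ?X = "\<lambda>z. P z (\<Sum>i\<in>I. (g q x (e i q) / g q (e i q) (e i q)) *\<^sub>R e i z)"
  have "?X q = x"
    using P_id[OF assms(1,2) P_tangent[OF assms(1,2)], of x] P_id[OF assms] unfolding P_def[of q x]
    by simp
  moreover have "vector_field A S ?X"
    by (intro P_vector_field vector_field_sum vector_field_cmult frame_vf chart)
  ultimately show thesis using that[of ?X] P_tangent by blast
qed

lemma obtain_normal_ext:
  assumes "q \<in> S" "q \<in> N" "\<xi> \<in> NN q"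
  obtains X where "vector_field A S X" "X q = \<xi>" "\<And>z. z \<in> S \<Longrightarrow> z \<in> N \<Longrightarrow> X z \<in> NN z"
proof -
  let ?X = "\<lambda>z. nor z (\<Sum>i\<in>UNIV. (g q \<xi> (e i q) / g q (e i q) (e i q)) *\<^sub>R e i z)"
  have "?X q = \<xi>"
    using frame_expansion[OF assms(1), of \<xi>] nor_id[OF assms] by simp
  moreover have "vector_field A S ?X"
    by (intro nor_vector_field vector_field_sum vector_field_cmult frame_vf chart)
  ultimately show thesis using that[of ?X] nor_normal by blast
qed

text \<open>The chosen extension is known only through its defining property, so some extension has
  to be exhibited first. The domain is cut down to S, where the frame lives.\<close>

lemma tan_ext:
  assumes "q \<in> S" "q \<in> N" "x \<in> TN q"
  obtains T where "q \<in> T" "T \<subseteq> S" "vector_field A T (tan_ext A n N q x)" "tan_ext A n N q x q = x"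
    "\<And>z. z \<in> T \<Longrightarrow> z \<in> N \<Longrightarrow> tan_ext A n N q x z \<in> TN z"
proof -
  have "\<exists>Y S. q \<in> S \<and> vector_field A S Y \<and> Y q = x \<and> (\<forall>z\<in>S \<inter> N. Y z \<in> TN z)"
    using obtain_tangent_ext[OF assms] assms(1) by (metis Int_iff)
  then have "\<exists>S. q \<in> S \<and> vector_field A S (tan_ext A n N q x) \<and> tan_ext A n N q x q = x \<and>
      (\<forall>z\<in>S \<inter> N. tan_ext A n N q x z \<in> TN z)"
    unfolding tan_ext_def by (rule someI_ex)
  then obtain T where T: "q \<in> T" "vector_field A T (tan_ext A n N q x)" "tan_ext A n N q x q = x"
      "\<And>z. z \<in> T \<inter> N \<Longrightarrow> tan_ext A n N q x z \<in> TN z" by blast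
  have "vector_field A (S \<inter> T) (tan_ext A n N q x)"
    by (rule vector_field_subset[OF T(2)]) (use chart vector_field_open[OF T(2)] in auto)
  then show thesis using that[of "S \<inter> T"] T assms by auto
qed

lemma nor_ext:
  assumes "q \<in> S" "q \<in> N" "\<xi> \<in> NN q"
  obtains T where "q \<in> T" "T \<subseteq> S" "vector_field A T (nor_ext A c n N q \<xi>)" "nor_ext A c n N q \<xi> q = \<xi>"
    "\<And>z. z \<in> T \<Longrightarrow> z \<in> N \<Longrightarrow> nor_ext A c n N q \<xi> z \<in> NN z"
proof -
  have "\<exists>Y S. q \<in> S \<and> vector_field A S Y \<and> Y q = \<xi> \<and> (\<forall>z\<in>S \<inter> N. Y z \<in> NN z)"
    using obtain_normal_ext[OF assms] assms(1) by (metis Int_iff)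
  then have "\<exists>S. q \<in> S \<and> vector_field A S (nor_ext A c n N q \<xi>) \<and> nor_ext A c n N q \<xi> q = \<xi> \<and>
      (\<forall>z\<in>S \<inter> N. nor_ext A c n N q \<xi> z \<in> NN z)"
    unfolding nor_ext_def by (rule someI_ex)
  then obtain T where T: "q \<in> T" "vector_field A T (nor_ext A c n N q \<xi>)" "nor_ext A c n N q \<xi> q = \<xi>"
      "\<And>z. z \<in> T \<inter> N \<Longrightarrow> nor_ext A c n N q \<xi> z \<in> NN z" by blast
  have "vector_field A (S \<inter> T) (nor_ext A c n N q \<xi>)"
    by (rule vector_field_subset[OF T(2)]) (use chart vector_field_open[OF T(2)] in auto)
  then show thesis using that[of "S \<inter> T"] T assms by auto
qed

text \<open>Reduces a covariant derivative to directional derivatives of frame components, to which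
  \<open>dir_deriv_along_submanifold\<close> applies.\<close>

lemma cov_frame_expansion:
  assumes C: "connection A D" and Y: "vector_field A T Y" "q \<in> T" "T \<subseteq> S"
  shows "cov A D q x Y = (\<Sum>i\<in>UNIV. dir_deriv A q x (\<lambda>z. g z (Y z) (e i z) / g z (e i z) (e i z)) *\<^sub>R e i q
    + (g q (Y q) (e i q) / g q (e i q) (e i q)) *\<^sub>R cov A D q x (e i))"
proof -
  have T: "open T" "T \<subseteq> fst a" using vector_field_open Y chart by auto
  have ev: "vector_field A T (e i)" for i using vector_field_subset[OF frame_vf T(1) Y(3)] .
  have sm: "smooth_fun A T (\<lambda>z. g z (Y z) (e i z) / g z (e i z) (e i z))" for i
    by (intro smooth_fun_divide gm_smooth chart T Y ev frame_norm_nz) (use Y in auto)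
  have "cov A D q x Y = cov A D q x (\<lambda>z. \<Sum>i\<in>UNIV. (g z (Y z) (e i z) / g z (e i z) (e i z)) *\<^sub>R e i z)"
    by (rule cov_cong[OF C Y(1) _ Y(2)])
      (use frame_expansion Y(3) in \<open>auto intro!: vector_field_sum vector_field_scaleR sm ev T\<close>)
  also have "\<dots> = (\<Sum>i\<in>UNIV. cov A D q x (\<lambda>z. (g z (Y z) (e i z) / g z (e i z) (e i z)) *\<^sub>R e i z))"
    by (rule cov_sum[OF C T(1) _ _ Y(2)]) (auto intro!: vector_field_scaleR sm ev)
  finally show ?thesis using cov_scaleR[OF C sm ev Y(2)] by simp
qed

text \<open>The frame components of Y - Y' vanish on \<open>N\<close>, hence so do their derivatives
  along x. This makes the choice of extensions immaterial.\<close>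

lemma cov_along:
  assumes C: "connection A D" and q: "q \<in> N" and x: "x \<in> TN q"
    and Y: "vector_field A T Y" "vector_field A T Y'" "q \<in> T" "T \<subseteq> S"
    and eq: "\<And>z. z \<in> T \<Longrightarrow> z \<in> N \<Longrightarrow> Y z = Y' z"
  shows "cov A D q x Y = cov A D q x Y'"
proof -
  have T: "open T" "T \<subseteq> fst a" using vector_field_open Y chart by auto
  have ev: "vector_field A T (e i)" for i using vector_field_subset[OF frame_vf T(1) Y(4)] .
  note d = vector_field_diff[OF Y(1,2)]
  have sm: "smooth_fun A T (\<lambda>z. g z (Y z - Y' z) (e i z) / g z (e i z) (e i z))" for i
    by (intro smooth_fun_divide gm_smooth chart T d ev frame_norm_nz) (use Y in auto)
  have "dir_deriv A q x (\<lambda>z. g z (Y z - Y' z) (e i z) / g z (e i z) (e i z)) = 0" for i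
    by (rule dir_deriv_along_submanifold[OF sm Y(3) _ q x]) (simp add: eq gm_linear_simps)
  then have "cov A D q x (\<lambda>z. Y z - Y' z) = 0"
    using cov_frame_expansion[OF C d Y(3,4)] eq[OF Y(3) q] by (simp add: gm_linear_simps)
  then show ?thesis using cov_diff[OF C Y(1,2,3)] by simp
qed

text \<open>The second fundamental form written with derivatives of the frame, so that it makes
  sense for arbitrary vectors at every point of S. For tangent vectors along \<open>N\<close> it is
  the normal part of \<nabla>_x Y for any tangent extension Y, by
  \<open>nor_cov_tangent\<close>.\<close>

definition II :: "('a, 'm) connection_op \<Rightarrow> 'a \<Rightarrow> real ^ 'm \<Rightarrow> real ^ 'm \<Rightarrow> real ^ 'm"
  where "II D q x y = (\<Sum>i\<in>I. (g q y (e i q) / g q (e i q) (e i q)) *\<^sub>R nor q (cov A D q x (e i)))"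

lemma II_linear_left: "connection A D \<Longrightarrow> q \<in> S \<Longrightarrow> linear (\<lambda>x. II D q x y)"
  unfolding II_def
  by (rule linearI)
    (simp_all add: linear_add[OF cov_linear[OF _ frame_vf]] linear_cmul[OF cov_linear[OF _ frame_vf]]
      linear_add[OF nor_linear] linear_cmul[OF nor_linear] sum.distrib scaleR_sum_right algebra_simps)

lemma II_linear_right: "linear (II D q x)"
  unfolding II_def
  by (rule linearI) (simp_all add: gm_linear_simps sum.distrib scaleR_sum_right algebra_simps
      add_divide_distrib)

text \<open>In the frame expansion the derivative of a component multiplies \<open>e i\<close>: for
  i in \<open>I\<close> this vector is tangent and killed by \<open>nor\<close>, for other i the
  component of Y vanishes along \<open>N\<close> and so does its derivative.\<close>

lemma nor_cov_tangent:
  assumes C: "connection A D" and q: "q \<in> N" and x: "x \<in> TN q"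
    and Y: "vector_field A T Y" "q \<in> T" "T \<subseteq> S" "\<And>z. z \<in> T \<Longrightarrow> z \<in> N \<Longrightarrow> Y z \<in> TN z"
  shows "nor q (cov A D q x Y) = II D q x (Y q)"
proof -
  have T: "open T" "T \<subseteq> fst a" "q \<in> S" using vector_field_open Y chart by auto
  have ev: "vector_field A T (e i)" for i using vector_field_subset[OF frame_vf T(1) Y(3)] .
  have sm: "smooth_fun A T (\<lambda>z. g z (Y z) (e i z) / g z (e i z) (e i z))" for i
    by (intro smooth_fun_divide gm_smooth chart T Y ev frame_norm_nz) (use Y in auto)
  have 0: "nor q (dir_deriv A q x (\<lambda>z. g z (Y z) (e i z) / g z (e i z) (e i z)) *\<^sub>R e i q
      + (g q (Y q) (e i q) / g q (e i q) (e i q)) *\<^sub>R cov A D q x (e i)) =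
      (if i \<in> I then (g q (Y q) (e i q) / g q (e i q) (e i q)) *\<^sub>R nor q (cov A D q x (e i)) else 0)" for i
  proof (cases "i \<in> I")
    case True
    then show ?thesis
      by (simp add: linear_add[OF nor_linear] linear_cmul[OF nor_linear] nor_def[of q "e i q"] P_frame T)
  next
    case False
    have "e i z \<in> NN z" if "z \<in> S" "z \<in> N" for z
      using False by (auto simp: normal_iff[OF that] intro!: frame_orth[OF that(1)])
    then have z: "g z (Y z) (e i z) = 0" if "z \<in> T" "z \<in> N" for z
      using that Y(3,4) tangent_normal by blast
    have "dir_deriv A q x (\<lambda>z. g z (Y z) (e i z) / g z (e i z) (e i z)) = 0"
      by (rule dir_deriv_along_submanifold[OF sm Y(2) _ q x]) (simp add: z)
    then show ?thesis using False z[OF Y(2) q] by (simp add: linear_0[OF nor_linear])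
  qed
  show ?thesis
    unfolding cov_frame_expansion[OF C Y(1-3)] linear_sum[OF nor_linear] 0 II_def
    by (simp add: sum.If_cases)
qed

lemma fund_form_eq:
  assumes C: "connection A D" and q: "q \<in> S" "q \<in> N" and x: "x \<in> TN q" "y \<in> TN q"
  shows "fund_form A c n N D q x y = II D q x y"
  using tan_ext[OF q x(2)] nor_cov_tangent[OF C q(2) x(1)]
  unfolding fund_form_def nor_part_eq[OF q] by metis

lemma II_normal: "q \<in> S \<Longrightarrow> q \<in> N \<Longrightarrow> II D q x y \<in> NN q"
  unfolding II_def using nor_normal
  by (auto simp: normal_iff linear_sum[OF gm_linear(2)] linear_cmul[OF gm_linear(2)])

text \<open>The members of the orthogonal frame need not commute, so x and y are extended by
  coordinate fields of a slice chart instead: these are tangent along \<open>N\<close> and have zero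
  bracket.\<close>

lemma II_sym:
  assumes W: "Weyl_structure A c D" and q: "q \<in> S" "q \<in> N" and x: "x \<in> TN q" "y \<in> TN q"
  shows "II D q x y = II D q y x"
proof -
  note C = Weyl_connection[OF W]
  obtain b J where b: "slice_chart A n N b J" "q \<in> fst b"
    using sub q(2) unfolding submanifold_def by blast
  have bA: "b \<in> A" using b(1) unfolding slice_chart_def by blast
  let ?T = "S \<inter> fst b"
  have T: "open ?T" "q \<in> ?T" "?T \<subseteq> S" "?T \<subseteq> fst b"
    using chart chart_homeo(1)[OF bA] b q by auto
  define E where "E v = coord_field A b (jac A b q v)" for v
  have E: "vector_field A ?T (E v)" "E v q = v" for v
    unfolding E_def using coord_field_vector_field[OF bA T(1,4)] coord_field_jac[OF bA b(2)] by auto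
  have tan: "E v z \<in> TN z" if "v \<in> TN q" "z \<in> ?T" "z \<in> N" for v z
    using that tangent_bundle_slice[OF b q(2)] tangent_bundle_slice[OF b(1) _ that(3)]
      jac_coord_field[OF bA, of z] unfolding E_def by auto
  have "II D q x y = nor q (cov A D q x (E y))"
    using nor_cov_tangent[OF C q(2) x(1) E(1)[of y] T(2,3)] tan x E(2) by simp
  also have "cov A D q x (E y) = cov A D q y (E x)"
    using cov_torsion[OF C Weyl_torsion_free[OF W] E(1)[of x] E(1)[of y] T(2)]
      lie_bracket_coord_field[OF bA b(2)] E(2) unfolding E_def by simp
  also have "nor q \<dots> = II D q y x"
    using nor_cov_tangent[OF C q(2) x(2) E(1)[of x] T(2,3)] tan x E(2) by simp
  finally show ?thesis .
qed

text \<open>Weingarten equation: differentiate g(Y,Z) = 0 along \<open>N\<close> for a tangent field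
  Z through y. The term with \<open>conn_form\<close> drops out because g(Y,Z) vanishes at q
  itself.\<close>

lemma cov_normal_tangent:
  assumes W: "Weyl_structure A c D" and q: "q \<in> N" and x: "x \<in> TN q" "y \<in> TN q"
    and Y: "vector_field A T Y" "q \<in> T" "T \<subseteq> S" "\<And>z. z \<in> T \<Longrightarrow> z \<in> N \<Longrightarrow> Y z \<in> NN z"
  shows "g q (cov A D q x Y) y = - g q (Y q) (II D q x y)"
proof -
  note C = Weyl_connection[OF W]
  have T: "open T" "T \<subseteq> fst a" "q \<in> S" "q \<in> fst a" using vector_field_open Y chart by auto
  obtain Z where Z: "vector_field A S Z" "Z q = y" "\<And>z. z \<in> S \<Longrightarrow> z \<in> N \<Longrightarrow> Z z \<in> TN z"
    using obtain_tangent_ext[OF T(3) q x(2)] by metis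
  have ZT: "vector_field A T Z" using vector_field_subset[OF Z(1) T(1) Y(3)] .
  have ZTN: "Z z \<in> TN z" if "z \<in> T" "z \<in> N" for z using Z(3) that Y(3) by blast
  have "dir_deriv A q x (\<lambda>z. g z (Y z) (Z z)) = 0"
    by (rule dir_deriv_along_submanifold[OF gm_smooth[OF chart(1) T(2) Y(1) ZT] Y(2) _ q x(1)])
      (use normal_tangent Y ZTN in blast)
  then have "g q (cov A D q x Y) y = - g q (Y q) (cov A D q x Z)"
    using Weyl_metric[OF W chart(1) T(4,2) Y(2,1) ZT, of x] Z(2)
      normal_tangent[OF T(3) Y(4)[OF Y(2) q] x(2)] by simp
  also have "g q (Y q) (cov A D q x Z) = g q (Y q) (nor q (cov A D q x Z))"
    using g_nor_normal[OF T(3) q Y(4)[OF Y(2) q], of "cov A D q x Z"] gm_sym by metis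
  also have "nor q (cov A D q x Z) = II D q x y"
    using nor_cov_tangent[OF C q x(1) ZT Y(2,3) ZTN] Z(2) by simp
  finally show ?thesis .
qed

text \<open>The mean curvature vector, normalized by \<open>g\<close> instead of \<open>c\<close>.\<close>

definition eta :: "('a, 'm) connection_op \<Rightarrow> 'a \<Rightarrow> real ^ 'm"
  where "eta D q = (1 / real n) *\<^sub>R
    (\<Sum>i\<in>I. (1 / g q (e i q) (e i q)) *\<^sub>R nor q (cov A D q (e i q) (e i)))"

lemma eta_vector_field: "connection A D \<Longrightarrow> vector_field A S (eta D)"
  unfolding eta_def
  by (intro vector_field_cmult vector_field_sum vector_field_scaleR nor_vector_field cov_vector_field
      smooth_fun_divide smooth_fun_const gm_smooth frame_vf chart frame_norm_nz)

lemma eta_normal: "q \<in> S \<Longrightarrow> q \<in> N \<Longrightarrow> eta D q \<in> NN q"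
  unfolding eta_def using nor_normal
  by (auto simp: normal_iff linear_sum[OF gm_linear(2)] linear_cmul[OF gm_linear(2)])

lemma frame_tangent: "q \<in> S \<Longrightarrow> q \<in> N \<Longrightarrow> i \<in> I \<Longrightarrow> e i q \<in> TN q"
  by (simp add: tang span_base)

lemma II_frame:
  assumes "connection A D" "q \<in> S" "q \<in> N" "i \<in> I" "x \<in> TN q"
  shows "II D q x (e i q) = nor q (cov A D q x (e i))"
  using nor_cov_tangent[OF assms(1,3,5) frame_vf assms(2) order_refl] frame_tangent assms(4) by simp

text \<open>The trace is computed in the tangent frame; the Weingarten equation turns it into minus
  the trace of the second fundamental form, which absorbs the sign in the definition of the mean
  curvature.\<close>

lemma mean_curv_eq:
  assumes W: "Weyl_structure A c D" and q: "q \<in> S" "q \<in> N" and \<xi>: "\<xi> \<in> NN q"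
  shows "mean_curv A c n N D q \<xi> = g q (eta D q) \<xi>"
proof -
  note C = Weyl_connection[OF W]
  obtain T where T: "q \<in> T" "T \<subseteq> S" "vector_field A T (nor_ext A c n N q \<xi>)" "nor_ext A c n N q \<xi> q = \<xi>"
    "\<And>z. z \<in> T \<Longrightarrow> z \<in> N \<Longrightarrow> nor_ext A c n N q \<xi> z \<in> NN z"
    using nor_ext[OF q \<xi>] by metis
  let ?f = "\<lambda>x. P q (cov A D q x (nor_ext A c n N q \<xi>))"
  have lin: "linear ?f"
    using linear_compose[OF cov_linear[OF C T(3,1)] P_linear[of q]] by (simp add: o_def)
  have "trace_on (TN q) ?f = (\<Sum>i\<in>I. g q (?f (e i q)) (e i q) / g q (e i q) (e i q))"
    by (rule trace_on_orthogonal_family[OF gm_bilinear])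
      (use frame_norm_nz[OF q(1)] frame_orth[OF q(1)] tang[OF q] P_tangent[OF q] lin in auto)
  also have "\<dots> = (\<Sum>i\<in>I. - (g q (nor q (cov A D q (e i q) (e i))) \<xi> / g q (e i q) (e i q)))"
  proof (rule sum.cong[OF refl])
    fix i assume i: "i \<in> I"
    note ei = frame_tangent[OF q i]
    have "g q (?f (e i q)) (e i q) = - g q \<xi> (II D q (e i q) (e i q))"
      using g_P_tangent[OF q ei] cov_normal_tangent[OF W q(2) ei ei T(3,1,2,5)] T(4) by simp
    then show "g q (?f (e i q)) (e i q) / g q (e i q) (e i q) =
        - (g q (nor q (cov A D q (e i q) (e i))) \<xi> / g q (e i q) (e i q))"
      using II_frame[OF C q i ei] gm_sym[of a q \<xi>] by simp
  qed
  finally have "trace_on (TN q) ?f =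
      - (\<Sum>i\<in>I. g q (nor q (cov A D q (e i q) (e i))) \<xi> / g q (e i q) (e i q))"
    by (simp add: sum_negf)
  then show ?thesis
    unfolding mean_curv_def tan_part_eq[OF q] eta_def
    by (simp add: linear_sum[OF gm_linear(2)] linear_cmul[OF gm_linear(2)])
qed

text \<open>With c = l g at q, the normal vector representing the mean curvature under c is
  \<open>eta D q\<close> divided by l, so l cancels in its product with c(x,y). Uniqueness follows
  from definiteness applied to the difference d.\<close>

lemma B0_eq:
  assumes W: "Weyl_structure A c D" and q: "q \<in> S" "q \<in> N" and x: "x \<in> TN q" "y \<in> TN q"
  shows "B0 A c n N D q x y = II D q x y - g q x y *\<^sub>R eta D q"
proof -
  define l where "l = (coord_dens A a q)\<^sup>2"
  have l: "l > 0" "c q x y = l * g q x y" for x y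
    unfolding l_def using coord_dens_pos[OF chart(1) S_chart[OF q(1)]] c_eq_gm[OF chart(1) S_chart[OF q(1)]]
    by auto
  have "mean_curv_vec A c n N D q = (1 / l) *\<^sub>R eta D q"
    unfolding mean_curv_vec_def
  proof (rule the_equality)
    show "(1 / l) *\<^sub>R eta D q \<in> NN q \<and>
        (\<forall>\<xi>\<in>NN q. c q ((1 / l) *\<^sub>R eta D q) \<xi> = mean_curv A c n N D q \<xi>)"
      using eta_normal[OF q, of D] l by (auto simp: normal_iff[OF q] mean_curv_eq[OF W q] gm_linear_simps)
    fix \<eta> assume \<eta>: "\<eta> \<in> NN q \<and> (\<forall>\<xi>\<in>NN q. c q \<eta> \<xi> = mean_curv A c n N D q \<xi>)"
    define d where "d = l *\<^sub>R \<eta> - eta D q"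
    have dn: "d \<in> NN q"
      using \<eta> eta_normal[OF q, of D] by (auto simp: d_def normal_iff[OF q] gm_linear_simps)
    have "g q d d = c q \<eta> d - mean_curv A c n N D q d"
      unfolding l mean_curv_eq[OF W q dn]
      by (simp add: d_def gm_linear_simps gm_sym[of a q \<eta> "eta D q"] algebra_simps)
    then have "g q d d = 0" using \<eta> dn by simp
    then have "d = 0" using gm_pos[OF chart(1) S_chart[OF q(1)], of d] by force
    then have "eta D q = l *\<^sub>R \<eta>" unfolding d_def by simp
    then show "\<eta> = (1 / l) *\<^sub>R eta D q" using l(1) by simp
  qed
  then show ?thesis
    unfolding B0_def fund_form_eq[OF Weyl_connection[OF W] q x] l using l(1) by simp
qed

end

section \<open>Change of the mixed Schouten-Weyl tensor\<close>

context sub_frame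
begin

lemma nor_vector_field_on:
  assumes "vector_field A T X" "T \<subseteq> S"
  shows "vector_field A T (\<lambda>q. nor q (X q))"
proof -
  have T: "open T" "T \<subseteq> fst a" using assms vector_field_open chart by auto
  have ev: "vector_field A T (e i)" for i using vector_field_subset[OF frame_vf T(1) assms(2)] .
  show ?thesis
    unfolding nor_def P_def
    by (intro vector_field_diff vector_field_sum vector_field_scaleR smooth_fun_divide gm_smooth
        chart T assms(1) ev frame_norm_nz) (use assms in auto)
qed

text \<open>Along \<open>N\<close> the function H(\<Xi>) equals g(eta, \<Xi>), which is smooth and
  may therefore replace the chosen extension in a tangential derivative. Metricity splits this
  derivative, and the part with \<nabla>\<Xi> is the term that the dual connection
  subtracts.\<close>

lemma cov_mean_curv_eq:
  assumes W: "Weyl_structure A c D" and q: "q \<in> S" "q \<in> N" and x: "x \<in> TN q" and \<xi>: "\<xi> \<in> NN q"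
  shows "cov_mean_curv A c n N D q x \<xi> =
    g q (cov A D q x (eta D)) \<xi> - 2 * conn_form a D q x * g q (eta D q) \<xi>"
proof -
  note C = Weyl_connection[OF W]
  let ?X = "nor_ext A c n N q \<xi>"
  obtain T where T: "q \<in> T" "T \<subseteq> S" "vector_field A T ?X" "?X q = \<xi>"
    "\<And>z. z \<in> T \<Longrightarrow> z \<in> N \<Longrightarrow> ?X z \<in> NN z"
    using nor_ext[OF q \<xi>] by metis
  have oT: "open T" "T \<subseteq> fst a" using vector_field_open T chart by auto
  have eT: "vector_field A T (eta D)" using vector_field_subset[OF eta_vector_field[OF C] oT(1) T(2)] .
  let ?h = "\<lambda>z. g z (eta D z) (?X z)"
  have h: "smooth_fun A T ?h" by (rule gm_smooth[OF chart(1) oT(2) eT T(3)])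
  have mc: "mean_curv A c n N D z (?X z) = ?h z" if "z \<in> T" "z \<in> N" for z
    using mean_curv_eq[OF W _ that(2) T(5)[OF that]] that T(2) by blast
  let ?F = "fun_ext A N q (\<lambda>z. mean_curv A c n N D z (?X z))"
  have "\<exists>F S. q \<in> S \<and> smooth_fun A S F \<and> (\<forall>z\<in>S \<inter> N. F z = mean_curv A c n N D z (?X z))"
    using h T(1) mc by (intro exI[of _ ?h] exI[of _ T]) auto
  then have "\<exists>S. q \<in> S \<and> smooth_fun A S ?F \<and> (\<forall>z\<in>S \<inter> N. ?F z = mean_curv A c n N D z (?X z))"
    unfolding fun_ext_def by (rule someI_ex)
  then obtain R where R: "q \<in> R" "smooth_fun A R ?F"
    "\<And>z. z \<in> R \<inter> N \<Longrightarrow> ?F z = mean_curv A c n N D z (?X z)" by blast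
  have o: "open (R \<inter> T)" using oT smooth_fun_open[OF R(2)] by blast
  have s: "smooth_fun A (R \<inter> T) ?F" "smooth_fun A (R \<inter> T) ?h"
    using smooth_fun_subset[OF R(2) o] smooth_fun_subset[OF h o] by auto
  have "dir_deriv A q x (\<lambda>z. ?F z - ?h z) = 0"
    by (rule dir_deriv_along_submanifold[OF smooth_fun_diff[OF s] _ _ q(2) x]) (use R T mc in auto)
  then have "dir_deriv A q x ?F = dir_deriv A q x ?h"
    using dir_deriv_diff[OF s, of q x] R(1) T(1) by simp
  also have "\<dots> = g q (cov A D q x (eta D)) \<xi> + g q (eta D q) (cov A D q x ?X)
      - 2 * conn_form a D q x * g q (eta D q) \<xi>"
    using Weyl_metric[OF W chart(1) S_chart[OF q(1)] oT(2) T(1) eT T(3), of x] T(4) by simp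
  finally have d: "dir_deriv A q x ?F = \<dots>" .
  have "mean_curv A c n N D q (nor q (cov A D q x ?X)) = g q (eta D q) (cov A D q x ?X)"
    using mean_curv_eq[OF W q nor_normal[OF q]] g_nor_normal[OF q eta_normal[OF q, of D]] gm_sym by metis
  then show ?thesis
    unfolding cov_mean_curv_def Let_def d nor_part_eq[OF q] by simp
qed

text \<open>Frame expression of the trace-free form \<open>B0\<close>, free of chosen extensions
  and, for a connection, linear in both arguments at every point of S.\<close>

definition beta :: "('a, 'm) connection_op \<Rightarrow> 'a \<Rightarrow> real ^ 'm \<Rightarrow> real ^ 'm \<Rightarrow> real ^ 'm"
  where "beta D q x y = II D q x y - g q x y *\<^sub>R eta D q"

lemma beta_linear:
  assumes "connection A D" "q \<in> S"
  shows "linear (\<lambda>x. beta D q x y)" "linear (beta D q x)"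
  using II_linear_left[OF assms, of y] II_linear_right[of D q x] unfolding beta_def
  by (auto simp: linear_iff gm_linear_simps algebra_simps)

lemma beta_normal: "q \<in> S \<Longrightarrow> q \<in> N \<Longrightarrow> beta D q x y \<in> NN q"
  using II_normal eta_normal by (auto simp: beta_def normal_iff gm_linear_simps)

lemma beta_sym:
  "Weyl_structure A c D \<Longrightarrow> q \<in> S \<Longrightarrow> q \<in> N \<Longrightarrow> x \<in> TN q \<Longrightarrow> y \<in> TN q \<Longrightarrow> beta D q x y = beta D q y x"
  unfolding beta_def using II_sym gm_sym by metis

lemma sec_ext_B0:
  assumes W: "Weyl_structure A c D" and q: "q \<in> S" "q \<in> N" and y: "y \<in> TN q" "z \<in> TN q"
  defines "Y \<equiv> tan_ext A n N q y" and "Z \<equiv> tan_ext A n N q z"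
  defines "s \<equiv> sec_ext A N q (\<lambda>w. B0 A c n N D w (Y w) (Z w))"
  obtains T where "q \<in> T" "T \<subseteq> S" "vector_field A T s" "vector_field A T Y" "vector_field A T Z"
    "Y q = y" "Z q = z"
    "\<And>w. w \<in> T \<Longrightarrow> w \<in> N \<Longrightarrow> s w = beta D w (Y w) (Z w)"
    "\<And>w. w \<in> T \<Longrightarrow> w \<in> N \<Longrightarrow> Y w \<in> TN w" "\<And>w. w \<in> T \<Longrightarrow> w \<in> N \<Longrightarrow> Z w \<in> TN w"
proof -
  note C = Weyl_connection[OF W]
  obtain T1 where T1: "q \<in> T1" "T1 \<subseteq> S" "vector_field A T1 Y" "Y q = y"
    "\<And>w. w \<in> T1 \<Longrightarrow> w \<in> N \<Longrightarrow> Y w \<in> TN w"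
    using tan_ext[OF q y(1)] unfolding Y_def by metis
  obtain T2 where T2: "q \<in> T2" "T2 \<subseteq> S" "vector_field A T2 Z" "Z q = z"
    "\<And>w. w \<in> T2 \<Longrightarrow> w \<in> N \<Longrightarrow> Z w \<in> TN w"
    using tan_ext[OF q y(2)] unfolding Z_def by metis
  let ?T = "T1 \<inter> T2"
  have T: "open ?T" "q \<in> ?T" "?T \<subseteq> S" "?T \<subseteq> fst a"
    using T1 T2 vector_field_open chart by auto
  have v: "vector_field A ?T Y" "vector_field A ?T Z" "vector_field A ?T (eta D)"
    using vector_field_subset[OF _ T(1)] T1(3) T2(3) eta_vector_field[OF C] T(3) by auto
  \<comment> \<open>Smooth witness for \<open>sec_ext\<close>: on \<open>N\<close> it equals
    B0(Y,Z), while off \<open>N\<close> it is just one possible extension.\<close>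
  define V where "V w = nor w (cov A D w (Y w) Z) - g w (Y w) (Z w) *\<^sub>R eta D w" for w
  have V: "vector_field A ?T V"
    unfolding V_def
    by (intro vector_field_diff nor_vector_field_on T cov_vector_field[OF C] vector_field_scaleR
        gm_smooth chart v)
  have Vb: "V w = B0 A c n N D w (Y w) (Z w)" if "w \<in> ?T" "w \<in> N" for w
  proof -
    have w: "w \<in> S" "Y w \<in> TN w" "Z w \<in> TN w" using that T1 T2 by auto
    have "nor w (cov A D w (Y w) Z) = II D w (Y w) (Z w)"
      by (rule nor_cov_tangent[OF C that(2) w(2) v(2) that(1) T(3)]) (use T2 in auto)
    then show ?thesis unfolding V_def B0_eq[OF W w(1) that(2) w(2,3)] by simp
  qed
  have "\<exists>V R. q \<in> R \<and> vector_field A R V \<and> (\<forall>w\<in>R \<inter> N. V w = B0 A c n N D w (Y w) (Z w))"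
    using V Vb T(2) by (intro exI[of _ V] exI[of _ ?T]) auto
  then have "\<exists>R. q \<in> R \<and> vector_field A R s \<and> (\<forall>w\<in>R \<inter> N. s w = B0 A c n N D w (Y w) (Z w))"
    unfolding s_def sec_ext_def by (rule someI_ex)
  then obtain R where R: "q \<in> R" "vector_field A R s"
    "\<And>w. w \<in> R \<inter> N \<Longrightarrow> s w = B0 A c n N D w (Y w) (Z w)" by blast
  let ?R = "R \<inter> ?T"
  have o: "open ?R" using T R vector_field_open by blast
  show thesis
  proof (rule that[of ?R])
    show "vector_field A ?R s" "vector_field A ?R Y" "vector_field A ?R Z"
      using vector_field_subset[OF R(2) o] vector_field_subset[OF v(1) o] vector_field_subset[OF v(2) o]
      by auto
    show "s w = beta D w (Y w) (Z w)" if "w \<in> ?R" "w \<in> N" for w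
      using R(3)[of w] that B0_eq[OF W _ that(2), of "Y w" "Z w"] T1(2,5) T2(5)
      unfolding beta_def by auto
  qed (use R T1 T2 in auto)
qed

text \<open>Only the single point q matters, so the frame may be normalized by square roots. This is
  the existence statement behind the choice in \<open>ctrace\<close>, phrased for g.\<close>

lemma orthonormal_basis_exists:
  assumes q: "q \<in> S" "q \<in> N"
  shows "\<exists>E. E \<subseteq> TN q \<and> span E = TN q \<and> (\<forall>x\<in>E. \<forall>y\<in>E. g q x y = (if x = y then 1 else 0))"
proof (intro exI conjI ballI)
  define r where "r i = 1 / sqrt (g q (e i q) (e i q))" for i
  have r: "r i > 0" "r i * r i * g q (e i q) (e i q) = 1" for i
    using frame_pos[OF q(1), of i] by (auto simp: r_def)
  let ?E = "(\<lambda>i. r i *\<^sub>R e i q) ` I"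
  show 1: "?E \<subseteq> TN q" using tang[OF q] by (auto intro!: span_scale[OF span_base])
  show "span ?E = TN q"
  proof
    show "span ?E \<subseteq> TN q" using 1 span_minimal[of ?E] tang[OF q] by (simp add: subspace_span)
    have "e i q \<in> span ?E" if "i \<in> I" for i
    proof -
      have "(1 / r i) *\<^sub>R (r i *\<^sub>R e i q) \<in> span ?E"
        by (rule span_scale, rule span_base) (use that in blast)
      then show ?thesis using r(1)[of i] by simp
    qed
    then show "TN q \<subseteq> span ?E"
      unfolding tang[OF q] by (intro span_minimal) (auto simp: subspace_span)
  qed
  fix x y assume "x \<in> ?E" "y \<in> ?E"
  then obtain i j where ij: "x = r i *\<^sub>R e i q" "y = r j *\<^sub>R e j q" by blast
  show "g q x y = (if x = y then 1 else 0)"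
  proof (cases "i = j")
    case True
    then show ?thesis using ij r(2)[of i] by (simp add: gm_linear_simps mult.assoc)
  next
    case False
    have gxy: "g q x y = 0" using False frame_orth[OF q(1)] ij by (simp add: gm_linear_simps)
    have "g q x x = 1" using ij r(2)[of i] by (simp add: gm_linear_simps mult.assoc)
    then have "x \<noteq> y" using gxy by auto
    then show ?thesis using gxy by simp
  qed
qed

section \<open>Sums over an arbitrary orthonormal basis of a tangent space\<close>

context
  fixes q E
  assumes q: "q \<in> S" "q \<in> N"
    and E: "E \<subseteq> TN q" "span E = TN q" "\<And>x y. x \<in> E \<Longrightarrow> y \<in> E \<Longrightarrow> g q x y = (if x = y then 1 else 0)"
begin

text \<open>An infinite index set would turn the sums into 0. Every finite subset is orthogonal,
  hence independent and of size at most m.\<close>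

lemma orthonormal_finite: "finite E"
proof -
  have "card G \<le> DIM(real ^ 'm)" if "G \<subseteq> E" "finite G" for G
  proof -
    have "independent ((\<lambda>x. x) ` G)"
      by (rule orthogonal_family_independent(2)[where b = "g q", OF gm_bilinear that(2)])
        (use subsetD[OF that(1)] E(3) in auto)
    then show ?thesis using independent_bound[of G] by simp
  qed
  then show ?thesis using finite_if_finite_subsets_card_bdd by blast
qed

lemma orthonormal_expansion: "v \<in> TN q \<Longrightarrow> v = (\<Sum>f\<in>E. g q v f *\<^sub>R f)"
proof -
  assume "v \<in> TN q"
  then have v: "v \<in> span ((\<lambda>x. x) ` E)" using E(2) by simp
  have "v = (\<Sum>f\<in>E. (g q v f / g q f f) *\<^sub>R f)"
    by (rule orthogonal_family_expansion[where b = "g q" and e = "\<lambda>x. x", OF gm_bilinear orthonormal_finite])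
      (use E(3) v in auto)
  also have "\<dots> = (\<Sum>f\<in>E. g q v f *\<^sub>R f)" by (rule sum.cong) (auto simp: E(3))
  finally show ?thesis .
qed

lemma orthonormnabla_theta_linear_sum: "linear \<phi> \<Longrightarrow> v \<in> TN q \<Longrightarrow> (\<Sum>f\<in>E. g q v f *\<^sub>R \<phi> f) = \<phi> v"
proof -
  assume l: "linear \<phi>" and v: "v \<in> TN q"
  have "\<phi> v = \<phi> (\<Sum>f\<in>E. g q v f *\<^sub>R f)" using orthonormal_expansion[OF v] by simp
  then show ?thesis by (simp add: linear_sum[OF l] linear_cmul[OF l])
qed

lemma orthonormal_card: "card E = n"
proof -
  have "independent ((\<lambda>x. x) ` E)"
    by (rule orthogonal_family_independent(2)[where b = "g q", OF gm_bilinear orthonormal_finite])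
      (use E(3) in auto)
  then have "card E = dim (TN q)" using E(1,2) by (intro basis_card_eq_dim) auto
  moreover have ind: "inj_on (\<lambda>i. e i q) I" "independent ((\<lambda>i. e i q) ` I)"
    by (rule orthogonal_family_independent[where b = "g q", OF gm_bilinear];
        use frame_norm_nz[OF q(1)] frame_orth[OF q(1)] in simp)+
  have "card ((\<lambda>i. e i q) ` I) = dim (TN q)"
    using tang[OF q] ind(2) by (intro basis_card_eq_dim) (auto simp: span_superset)
  ultimately show ?thesis using card_image[OF ind(1)] card_I by simp
qed

text \<open>Contracting the basis with g(f, e i) moves the derivative onto \<open>e i\<close>, so
  the sum of II(f,f) becomes the frame sum that defines n times \<open>eta\<close>; the metric term
  contributes the same amount since the basis has n members.\<close>

lemma beta_trace:
  assumes W: "Weyl_structure A c D"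
  shows "(\<Sum>f\<in>E. beta D q f f) = 0"
proof -
  note C = Weyl_connection[OF W]
  have "(\<Sum>f\<in>E. II D q f f) = (\<Sum>i\<in>I. \<Sum>f\<in>E. (g q f (e i q) / g q (e i q) (e i q)) *\<^sub>R nor q (cov A D q f (e i)))"
    unfolding II_def by (rule sum.swap)
  also have "\<dots> = (\<Sum>i\<in>I. (1 / g q (e i q) (e i q)) *\<^sub>R nor q (cov A D q (e i q) (e i)))"
  proof (rule sum.cong[OF refl])
    fix i assume i: "i \<in> I"
    have l: "linear (\<lambda>f. nor q (cov A D q f (e i)))"
      using linear_compose[OF cov_linear[OF C frame_vf q(1)] nor_linear[of q]] by (simp add: o_def)
    have "(\<Sum>f\<in>E. (g q f (e i q) / g q (e i q) (e i q)) *\<^sub>R nor q (cov A D q f (e i))) =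
        (1 / g q (e i q) (e i q)) *\<^sub>R (\<Sum>f\<in>E. g q (e i q) f *\<^sub>R nor q (cov A D q f (e i)))"
      unfolding scaleR_sum_right
    proof (rule sum.cong[OF refl])
      fix f
      show "(g q f (e i q) / g q (e i q) (e i q)) *\<^sub>R nor q (cov A D q f (e i)) =
          (1 / g q (e i q) (e i q)) *\<^sub>R g q (e i q) f *\<^sub>R nor q (cov A D q f (e i))"
        using gm_sym[of a q f "e i q"] by simp
    qed
    then show "(\<Sum>f\<in>E. (g q f (e i q) / g q (e i q) (e i q)) *\<^sub>R nor q (cov A D q f (e i))) =
        (1 / g q (e i q) (e i q)) *\<^sub>R nor q (cov A D q (e i q) (e i))"
      using orthonormnabla_theta_linear_sum[OF l frame_tangent[OF q i]] by simp
  qed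
  also have "\<dots> = real n *\<^sub>R eta D q" using n_pos unfolding eta_def by simp
  finally have "(\<Sum>f\<in>E. II D q f f) = real n *\<^sub>R eta D q" .
  moreover have "(\<Sum>f\<in>E. g q f f *\<^sub>R eta D q) = real n *\<^sub>R eta D q"
    using E(3) orthonormal_card by (simp add: sum_constant_scaleR del: sum_constant)
  ultimately show ?thesis unfolding beta_def by (simp add: sum_subtractf)
qed

text \<open>With a basis of one element the trace is the only component.\<close>

lemma beta_curve:
  assumes W: "Weyl_structure A c D" and "n = 1" and x: "x \<in> TN q" "y \<in> TN q"
  shows "beta D q x y = 0"
proof -
  obtain f where f: "E = {f}" using orthonormal_card assms(2) card_1_singletonE by metis
  note l = beta_linear[OF Weyl_connection[OF W] q(1)]
  have "x = g q x f *\<^sub>R f" "y = g q y f *\<^sub>R f"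
    using orthonormal_expansion[OF x(1)] orthonormal_expansion[OF x(2)] f by auto
  then have "beta D q x y = g q x f *\<^sub>R g q y f *\<^sub>R beta D q f f"
    using linear_cmul[OF l(1)] linear_cmul[OF l(2)] by metis
  then show ?thesis using beta_trace[OF W] f by simp
qed

end

end

section \<open>Extrinsic geometry of \<open>N\<close> under a change of Weyl structure\<close>

locale sub_weyl = weyl_pair A c a S e D D' + sub_frame A c a S e n N I
  for A :: "('a::{t2_space,second_countable_topology}, 'm::finite) chart set"
    and c a S e D D' n N I
begin

text \<open>Of the three terms added by \<open>cov_change\<close>, those along x and y are tangent
  and vanish under \<open>nor\<close>.\<close>

lemma II_change:
  assumes q: "q \<in> S" "q \<in> N" and x: "x \<in> TN q" "y \<in> TN q"
  shows "II D' q x y = II D q x y - g q x y *\<^sub>R nor q (U q)"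
proof -
  obtain Y where Y: "vector_field A S Y" "Y q = y" "\<And>z. z \<in> S \<Longrightarrow> z \<in> N \<Longrightarrow> Y z \<in> TN z"
    using obtain_tangent_ext[OF q x(2)] by metis
  have "II D' q x y = nor q (cov A D' q x Y)" "II D q x y = nor q (cov A D q x Y)"
    using nor_cov_tangent[OF C' q(2) x(1) Y(1) q(1) order_refl Y(3)]
      nor_cov_tangent[OF C q(2) x(1) Y(1) q(1) order_refl Y(3)] Y(2) by auto
  then show ?thesis
    using cov_change[OF q(1) Y(1) q(1), of x]
    by (simp add: linear_add[OF nor_linear] linear_diff[OF nor_linear] linear_cmul[OF nor_linear]
        Y(2) nor_tangent[OF q x(1)] nor_tangent[OF q x(2)])
qed

lemma eta_change:
  assumes q: "q \<in> S" "q \<in> N"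
  shows "eta D' q = eta D q - nor q (U q)"
proof -
  have i: "(1 / g q (e i q) (e i q)) *\<^sub>R nor q (cov A D' q (e i q) (e i)) =
      (1 / g q (e i q) (e i q)) *\<^sub>R nor q (cov A D q (e i q) (e i)) - nor q (U q)" if "i \<in> I" for i
    using II_change[OF q frame_tangent[OF q that] frame_tangent[OF q that]]
      II_frame[OF C q that frame_tangent[OF q that]] II_frame[OF C' q that frame_tangent[OF q that]]
      frame_norm_nz[OF q(1), of i] by (simp add: scaleR_diff_right)
  have "eta D' q = (1 / real n) *\<^sub>R
      ((\<Sum>i\<in>I. (1 / g q (e i q) (e i q)) *\<^sub>R nor q (cov A D q (e i q) (e i))) - (\<Sum>i\<in>I. nor q (U q)))"
    unfolding eta_def sum_subtractf[symmetric] by (intro arg_cong2[where f = scaleR] sum.cong refl i)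
  then show ?thesis
    unfolding eta_def using card_I n_pos
    by (simp add: scaleR_diff_right sum_constant_scaleR del: sum_constant)
qed

lemma beta_change:
  "q \<in> S \<Longrightarrow> q \<in> N \<Longrightarrow> x \<in> TN q \<Longrightarrow> y \<in> TN q \<Longrightarrow> beta D' q x y = beta D q x y"
  unfolding beta_def by (simp add: II_change eta_change algebra_simps)

text \<open>Along \<open>N\<close> the new mean curvature vector is eta - U + P U. Differentiating U
  produces \<nabla>\<theta>; P U is tangent, so its derivative has normal part II(x, P U), which is
  the trace-free part plus \<theta>(x) eta. The multiples of \<theta>(x) eta cancel in total: one
  from here, one from \<nabla>', minus two from the change of \<open>conn_form\<close>.\<close>

lemma cov_mean_curv_change:
  assumes q: "q \<in> S" "q \<in> N" and x: "x \<in> TN q" and \<xi>: "\<xi> \<in> NN q"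
  shows "cov_mean_curv A c n N D' q x \<xi> - cov_mean_curv A c n N D q x \<xi> =
    g q (beta D q x (P q (U q))) \<xi> + g q (U q) x * g q (U q) \<xi> - nabla_theta q x \<xi>"
proof -
  note v = eta_vector_field[OF C] eta_vector_field[OF C'] U_vector_field
    P_vector_field[OF U_vector_field] nor_vector_field[OF U_vector_field]
  have nx: "g q x \<xi> = 0" "g q x (eta D' q) = 0"
    using tangent_normal[OF q(1) _ x] \<xi> eta_normal[OF q] by auto
  have PU: "P q (U q) \<in> TN q" by (rule P_tangent[OF q])
  have "cov A D' q x (eta D') =
      cov A D q x (eta D') + g q (U q) x *\<^sub>R eta D' q + g q (U q) (eta D' q) *\<^sub>R x"
    using cov_change[OF q(1) v(2) q(1), of x] nx by simp
  \<comment> \<open>\<open>eta_change\<close> is available on \<open>N\<close> only, which suffices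
    for a tangential derivative.\<close>
  also have "cov A D q x (eta D') = cov A D q x (\<lambda>z. eta D z - nor z (U z))"
    by (rule cov_along[OF C q(2) x v(2) vector_field_diff[OF v(1,5)] q(1) order_refl eta_change])
  also have "\<dots> = cov A D q x (eta D) - (cov A D q x U - cov A D q x (\<lambda>z. P z (U z)))"
    using cov_diff[OF C v(1,5) q(1), of x] cov_diff[OF C v(3,4) q(1), of x] unfolding nor_def by simp
  finally have 1: "g q (cov A D' q x (eta D')) \<xi> = g q (cov A D q x (eta D)) \<xi> - g q (cov A D q x U) \<xi>
      + g q (cov A D q x (\<lambda>z. P z (U z))) \<xi> + g q (U q) x * g q (eta D' q) \<xi>"
    by (simp add: gm_linear_simps nx)
  have "g q (cov A D q x (\<lambda>z. P z (U z))) \<xi> = g q (II D q x (P q (U q))) \<xi>"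
    using nor_cov_tangent[OF C q(2) x v(4) q(1) order_refl P_tangent] g_nor_normal[OF q \<xi>] by metis
  also have "\<dots> = g q (beta D q x (P q (U q))) \<xi> + g q (U q) x * g q (eta D q) \<xi>"
    unfolding beta_def using g_P_tangent[OF q x, of "U q"] gm_sym[of a q x]
    by (simp add: gm_linear_simps)
  finally have 2: "g q (cov A D q x (\<lambda>z. P z (U z))) \<xi> = \<dots>" .
  have 3: "g q (eta D' q) \<xi> = g q (eta D q) \<xi> - g q (U q) \<xi>"
    unfolding eta_change[OF q] by (simp add: gm_linear_simps g_nor_normal[OF q \<xi>])
  show ?thesis
    unfolding cov_mean_curv_eq[OF W q x \<xi>] cov_mean_curv_eq[OF W' q x \<xi>] 1 2 3
      conn_form_change[OF q(1)] nabla_theta_def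
    by (simp add: algebra_simps)
qed

text \<open>On the normal bundle \<nabla>' adds just \<theta>(v), as v is tangent and orthogonal to
  the section; on TN the usual change formula holds with U replaced by P U. The product rule
  combines the two.\<close>

lemma cov_B0_change:
  assumes q: "q \<in> S" "q \<in> N" and x: "v \<in> TN q" "x \<in> TN q" "f \<in> TN q"
  defines "\<theta> \<equiv> g q (U q)"
  shows "cov_B0 A c n N D' q v x f - cov_B0 A c n N D q v x f =
    \<theta> v *\<^sub>R beta D q x f
    - beta D q (\<theta> v *\<^sub>R x + \<theta> x *\<^sub>R v - g q v x *\<^sub>R P q (U q)) f
    - beta D q x (\<theta> v *\<^sub>R f + \<theta> f *\<^sub>R v - g q v f *\<^sub>R P q (U q))"
proof -
  define Y where "Y = tan_ext A n N q x"
  define Z where "Z = tan_ext A n N q f"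
  define s where "s D = sec_ext A N q (\<lambda>w. B0 A c n N D w (Y w) (Z w))" for D
  obtain T where T: "q \<in> T" "T \<subseteq> S" "vector_field A T (s D)" "vector_field A T Y" "vector_field A T Z"
    "Y q = x" "Z q = f"
    "\<And>w. w \<in> T \<Longrightarrow> w \<in> N \<Longrightarrow> s D w = beta D w (Y w) (Z w)"
    "\<And>w. w \<in> T \<Longrightarrow> w \<in> N \<Longrightarrow> Y w \<in> TN w" "\<And>w. w \<in> T \<Longrightarrow> w \<in> N \<Longrightarrow> Z w \<in> TN w"
    by (rule sec_ext_B0[OF W q x(2,3), folded Y_def Z_def, folded s_def]) (rule that; assumption)
  obtain T' where T': "q \<in> T'" "T' \<subseteq> S" "vector_field A T' (s D')"
    "\<And>w. w \<in> T' \<Longrightarrow> w \<in> N \<Longrightarrow> s D' w = beta D' w (Y w) (Z w)"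
    by (rule sec_ext_B0[OF W' q x(2,3), folded Y_def Z_def, folded s_def]) (rule that; assumption)
  let ?T = "T \<inter> T'"
  have oT: "open ?T" using vector_field_open T(3) T'(3) by blast
  note lin = linear_add[OF nor_linear] linear_diff[OF nor_linear] linear_cmul[OF nor_linear]
  note linP = linear_add[OF P_linear] linear_diff[OF P_linear] linear_cmul[OF P_linear]
  have sq: "s D q = beta D q x f" using T(1,6,7) T(8)[OF T(1) q(2)] by simp
  \<comment> \<open>The two chosen extensions may differ away from \<open>N\<close>; on
    \<open>N\<close> both equal the invariant form \<open>beta\<close> on Y and Z.\<close>
  have "cov A D' q v (s D') = cov A D' q v (s D)"
  proof (rule cov_along[OF C' q(2) x(1)])
    show "vector_field A ?T (s D')" "vector_field A ?T (s D)"
      using vector_field_subset[OF T'(3) oT] vector_field_subset[OF T(3) oT] by auto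
    show "s D' w = s D w" if "w \<in> ?T" "w \<in> N" for w
      using T(8)[of w] T'(4)[of w] that beta_change[of w "Y w" "Z w"] T(2,9,10) by auto
  qed (use T T' in auto)
  also have "nor q \<dots> = nor q (cov A D q v (s D)) + \<theta> v *\<^sub>R beta D q x f"
    unfolding cov_change[OF q(1) T(3,1)] sq lin \<theta>_def nor_tangent[OF q x(1)] nor_id[OF q beta_normal[OF q]]
      tangent_normal[OF q(1) beta_normal[OF q] x(1)] by simp
  finally have 1: "nor q (cov A D' q v (s D')) = nor q (cov A D q v (s D)) + \<theta> v *\<^sub>R beta D q x f" .
  have 2: "P q (cov A D' q v Y) = P q (cov A D q v Y) + (\<theta> v *\<^sub>R x + \<theta> x *\<^sub>R v - g q v x *\<^sub>R P q (U q))"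
    unfolding cov_change[OF q(1) T(4,1)] linP \<theta>_def T(6) P_id[OF q x(1)] P_id[OF q x(2)] by simp
  have 3: "P q (cov A D' q v Z) = P q (cov A D q v Z) + (\<theta> v *\<^sub>R f + \<theta> f *\<^sub>R v - g q v f *\<^sub>R P q (U q))"
    unfolding cov_change[OF q(1) T(5,1)] linP \<theta>_def T(7) P_id[OF q x(1)] P_id[OF q x(3)] by simp
  have B: "B0 A c n N D q y z = beta D q y z" "B0 A c n N D' q y z = beta D q y z"
    if "y \<in> TN q" "z \<in> TN q" for y z
    using B0_eq[OF W q that] B0_eq[OF W' q that] beta_change[OF q that] unfolding beta_def by auto
  have cB: "cov_B0 A c n N D'' q v x f = nor q (cov A D'' q v (s D''))
      - beta D q (P q (cov A D'' q v Y)) f - beta D q x (P q (cov A D'' q v Z))"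
    if "D'' = D \<or> D'' = D'" for D''
    using that B[OF P_tangent[OF q] x(3)] B[OF x(2) P_tangent[OF q]]
    unfolding cov_B0_def Let_def Y_def[symmetric] Z_def[symmetric] s_def[symmetric]
      tan_part_eq[OF q] nor_part_eq[OF q] by auto
  show ?thesis
    using cB[of D] cB[of D'] unfolding 1 2 3
    by (simp add: linear_add[OF beta_linear(1)[OF C q(1)]] linear_add[OF beta_linear(2)[OF C q(1)]])
qed

text \<open>Sum \<open>cov_B0_change\<close> over an orthonormal basis, with \<tau> = P U: the
  products \<theta>(f) beta(x,f) occur with coefficients 1, -1 and -2, the metric terms give
  beta(\<tau>,x) and n times beta(x,\<tau>), and the trace term is zero. Symmetry of beta yields 1 -
  1 - 2 + 1 + n = n - 1.\<close>

lemma codiff_B0_change: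
  assumes q: "q \<in> S" "q \<in> N" and a_ref: "a = ref_chart A q" and x: "x \<in> TN q"
  shows "codiff_B0 A c n N D' q x - codiff_B0 A c n N D q x = (real n - 1) *\<^sub>R beta D q x (P q (U q))"
proof -
  \<comment> \<open>The basis chosen inside \<open>ctrace\<close> depends on c and the subspace
    only, so both codifferentials sum over the same one and can be compared termwise.\<close>
  define E where "E = (SOME E. E \<subseteq> TN q \<and> span E = TN q \<and>
    (\<forall>x\<in>E. \<forall>y\<in>E. c q x y = (if x = y then 1 else 0)))"
  have gc: "c q = g q" using gm_ref_chart a_ref by simp
  have "E \<subseteq> TN q \<and> span E = TN q \<and> (\<forall>x\<in>E. \<forall>y\<in>E. c q x y = (if x = y then 1 else 0))"
    unfolding E_def by (rule someI_ex) (use orthonormal_basis_exists[OF q] gc in simp)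
  then have E: "E \<subseteq> TN q" "span E = TN q" "\<And>x y. x \<in> E \<Longrightarrow> y \<in> E \<Longrightarrow> g q x y = (if x = y then 1 else 0)"
    unfolding gc by auto
  note l = beta_linear[OF C q(1)]
  let ?PU = "P q (U q)"
  have PU: "?PU \<in> TN q" by (rule P_tangent[OF q])
  have "codiff_B0 A c n N D' q x - codiff_B0 A c n N D q x =
      (\<Sum>f\<in>E. cov_B0 A c n N D' q f x f - cov_B0 A c n N D q f x f)"
    unfolding codiff_B0_def ctrace_def E_def[symmetric] by (simp add: sum_subtractf)
  also have "\<dots> = (\<Sum>f\<in>E. g q x f *\<^sub>R beta D q ?PU f - g q (U q) x *\<^sub>R beta D q f f
      - 2 *\<^sub>R (g q ?PU f *\<^sub>R beta D q x f) + beta D q x ?PU)"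
  proof (rule sum.cong[OF refl])
    fix f assume f: "f \<in> E"
    then have fT: "f \<in> TN q" using E(1) by blast
    have "g q (U q) f = g q ?PU f" "g q f x = g q x f" "g q f f = 1"
      using g_P_tangent[OF q fT] gm_sym E(3)[OF f f] by auto
    then show "cov_B0 A c n N D' q f x f - cov_B0 A c n N D q f x f =
        g q x f *\<^sub>R beta D q ?PU f - g q (U q) x *\<^sub>R beta D q f f
        - 2 *\<^sub>R (g q ?PU f *\<^sub>R beta D q x f) + beta D q x ?PU"
      unfolding cov_B0_change[OF q fT x fT]
      by (simp add: linear_add[OF l(1)] linear_add[OF l(2)] linear_diff[OF l(1)] linear_diff[OF l(2)]
          linear_cmul[OF l(1)] linear_cmul[OF l(2)] flip: scaleR_2)
  qed
  also have "\<dots> = beta D q ?PU x - 2 *\<^sub>R beta D q x ?PU + real n *\<^sub>R beta D q x ?PU"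
  proof -
    have "(\<Sum>f\<in>E. g q x f *\<^sub>R beta D q ?PU f) = beta D q ?PU x"
      by (rule orthonormnabla_theta_linear_sum[OF q E l(2) x])
    moreover have "(\<Sum>f\<in>E. g q ?PU f *\<^sub>R beta D q x f) = beta D q x ?PU"
      by (rule orthonormnabla_theta_linear_sum[OF q E l(2) PU])
    moreover have "(\<Sum>f\<in>E. beta D q f f) = 0"
      by (rule beta_trace[OF q E W])
    moreover have "card E = n"
      by (rule orthonormal_card[OF q E])
    ultimately show ?thesis
      unfolding sum.distrib sum_subtractf scaleR_sum_right[symmetric] sum_constant_scaleR by simp
  qed
  also have "\<dots> = (real n - 1) *\<^sub>R beta D q x ?PU"
    unfolding beta_sym[OF W q PU x] by (simp add: algebra_simps scaleR_2)
  finally show ?thesis .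
qed

lemma mixed_Schouten_Weyl_invariant:
  assumes q: "q \<in> S" "q \<in> N" and a_ref: "a = ref_chart A q" and x: "x \<in> TN q" and \<xi>: "\<xi> \<in> NN q"
    and m: "CARD('m) \<ge> 2"
  shows "mixed_Schouten_Weyl A c n N Mo D' q x \<xi> = mixed_Schouten_Weyl A c n N Mo D q x \<xi>"
proof -
  have gc: "c q = g q" using gm_ref_chart a_ref by simp
  have "c q x \<xi> = 0" using tangent_normal[OF q(1) \<xi> x] gc by simp
  note 1 = Schouten_Weyl_change[OF q(1) a_ref this m, of Mo]
  note 2 = cov_mean_curv_change[OF q x \<xi>]
  note 3 = codiff_B0_change[OF q a_ref x]
  have PU: "P q (U q) \<in> TN q" by (rule P_tangent[OF q])
  have 4: "g q (beta D q x (P q (U q))) \<xi> =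
      (if n = 1 then 0 else 1 / (real n - 1) * c q (codiff_B0 A c n N D' q x - codiff_B0 A c n N D q x) \<xi>)"
  proof (cases "n = 1")
    case True
    obtain E where "E \<subseteq> TN q" "span E = TN q"
      "\<And>x y. x \<in> E \<Longrightarrow> y \<in> E \<Longrightarrow> g q x y = (if x = y then 1 else 0)"
      using orthonormal_basis_exists[OF q] by metis
    from beta_curve[OF q this W True x PU] show ?thesis using True by (simp add: gm_linear_simps)
  next
    case False
    then show ?thesis unfolding 3 gc by (simp add: gm_linear_simps)
  qed
  show ?thesis
    using 1 2 4 unfolding mixed_Schouten_Weyl_def gc
    by (cases "n = 1") (simp_all add: gm_linear_simps right_diff_distrib)
qed

end

theorem proposition4p16:
  fixes A :: "('a::{t2_space,second_countable_topology}, 'm::finite) chart set"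
    and c :: "'a \<Rightarrow> real ^ 'm \<Rightarrow> real ^ 'm \<Rightarrow> real"
    and Mo :: "('a, 'm) density_op"
    and n :: nat and N :: "'a set"
    and D D' :: "('a, 'm) connection_op"
  assumes "smooth_manifold A"
    and "conformal_structure A c"
    and "1 \<le> n" and "n < CARD('m)"
    and "submanifold A n N"
    and "CARD('m) \<ge> 3 \<or> (CARD('m) = 2 \<and> Moebius_structure A c Mo)"
    and "Weyl_structure A c D" and "Weyl_structure A c D'"
  shows "\<forall>p\<in>N. \<forall>x\<in>tangent_bundle A n N p. \<forall>\<xi>\<in>normal_bundle A c n N p.
    mixed_Schouten_Weyl A c n N Mo D p x \<xi> = mixed_Schouten_Weyl A c n N Mo D' p x \<xi>"
proof (intro ballI)
  fix p x \<xi>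
  assume p: "p \<in> N" and x: "x \<in> tangent_bundle A n N p" and \<xi>: "\<xi> \<in> normal_bundle A c n N p"
  interpret conformal_mfd A c
    by unfold_locales fact+
  obtain b I where b: "slice_chart A n N b I" "p \<in> fst b"
    using assms(5) p unfolding submanifold_def by blast
  have bA: "b \<in> A" "card I = n" using b(1) unfolding slice_chart_def by auto
  let ?a = "ref_chart A p"
  let ?S = "fst ?a \<inter> fst b"
  have S: "open ?S" "?S \<subseteq> fst ?a" "?S \<subseteq> fst b" "p \<in> ?S"
    using ref_chart_open chart_homeo(1)[OF bA(1)] ref_chart(2) b(2) by auto
  let ?E = "\<lambda>i. coord_field A b (axis i 1)"
  obtain e where e: "orthogonalized ?a ?S ?E UNIV e" "orthogonalized ?a ?S ?E I e"
    using adapted_frame[OF ref_chart(1) bA(1) S(1-3)] by blast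
  interpret sub_weyl A c ?a ?S e D D' n N I
  proof unfold_locales
    show "tangent_bundle A n N q = span ((\<lambda>i. e i q) ` I)" if "q \<in> ?S" "q \<in> N" for q
      using tangent_bundle_slice[OF b(1) _ that(2)] span_coord_field[OF bA(1)] that(1)
        orthogonalizedD(4)[OF e(2) that(1)] by auto
  qed (use assms S ref_chart bA orthogonalizedD[OF e(1)] in auto)
  show "mixed_Schouten_Weyl A c n N Mo D p x \<xi> = mixed_Schouten_Weyl A c n N Mo D' p x \<xi>"
    by (rule mixed_Schouten_Weyl_invariant[OF S(4) p refl x \<xi>, symmetric]) (use assms in auto)
qed

end
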